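(* Let $\Omega\subseteq\mathbb{R}^N$, $N\ge2$, be a bounded domain and let $p,q:\overline\Omega\to[1,\infty)$ and $\mu:\overline\Omega\to[0,\infty)$ be Hölder continuous functions such that $1<p(x)\le q(x)$ for all $x\in\overline\Omega$ and $$\Big(\frac qp\Big)_+<1+\frac{\gamma}{N},$$ where $\gamma$ is the Hölder exponent of $\mu$. Then $\mathcal{H}_{\log}$ satisfies (A1), and $C^\infty(\Omega)\cap W^{1,\mathcal{H}_{\log}}(\Omega)$ is dense in $W^{1,\mathcal{H}_{\log}}(\Omega)$.
   Context: $(q/p)_+=\max_{x\in\overline\Omega}q(x)/p(x)$. Hölder exponents lie in $(0,1]$; $\mu$ has Hölder exponent $\gamma$ if $|\mu(x)-\mu(y)|\le c|x-y|^\gamma$ for some $c$ and all $x,y\in\overline\Omega$. Let $\mathcal{H}_{\log}(x,t)=t^{p(x)}+\mu(x)t^{q(x)}\log(e+t)$ for $x\in\overline\Omega$, $t\ge0$. For $\varphi:\Omega\times[0,\infty)\to[0,\infty]$ put $\varphi^{-1}(x,s)=\inf\{t\ge0:\varphi(x,t)\ge s\}$. $\varphi$ satisfies (A1) if there exists $0<\beta<1$ such that $\beta\varphi^{-1}(x,t)\le\varphi^{-1}(y,t)$ for every $t\in[1,1/|B|]$, for a.a. $x,y\in B\cap\Omega$ and for every ball $B$ with $|B|\le1$. For measurable $u$ set $\varrho_{\mathcal{H}_{\log}}(u)=\int_\Omega\mathcal{H}_{\log}(x,|u|)\,dx$; $L^{\mathcal{H}_{\log}}(\Omega)$ is the space of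 measurable $u:\Omega\to\mathbb{R}$ with $\varrho_{\mathcal{H}_{\log}}(u)<\infty$. $W^{1,\mathcal{H}_{\log}}(\Omega)=\{u\in L^{\mathcal{H}_{\log}}(\Omega): |\nabla u|\in L^{\mathcal{H}_{\log}}(\Omega)\}$ (weak gradient) with norm $\|u\|_{1,\mathcal{H}_{\log}}=\inf\{\lambda>0:\varrho_{\mathcal{H}_{\log}}(u/\lambda)+\varrho_{\mathcal{H}_{\log}}(|\nabla u|/\lambda)\le1\}$. *)

theory Defs
  imports "HOL-Analysis.Analysis"
begin

definition hoelder_on :: "real \<Rightarrow> 'a::metric_space set \<Rightarrow> ('a \<Rightarrow> real) \<Rightarrow> bool" where
  "hoelder_on \<gamma> S f \<longleftrightarrow> 0 < \<gamma> \<and> \<gamma> \<le> 1 \<and>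
     (\<exists>c. \<forall>x\<in>S. \<forall>y\<in>S. \<bar>f x - f y\<bar> \<le> c * dist x y powr \<gamma>)"

definition H_log :: "('a \<Rightarrow> real) \<Rightarrow> ('a \<Rightarrow> real) \<Rightarrow> ('a \<Rightarrow> real) \<Rightarrow> 'a \<Rightarrow> real \<Rightarrow> real" where
  "H_log p q \<mu> x t = t powr p x + \<mu> x * t powr q x * ln (exp 1 + t)"

text \<open>The inverse takes its values in the extended half-line: the infimum of the empty set is
  \<open>\<infinity>\<close>.\<close>

definition left_inverse :: "('a \<Rightarrow> real \<Rightarrow> ennreal) \<Rightarrow> 'a \<Rightarrow> real \<Rightarrow> ennreal" where
  "left_inverse \<phi> x s = Inf {ennreal t | t. 0 \<le> t \<and> \<phi> x t \<ge> ennreal s}"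

text \<open>"For almost all \<open>x, y\<close>" is read as: for all \<open>x, y\<close> outside a common Lebesgue null set, which
  may depend on the ball but not on \<open>t\<close>.\<close>

definition cond_A1 :: "'a::euclidean_space set \<Rightarrow> ('a \<Rightarrow> real \<Rightarrow> ennreal) \<Rightarrow> bool" where
  "cond_A1 \<Omega> \<phi> \<longleftrightarrow>
     (\<exists>\<beta>::real. 0 < \<beta> \<and> \<beta> < 1 \<and>
       (\<forall>z r. 0 < r \<and> measure lebesgue (ball z r) \<le> 1 \<longrightarrow>
         (\<exists>Z\<in>null_sets lebesgue. \<forall>x\<in>ball z r \<inter> \<Omega> - Z. \<forall>y\<in>ball z r \<inter> \<Omega> - Z.
            \<forall>t\<in>{1..1 / measure lebesgue (ball z r)}.
              ennreal \<beta> * left_inverse \<phi> x t \<le> left_inverse \<phi> y t)))"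

text \<open>On an open set \<open>S\<close>, the following predicate is the usual \<open>C\<^sup>k\<close>: a function is \<open>C\<^sup>k\<^sup>+\<^sup>1\<close> iff it is
  differentiable with all first partial derivatives of class \<open>C\<^sup>k\<close>.\<close>

primrec Ck_on :: "nat \<Rightarrow> 'a::euclidean_space set \<Rightarrow> ('a \<Rightarrow> real) \<Rightarrow> bool" where
  "Ck_on 0 S f \<longleftrightarrow> continuous_on S f"
| "Ck_on (Suc k) S f \<longleftrightarrow> (\<forall>x\<in>S. f differentiable (at x)) \<and>
     (\<forall>i\<in>Basis. Ck_on k S (\<lambda>x. frechet_derivative f (at x) i))"

definition Cinf_on :: "'a::euclidean_space set \<Rightarrow> ('a \<Rightarrow> real) \<Rightarrow> bool" where
  "Cinf_on S f \<longleftrightarrow> (\<forall>k. Ck_on k S f)"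

definition test_function :: "'a::euclidean_space set \<Rightarrow> ('a \<Rightarrow> real) \<Rightarrow> bool" where
  "test_function \<Omega> \<psi> \<longleftrightarrow> Cinf_on UNIV \<psi> \<and>
     compact (closure {x. \<psi> x \<noteq> 0}) \<and> closure {x. \<psi> x \<noteq> 0} \<subseteq> \<Omega>"

definition locally_integrable_on ::
    "'a::euclidean_space set \<Rightarrow> ('a \<Rightarrow> 'b::{banach, second_countable_topology}) \<Rightarrow> bool" where
  "locally_integrable_on \<Omega> f \<longleftrightarrow> (\<forall>K. compact K \<and> K \<subseteq> \<Omega> \<longrightarrow> set_integrable lebesgue K f)"

definition has_weak_gradient ::
    "'a::euclidean_space set \<Rightarrow> ('a \<Rightarrow> real) \<Rightarrow> ('a \<Rightarrow> 'a) \<Rightarrow> bool" where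
  "has_weak_gradient \<Omega> u G \<longleftrightarrow>
     locally_integrable_on \<Omega> u \<and> locally_integrable_on \<Omega> G \<and>
     (\<forall>\<psi>. test_function \<Omega> \<psi> \<longrightarrow> (\<forall>i\<in>Basis.
        (LINT x:\<Omega>|lebesgue. u x * frechet_derivative \<psi> (at x) i) =
        - (LINT x:\<Omega>|lebesgue. (G x \<bullet> i) * \<psi> x)))"

text \<open>A weak gradient on an open set is unique up to a null set, so the choice of representative
  affects neither the modular nor the norm below.\<close>

definition weak_gradient :: "'a::euclidean_space set \<Rightarrow> ('a \<Rightarrow> real) \<Rightarrow> 'a \<Rightarrow> 'a" where
  "weak_gradient \<Omega> u = (SOME G. has_weak_gradient \<Omega> u G)"

definition modular ::
    "'a::euclidean_space set \<Rightarrow> ('a \<Rightarrow> real \<Rightarrow> real) \<Rightarrow> ('a \<Rightarrow> real) \<Rightarrow> ennreal" where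
  "modular \<Omega> H u = (\<integral>\<^sup>+x\<in>\<Omega>. ennreal (H x \<bar>u x\<bar>) \<partial>lebesgue)"

text \<open>Functions are representatives on the whole space; only their values on \<open>\<Omega>\<close>, up to null sets,
  matter.\<close>

definition MO_space ::
    "'a::euclidean_space set \<Rightarrow> ('a \<Rightarrow> real \<Rightarrow> real) \<Rightarrow> ('a \<Rightarrow> real) set" where
  "MO_space \<Omega> H = {u. u \<in> borel_measurable (lebesgue_on \<Omega>) \<and> modular \<Omega> H u < \<infinity>}"

definition MO_Sobolev ::
    "'a::euclidean_space set \<Rightarrow> ('a \<Rightarrow> real \<Rightarrow> real) \<Rightarrow> ('a \<Rightarrow> real) set" where
  "MO_Sobolev \<Omega> H = {u \<in> MO_space \<Omega> H. (\<exists>G. has_weak_gradient \<Omega> u G) \<and>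
     (\<lambda>x. norm (weak_gradient \<Omega> u x)) \<in> MO_space \<Omega> H}"

definition MO_Sobolev_norm ::
    "'a::euclidean_space set \<Rightarrow> ('a \<Rightarrow> real \<Rightarrow> real) \<Rightarrow> ('a \<Rightarrow> real) \<Rightarrow> real" where
  "MO_Sobolev_norm \<Omega> H u = Inf {l. 0 < l \<and>
     modular \<Omega> H (\<lambda>x. u x / l) + modular \<Omega> H (\<lambda>x. norm (weak_gradient \<Omega> u x) / l) \<le> 1}"

end

theory Submission
  imports Defs
begin

text \<open>Both conclusions rest on one comparison between nearby points. Write \<open>H\<close> for the
  integrand and \<open>N\<close> for the dimension. If \<open>dist x y \<le> r\<close> and \<open>H y t\<close> is at most of order \<open>r\<^sup>-\<^sup>N\<close>,
  then \<open>H x t \<le> C * (1 + H y t)\<close> with \<open>C\<close> independent of \<open>x, y, r, t\<close> (\<open>H_log_comparison\<close>). The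
  size bound gives \<open>t \<lesssim> r\<^sup>-\<^sup>N\<close> for \<open>t \<ge> 1\<close>, so a change of the exponents by a power of \<open>r\<close> costs
  a bounded factor. Replacing \<open>\<mu> x\<close> by \<open>\<mu> y\<close> costs a term of order \<open>r\<^sup>\<gamma> t\<^sup>q log (e + t)\<close>. Since
  \<open>q \<le> \<kappa> p\<close>, this is \<open>t\<^sup>p\<close> times at most \<open>r\<^sup>\<gamma> (r\<^sup>-\<^sup>N)\<^sup>\<kappa>\<^sup>-\<^sup>1\<close> and a logarithm, and the strict
  inequality \<open>\<kappa> < 1 + \<gamma> / N\<close> leaves a positive power of \<open>r\<close> to absorb the logarithm.
  Condition (A1) is this comparison read through the left inverse
  (\<open>cond_A1_of_comparison\<close>).

  For the density, the comparison replaces Jensen's inequality. The modular of \<open>f\<close> bounds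
  the mollified \<open>H (\<cdot>, \<bar>f\<bar>)\<close> by a multiple of \<open>r\<^sup>-\<^sup>N\<close>, and because \<open>H x t / t\<close> is nondecreasing,
  some point near \<open>x\<close> has a small enough value of \<open>H\<close> at half of the mollified \<open>\<bar>f\<bar>\<close>. Hence \<open>H\<close>
  of the mollification of \<open>f\<close> is at most a constant times one plus the mollification of
  \<open>H (\<cdot>, \<bar>f\<bar>)\<close> (\<open>H_conv_le\<close>). The latter converges in \<open>L\<^sup>1\<close>, so dominated convergence makes the
  modular of the error tend to zero (\<open>modular_mollifier_tendsto\<close>).

  The rest is the construction of Meyers and Serrin (\<open>smooth_approximation\<close>): cut \<open>u\<close> into
  pieces \<open>\<zeta>\<^sub>k u\<close> by a partition of unity, mollify each piece with its own small radius, and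
  add up. The gradient of a mollified piece is the mollification of \<open>\<zeta>\<^sub>k \<nabla>u + u \<nabla>\<zeta>\<^sub>k\<close>
  (\<open>gradient_conv_cutoff\<close>), so the same modular estimate controls functions and gradients.
  The norm of \<open>u - v\<close> is defined through some weak gradient of \<open>u - v\<close>, which is compared
  with the one at hand by uniqueness (\<open>weak_gradient_unique\<close>).\<close>

section \<open>Smooth functions\<close>

lemma Ck_on_cong:
  assumes "open S" "\<And>x. x \<in> S \<Longrightarrow> f x = g x" "Ck_on k S f"
  shows "Ck_on k S g"
  using assms(2,3)
proof (induction k arbitrary: f g)
  case 0
  then show ?case using continuous_on_cong[of S S f g] by simp
next
  case (Suc k)
  have fd: "f differentiable (at x)" if "x \<in> S" for x
    using Suc.prems(2) that by simp
  have gd: "(g has_derivative frechet_derivative f (at x)) (at x)" if "x \<in> S" for x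
    by (rule has_derivative_transform_within_open[OF
          frechet_derivative_works[THEN iffD1, OF fd[OF that]] assms(1) that Suc.prems(1)])
  have eq: "frechet_derivative f (at x) = frechet_derivative g (at x)" if "x \<in> S" for x
    using frechet_derivative_at[OF gd[OF that]] .
  have "Ck_on k S (\<lambda>x. frechet_derivative g (at x) i)" if "i \<in> Basis" for i
    using Suc.IH[of "\<lambda>x. frechet_derivative f (at x) i" "\<lambda>x. frechet_derivative g (at x) i"]
      eq Suc.prems(2) that by simp
  then show ?case using gd differentiable_def by (auto simp: differentiable_def)
qed

lemma Ck_on_SucI:
  assumes "open S" "\<And>x. x \<in> S \<Longrightarrow> (f has_derivative f' x) (at x)"
    "\<And>i. i \<in> Basis \<Longrightarrow> Ck_on k S (\<lambda>x. f' x i)"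
  shows "Ck_on (Suc k) S f"
proof -
  have eq: "f' x = frechet_derivative f (at x)" if "x \<in> S" for x
    using frechet_derivative_at[OF assms(2)[OF that]] .
  have "Ck_on k S (\<lambda>x. frechet_derivative f (at x) i)" if "i \<in> Basis" for i
    by (rule Ck_on_cong[OF assms(1) _ assms(3)[OF that]]) (simp add: eq)
  then show ?thesis using assms(2) by (auto simp: differentiable_def)
qed

lemma Ck_on_imp_continuous_on: "Ck_on k S f \<Longrightarrow> continuous_on S f"
  by (cases k) (auto intro!: continuous_at_imp_continuous_on differentiable_imp_continuous_within)

lemma Ck_on_Suc_imp: "Ck_on (Suc k) S f \<Longrightarrow> Ck_on k S f"
proof (induction k arbitrary: f)
  case 0
  then show ?case using Ck_on_imp_continuous_on[of "Suc 0"] by simp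
next
  case (Suc k)
  then show ?case by (metis Ck_on.simps(2))
qed

lemma Ck_on_subset: "Ck_on k S f \<Longrightarrow> T \<subseteq> S \<Longrightarrow> Ck_on k T f"
  by (induction k arbitrary: f) (auto intro: continuous_on_subset)

text \<open>This reduces the smoothness of a locally finite infinite sum to that of finite sums.\<close>

lemma Ck_on_local:
  assumes "\<And>x. x \<in> S \<Longrightarrow> \<exists>U. open U \<and> x \<in> U \<and> Ck_on k U f"
  shows "Ck_on k S f"
  using assms
proof (induction k arbitrary: f)
  case 0
  have "continuous (at x) f" if x: "x \<in> S" for x
  proof -
    from 0[OF x] obtain U where "open U" "x \<in> U" "continuous_on U f" by auto
    then show ?thesis by (simp add: continuous_on_eq_continuous_at)
  qed
  then show ?case
    by (auto intro: continuous_at_imp_continuous_on)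
next
  case (Suc k)
  have "Ck_on k S (\<lambda>x. frechet_derivative f (at x) i)" if "i \<in> Basis" for i
    by (rule Suc.IH) (use Suc.prems that in fastforce)
  then show ?case using Suc.prems by fastforce
qed

lemma Ck_on_const: "Ck_on k S (\<lambda>x. c)"
proof (induction k arbitrary: c)
  case (Suc k)
  then show ?case by simp
qed simp

lemma Ck_on_add:
  assumes S: "open S" shows "Ck_on k S f \<Longrightarrow> Ck_on k S g \<Longrightarrow> Ck_on k S (\<lambda>x. f x + g x)"
proof (induction k arbitrary: f g)
  case 0
  then show ?case by (auto intro: continuous_on_add)
next
  case (Suc k)
  have d: "(f has_derivative frechet_derivative f (at x)) (at x)"
    "(g has_derivative frechet_derivative g (at x)) (at x)" if "x \<in> S" for x
    using Suc.prems that by (auto simp: frechet_derivative_works[symmetric])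
  show ?case
    by (rule Ck_on_SucI[OF S has_derivative_add[OF d]]) (use Suc in auto)
qed

lemma Ck_on_mult:
  assumes S: "open S" shows "Ck_on k S f \<Longrightarrow> Ck_on k S g \<Longrightarrow> Ck_on k S (\<lambda>x. f x * g x)"
proof (induction k arbitrary: f g)
  case 0
  then show ?case by (auto intro: continuous_on_mult)
next
  case (Suc k)
  have f: "Ck_on k S f" and g: "Ck_on k S g" using Suc.prems Ck_on_Suc_imp by blast+
  have d: "(f has_derivative frechet_derivative f (at x)) (at x)"
    "(g has_derivative frechet_derivative g (at x)) (at x)" if "x \<in> S" for x
    using Suc.prems that by (auto simp: frechet_derivative_works[symmetric])
  show ?case
  proof (rule Ck_on_SucI[OF S has_derivative_mult[OF d]])
    show "Ck_on k S (\<lambda>x. f x * frechet_derivative g (at x) i + frechet_derivative f (at x) i * g x)"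
      if "i \<in> Basis" for i
      by (intro Ck_on_add[OF S] Suc.IH f g) (use Suc.prems that in auto)
  qed (use Suc in auto)
qed

lemma Ck_on_minus:
  assumes S: "open S" "Ck_on k S f" "Ck_on k S g" shows "Ck_on k S (\<lambda>x. f x - g x)"
  using Ck_on_add[OF S(1,2) Ck_on_mult[OF S(1) Ck_on_const[of k S "-1"] S(3)]] by simp

lemma Ck_on_sum:
  assumes S: "open S" and "\<And>j. j \<in> J \<Longrightarrow> Ck_on k S (f j)"
  shows "Ck_on k S (\<lambda>x. \<Sum>j\<in>J. f j x)"
  using assms(2)
  by (induction J rule: infinite_finite_induct) (auto intro!: Ck_on_const Ck_on_add[OF S])

lemma Ck_on_affine:
  "Ck_on k UNIV f \<Longrightarrow> Ck_on k UNIV (\<lambda>x. f (c *\<^sub>R x + a))"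
proof (induction k arbitrary: f)
  case 0
  then show ?case by (auto intro!: continuous_on_compose2[of UNIV f] continuous_intros)
next
  case (Suc k)
  have d: "((\<lambda>x. f (c *\<^sub>R x + a)) has_derivative
      (\<lambda>h. frechet_derivative f (at (c *\<^sub>R x + a)) (c *\<^sub>R h))) (at x)" for x
  proof -
    have "f differentiable (at (c *\<^sub>R x + a))" using Suc.prems by simp
    then have D: "(f has_derivative frechet_derivative f (at (c *\<^sub>R x + a))) (at (c *\<^sub>R x + a))"
      using frechet_derivative_works by blast
    show ?thesis
      by (rule has_derivative_compose[of "\<lambda>x. c *\<^sub>R x + a", OF _ D])
        (auto intro!: derivative_eq_intros)
  qed
  show ?case
  proof (rule Ck_on_SucI[OF open_UNIV d])
    fix i :: 'a assume i: "i \<in> Basis"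
    have l: "linear (frechet_derivative f (at (c *\<^sub>R x + a)))" for x
      using Suc.prems by (intro linear_frechet_derivative) simp
    have "Ck_on k UNIV (\<lambda>x. c * frechet_derivative f (at (c *\<^sub>R x + a)) i)"
      by (intro Ck_on_mult Ck_on_const open_UNIV Suc.IH) (use Suc.prems i in auto)
    then show "Ck_on k UNIV (\<lambda>x. frechet_derivative f (at (c *\<^sub>R x + a)) (c *\<^sub>R i))"
      by (simp add: linear_cmul[OF l])
  qed
qed

lemma Ck_on_inner: "Ck_on k UNIV (\<lambda>x. x \<bullet> a)"
proof (cases k)
  case 0 then show ?thesis by (auto intro!: continuous_intros)
next
  case (Suc j)
  show ?thesis unfolding Suc
    by (rule Ck_on_SucI[where f' = "\<lambda>x h. h \<bullet> a"])
      (auto intro!: derivative_eq_intros Ck_on_const)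
qed

lemma Ck_on_inner_self: "Ck_on k UNIV (\<lambda>x::'a::euclidean_space. x \<bullet> x)"
proof -
  have "Ck_on k UNIV (\<lambda>x::'a. \<Sum>i\<in>Basis. (x \<bullet> i) * (x \<bullet> i))"
    by (intro Ck_on_sum Ck_on_mult Ck_on_inner open_UNIV)
  then show ?thesis by (simp add: euclidean_inner[symmetric])
qed

text \<open>Composition with a function all of whose derivatives stay in the span of one family \<open>h\<close>;
  the induction runs over all members of the family at once.\<close>

lemma Ck_on_compose_family:
  fixes h h' :: "nat \<Rightarrow> real \<Rightarrow> real"
  assumes h: "\<And>n t. (h n has_real_derivative a n * h (n+1) t + b n * h (n+2) t) (at t)"
    and f: "\<And>k. Ck_on k UNIV f"
  shows "Ck_on k UNIV (\<lambda>x. h n (f x))"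
proof (induction k arbitrary: n)
  case 0
  have "continuous_on UNIV (h n)"
    using h DERIV_isCont continuous_at_imp_continuous_on by blast
  then show ?case using f[of 0] by (auto intro: continuous_on_compose2)
next
  case (Suc k)
  have fd: "f differentiable (at x)" for x using f[of 1] by simp
  have d: "((\<lambda>x. h n (f x)) has_derivative
     (\<lambda>v. (a n * h (n+1) (f x) + b n * h (n+2) (f x)) * frechet_derivative f (at x) v)) (at x)" for x
    by (rule has_derivative_compose[of f _ x UNIV "h n", OF _
          h[of n "f x", unfolded has_field_derivative_def]])
      (use fd frechet_derivative_works in auto)
  show ?case
  proof (rule Ck_on_SucI[OF open_UNIV d])
    fix i :: 'a assume i: "i \<in> Basis"
    show "Ck_on k UNIV (\<lambda>x. (a n * h (n+1) (f x) + b n * h (n+2) (f x)) * frechet_derivative f (at x) i)"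
      by (intro Ck_on_mult Ck_on_add Ck_on_const open_UNIV Suc.IH) (use f[of "Suc k"] i in auto)
  qed
qed

text \<open>The member \<open>n = 0\<close> is the standard smooth function that vanishes for \<open>t \<le> 0\<close>. The factors
  \<open>t\<^sup>-\<^sup>n\<close> are there because the family is then closed under differentiation up to linear
  combinations.\<close>

definition flat_exp :: "nat \<Rightarrow> real \<Rightarrow> real" where
  "flat_exp n t = (if t \<le> 0 then 0 else (1 / t) ^ n * exp (- (1 / t)))"

lemma flat_exp_tendsto_0: "(flat_exp n \<longlongrightarrow> 0) (at 0)"
proof -
  have "((\<lambda>t::real. (1/t)^n * exp (-(1/t))) \<longlongrightarrow> 0) (at_right 0)"
  proof -
    have "((\<lambda>y::real. y^n * exp (-y)) \<longlongrightarrow> 0) at_top"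
      using tendsto_power_div_exp_0[of n] by (simp add: exp_minus field_simps)
    from filterlim_compose[OF this filterlim_inverse_at_top_right]
    show ?thesis by (simp add: inverse_eq_divide)
  qed
  then have R: "(flat_exp n \<longlongrightarrow> 0) (at_right 0)"
    by (rule Lim_transform_eventually)
      (auto simp: flat_exp_def eventually_at_filter)
  have L: "(flat_exp n \<longlongrightarrow> 0) (at_left 0)"
    by (rule tendsto_eventually) (auto simp: flat_exp_def eventually_at_filter)
  show ?thesis using L R filterlim_split_at by blast
qed

lemma DERIV_flat_exp:
  "(flat_exp n has_real_derivative - real n * flat_exp (n+1) t + 1 * flat_exp (n+2) t) (at t)"
proof (cases t "0::real" rule: linorder_cases)
  case less
  have "((\<lambda>_. 0) has_real_derivative 0) (at t)" by simp
  then have "(flat_exp n has_real_derivative 0) (at t)"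
    by (rule has_field_derivative_transform_within_open[where S="{..<0}"])
      (use less in \<open>auto simp: flat_exp_def\<close>)
  then show ?thesis using less by (simp add: flat_exp_def)
next
  case equal
  have "((\<lambda>h. (flat_exp n h - flat_exp n 0) / (h - 0)) \<longlongrightarrow> 0) (at 0)"
    by (rule Lim_transform_eventually[OF flat_exp_tendsto_0[of "n+1"]])
      (auto simp: flat_exp_def)
  then show ?thesis using equal
    by (simp add: has_field_derivative_iff flat_exp_def)
next
  case greater
  have "((\<lambda>t. (1 / t) ^ n * exp (- (1 / t))) has_real_derivative
      - real n * ((1/t)^(n+1) * exp (-(1/t))) + (1/t)^(n+2) * exp (-(1/t))) (at t)"
  proof -
    have s: "((\<lambda>t. 1 / t) has_real_derivative - ((1/t)^2)) (at t)"
      using greater by (auto intro!: derivative_eq_intros simp: power2_eq_square)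
    have "((\<lambda>t. (1 / t) ^ n * exp (- (1 / t))) has_real_derivative
        (real n * (- ((1/t)^2) * (1/t) ^ (n - Suc 0))) * exp (- (1/t)) +
        (exp (- (1/t)) * (- (- ((1/t)^2)))) * (1/t) ^ n) (at t)"
      by (intro DERIV_mult DERIV_power DERIV_fun_exp DERIV_minus s)
    moreover have "real n * (- (u^2) * u ^ (n - Suc 0)) = - real n * u^(n+1)" for u :: real
      by (cases n) (simp_all add: power2_eq_square algebra_simps)
    ultimately have "((\<lambda>t. (1 / t) ^ n * exp (- (1 / t))) has_real_derivative
        (- real n * (1/t)^(n+1)) * exp (- (1/t)) +
        (exp (- (1 / t)) * (- (- ((1/t)^2)))) * (1/t) ^ n) (at t)"
      by (simp only:)
    then show ?thesis by (simp only: mult_ac power_add minus_minus)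
  qed
  then have "(flat_exp n has_real_derivative
      - real n * ((1/t)^(n+1) * exp (-(1/t))) + (1/t)^(n+2) * exp (-(1/t))) (at t)"
    by (rule has_field_derivative_transform_within_open[where S="{0<..}"])
      (use greater in \<open>auto simp: flat_exp_def\<close>)
  then show ?thesis using greater by (simp add: flat_exp_def)
qed

definition bump :: "'a::euclidean_space \<Rightarrow> real" where
  "bump x = flat_exp 0 (1 - x \<bullet> x)"

lemma Ck_bump: "Ck_on k UNIV (bump :: 'a::euclidean_space \<Rightarrow> real)"
proof -
  have "Ck_on k UNIV (\<lambda>x::'a. 1 - x \<bullet> x)" for k
    by (intro Ck_on_minus Ck_on_const Ck_on_inner_self open_UNIV)
  then show ?thesis unfolding bump_def
    using Ck_on_compose_family[of flat_exp "\<lambda>n. - real n" "\<lambda>_. 1", OF DERIV_flat_exp] by blast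
qed

lemma bump_nonneg: "0 \<le> bump x" and bump_le_1: "bump x \<le> 1"
  by (auto simp: bump_def flat_exp_def)

lemma bump_eq_0: "1 \<le> norm x \<Longrightarrow> bump x = 0"
  by (simp add: bump_def flat_exp_def dot_square_norm)

lemma bump_ge: "norm x \<le> 1/2 \<Longrightarrow> exp (-2) \<le> bump x"
proof -
  assume "norm x \<le> 1/2"
  then have "x \<bullet> x \<le> (1/2)^2"
    unfolding dot_square_norm by (intro power_mono) auto
  then have *: "x \<bullet> x \<le> 1/2" by (simp add: power2_eq_square)
  then have "1 / (1 - x \<bullet> x) \<le> 2" by (simp add: field_simps)
  then show ?thesis using * by (simp add: bump_def flat_exp_def)
qed

text \<open>The normalising constant is kept as an integral; only a lower bound on it is ever
  needed, which avoids computing how it scales with \<open>r\<close>.\<close>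

definition mollifier :: "real \<Rightarrow> 'a::euclidean_space \<Rightarrow> real" where
  "mollifier r x = bump (x /\<^sub>R r) / (LINT y|lborel. bump ((y::'a) /\<^sub>R r))"

lemma Cinf_mollifier: "Cinf_on UNIV (mollifier r :: 'a::euclidean_space \<Rightarrow> real)"
  unfolding Cinf_on_def
proof
  fix k
  have "Ck_on k UNIV (\<lambda>x::'a. bump (inverse r *\<^sub>R x + 0) * (1 / (LINT y|lborel. bump (y /\<^sub>R r :: 'a))))"
    by (intro Ck_on_mult[OF open_UNIV Ck_on_affine[OF Ck_bump]] Ck_on_const)
  then show "Ck_on k UNIV (mollifier r :: 'a \<Rightarrow> real)"
    by (simp add: mollifier_def[abs_def])
qed

lemma integrable_bump: "r > 0 \<Longrightarrow> integrable lborel (\<lambda>y::'a::euclidean_space. bump (y /\<^sub>R r))"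
  and bump_integral_ge: "r > 0 \<Longrightarrow>
     exp (-2) * measure lborel (ball (0::'a) (r/2)) \<le> (LINT y|lborel. bump (y /\<^sub>R r :: 'a))"
proof -
  assume r: "r > 0"
  have c: "continuous_on UNIV (\<lambda>y::'a. bump (y /\<^sub>R r))"
    using Ck_on_affine[OF Ck_bump[of 0], of "inverse r" 0] by simp
  have "integrable lborel (\<lambda>y::'a. indicator (cball 0 r) y *\<^sub>R bump (y /\<^sub>R r))"
    by (rule borel_integrable_compact) (auto intro: continuous_on_subset[OF c])
  moreover have "indicator (cball 0 r) y *\<^sub>R bump (y /\<^sub>R r) = bump (y /\<^sub>R r)" for y :: 'a
    using r by (auto simp: indicator_def field_simps intro!: bump_eq_0)
  ultimately show i: "integrable lborel (\<lambda>y::'a. bump (y /\<^sub>R r))" by (simp only:)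
  have "exp (-2) * measure lborel (ball (0::'a) (r/2)) =
      (LINT y|lborel. indicator (ball (0::'a) (r/2)) y *\<^sub>R exp (-2))"
    by simp
  also have "\<dots> \<le> (LINT y|lborel. bump (y /\<^sub>R r :: 'a))"
  proof (rule integral_mono[OF _ i])
    show "indicator (ball 0 (r/2)) y *\<^sub>R exp (-2) \<le> bump (y /\<^sub>R r)" for y :: 'a
      using r bump_nonneg[of "y /\<^sub>R r"]
      by (auto simp: indicator_def field_simps intro!: bump_ge)
  qed (use emeasure_lborel_ball_finite[of "0::'a" "r/2"] in \<open>auto intro!: integrable_real_indicator\<close>)
  finally show "exp (-2) * measure lborel (ball (0::'a) (r/2)) \<le> (LINT y|lborel. bump (y /\<^sub>R r :: 'a))" .
qed

lemma measure_ball: "r \<ge> 0 \<Longrightarrow>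
    measure lborel (ball (x::'a::euclidean_space) r) = unit_ball_vol DIM('a) * r ^ DIM('a)"
  using content_ball by (metis measure_completion sets.top)

lemma bump_integral_pos: "r > 0 \<Longrightarrow> 0 < (LINT y|lborel. bump (y /\<^sub>R r :: 'a::euclidean_space))"
  using bump_integral_ge[of r, where 'a='a] by (simp add: measure_ball unit_ball_vol_pos
      less_le_trans[rotated])

lemma mollifier_nonneg: "r > 0 \<Longrightarrow> 0 \<le> mollifier r (x::'a::euclidean_space)"
  using bump_integral_pos[of r, where 'a='a] by (simp add: mollifier_def bump_nonneg)

lemma mollifier_eq_0: "r > 0 \<Longrightarrow> r \<le> norm x \<Longrightarrow> mollifier r x = 0"
  by (simp add: mollifier_def bump_eq_0 field_simps)

lemma integrable_mollifier: "r > 0 \<Longrightarrow> integrable lborel (mollifier r :: 'a::euclidean_space \<Rightarrow> real)"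
  unfolding mollifier_def[abs_def] using integrable_bump by (rule integrable_divide)

lemma integral_mollifier: "r > 0 \<Longrightarrow> (LINT x|lborel. mollifier r (x::'a::euclidean_space)) = 1"
  unfolding mollifier_def[abs_def] using bump_integral_pos[of r, where 'a='a] by simp

text \<open>On a ball of half the radius the bump is at least \<open>exp (-2)\<close>, so the normalising integral
  is at least of order \<open>r\<^sup>N\<close>.\<close>

lemma mollifier_le:
  "\<exists>B\<ge>0. \<forall>r>0. \<forall>x::'a::euclidean_space. mollifier r x \<le> B * (1/r) ^ DIM('a)"
proof -
  let ?c = "exp (-2) * unit_ball_vol DIM('a) / 2 ^ DIM('a)"
  have c: "?c > 0" by (simp add: unit_ball_vol_pos)
  have "mollifier r x \<le> (1 / ?c) * (1/r) ^ DIM('a)" if r: "r > 0" for r and x :: 'a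
  proof -
    have "?c * r ^ DIM('a) \<le> (LINT y|lborel. bump (y /\<^sub>R r :: 'a))"
      using bump_integral_ge[OF r, where 'a='a] r by (simp add: measure_ball power_divide)
    moreover have "?c * r ^ DIM('a) > 0" using c r by simp
    ultimately have "bump (x /\<^sub>R r) / (LINT y|lborel. bump (y /\<^sub>R r :: 'a)) \<le> 1 / (?c * r ^ DIM('a))"
      by (intro frac_le) (auto simp: bump_le_1)
    then show ?thesis by (simp add: mollifier_def power_divide)
  qed
  then show ?thesis using c by (intro exI[of _ "1 / ?c"]) auto
qed

section \<open>Test functions and convolution\<close>

lemma test_function_imp_Cinf: "test_function S \<psi> \<Longrightarrow> Cinf_on UNIV \<psi>"
  by (simp add: test_function_def)

lemma test_functionI:
  assumes "Cinf_on UNIV \<psi>" "compact K" "K \<subseteq> S" "\<And>x. x \<notin> K \<Longrightarrow> \<psi> x = 0"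
  shows "test_function S \<psi>"
proof -
  have "closure {x. \<psi> x \<noteq> 0} \<subseteq> K"
    using assms(2,4) by (intro closure_minimal) (auto intro: compact_imp_closed)
  moreover from this have "compact (closure {x. \<psi> x \<noteq> 0})"
    using closed_Int_compact[OF closed_closure assms(2)] by (metis Int_absorb2)
  ultimately show ?thesis using assms unfolding test_function_def by blast
qed

lemma test_functionE:
  assumes "test_function S \<psi>"
  obtains K where "compact K" "K \<subseteq> S" "\<And>x. x \<notin> K \<Longrightarrow> \<psi> x = 0"
  using assms that[of "closure {x. \<psi> x \<noteq> 0}"] closure_subset[of "{x. \<psi> x \<noteq> 0}"]
  unfolding test_function_def by blast

lemma Cinf_on_differentiable: "Cinf_on S f \<Longrightarrow> x \<in> S \<Longrightarrow> f differentiable (at x)"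
  unfolding Cinf_on_def by (metis Ck_on.simps(2))

lemma Cinf_on_has_derivative:
  "Cinf_on S f \<Longrightarrow> x \<in> S \<Longrightarrow> (f has_derivative frechet_derivative f (at x)) (at x)"
  using Cinf_on_differentiable frechet_derivative_works by blast

lemma Cinf_on_continuous_on: "Cinf_on S f \<Longrightarrow> continuous_on S f"
  unfolding Cinf_on_def using Ck_on.simps(1) by blast

lemma Cinf_on_deriv: "Cinf_on S f \<Longrightarrow> i \<in> Basis \<Longrightarrow> Cinf_on S (\<lambda>x. frechet_derivative f (at x) i)"
  unfolding Cinf_on_def by (metis Ck_on.simps(2))

lemma Cinf_on_mult: "open S \<Longrightarrow> Cinf_on S f \<Longrightarrow> Cinf_on S g \<Longrightarrow> Cinf_on S (\<lambda>x. f x * g x)"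
  unfolding Cinf_on_def using Ck_on_mult by blast

lemma frechet_derivative_eq_0_outside:
  assumes "closed K" "\<And>x. x \<notin> K \<Longrightarrow> \<psi> x = 0" "x \<notin> K"
  shows "frechet_derivative \<psi> (at x) = (\<lambda>_. 0)"
proof -
  have "((\<lambda>_. 0) has_derivative (\<lambda>_. 0)) (at x)" by simp
  then have "(\<psi> has_derivative (\<lambda>_. 0)) (at x)"
    by (rule has_derivative_transform_within_open[where s="- K"]) (use assms in auto)
  then show ?thesis by (metis frechet_derivative_at)
qed

lemma test_function_deriv:
  assumes "test_function S \<psi>" "i \<in> Basis"
  shows "test_function S (\<lambda>x. frechet_derivative \<psi> (at x) i)"
proof -
  obtain K where K: "compact K" "K \<subseteq> S" "\<And>x. x \<notin> K \<Longrightarrow> \<psi> x = 0"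
    using test_functionE[OF assms(1)] by metis
  show ?thesis
  proof (rule test_functionI[OF _ K(1,2)])
    show "Cinf_on UNIV (\<lambda>x. frechet_derivative \<psi> (at x) i)"
      using assms by (intro Cinf_on_deriv test_function_imp_Cinf)
    show "frechet_derivative \<psi> (at x) i = 0" if "x \<notin> K" for x
      using frechet_derivative_eq_0_outside[of K \<psi> x, OF compact_imp_closed[OF K(1)] K(3) that] by simp
  qed
qed

lemma test_function_bounded:
  assumes "test_function S \<psi>"
  obtains B where "B \<ge> 0" "\<And>x. \<bar>\<psi> x\<bar> \<le> B"
proof -
  obtain K where K: "compact K" "K \<subseteq> S" "\<And>x. x \<notin> K \<Longrightarrow> \<psi> x = 0"
    using test_functionE[OF assms(1)] by blast
  have "continuous_on K \<psi>"
    using Cinf_on_continuous_on[OF test_function_imp_Cinf[OF assms]] continuous_on_subset by blast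
  then have "bounded (\<psi> ` K)" using K(1) compact_continuous_image compact_imp_bounded by blast
  then obtain B where "B > 0" "\<And>x. x \<in> K \<Longrightarrow> norm (\<psi> x) \<le> B" by (auto simp: bounded_pos)
  then have "\<bar>\<psi> x\<bar> \<le> B" for x using K(3)[of x] by (cases "x \<in> K") auto
  then show ?thesis using \<open>B > 0\<close> that[of B] by auto
qed

lemma frechet_derivative_eq_sum:
  assumes "f differentiable (at x)"
  shows "frechet_derivative f (at x) h = (\<Sum>i\<in>Basis. (h \<bullet> i) * frechet_derivative f (at x) i)"
proof -
  have l: "linear (frechet_derivative f (at x))" by (rule linear_frechet_derivative[OF assms])
  have "frechet_derivative f (at x) (\<Sum>i\<in>Basis. (h \<bullet> i) *\<^sub>R i) =
      (\<Sum>i\<in>Basis. (h \<bullet> i) * frechet_derivative f (at x) i)"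
    by (simp add: linear_sum[OF l] linear_cmul[OF l])
  then show ?thesis by (simp add: euclidean_representation)
qed

text \<open>Gradient bound and Lipschitz bound with the same constant; together they dominate the
  difference quotients of a kernel.\<close>

lemma test_function_deriv_bounded:
  assumes "test_function S (\<psi> :: 'a::euclidean_space \<Rightarrow> real)"
  obtains L where "L \<ge> 0" "\<And>x h. \<bar>frechet_derivative \<psi> (at x) h\<bar> \<le> L * norm h"
    "\<And>x y. \<bar>\<psi> x - \<psi> y\<bar> \<le> L * norm (x - y)"
proof -
  have "\<forall>i\<in>Basis. \<exists>B\<ge>0. \<forall>x. \<bar>frechet_derivative \<psi> (at x) i\<bar> \<le> B"
    using test_function_bounded[OF test_function_deriv[OF assms]] by metis
  then obtain B where B: "\<And>i. i \<in> Basis \<Longrightarrow> B i \<ge> 0"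
    "\<And>i x. i \<in> Basis \<Longrightarrow> \<bar>frechet_derivative \<psi> (at x) i\<bar> \<le> B i" by metis
  let ?L = "\<Sum>i\<in>Basis. B i"
  have d: "\<psi> differentiable (at x)" for x
    using Cinf_on_differentiable[OF test_function_imp_Cinf[OF assms]] by simp
  have 1: "\<bar>frechet_derivative \<psi> (at x) h\<bar> \<le> ?L * norm h" for x h
  proof -
    have "\<bar>frechet_derivative \<psi> (at x) h\<bar> \<le> (\<Sum>i\<in>Basis. \<bar>(h \<bullet> i) * frechet_derivative \<psi> (at x) i\<bar>)"
      by (subst frechet_derivative_eq_sum[OF d]) (rule sum_abs)
    also have "\<dots> \<le> (\<Sum>i\<in>Basis. norm h * B i)"
      by (intro sum_mono) (auto simp: abs_mult intro!: mult_mono Basis_le_norm B)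
    finally show ?thesis by (simp add: sum_distrib_left mult.commute)
  qed
  have 2: "\<bar>\<psi> x - \<psi> y\<bar> \<le> ?L * norm (x - y)" for x y
  proof -
    have "norm (\<psi> x - \<psi> y) \<le> ?L * norm (x - y)"
    proof (rule differentiable_bound[of UNIV \<psi> "\<lambda>x. frechet_derivative \<psi> (at x)"])
      show "onorm (frechet_derivative \<psi> (at x)) \<le> ?L" for x
        by (rule onorm_le) (use 1 in auto)
    qed (use d in \<open>auto simp: frechet_derivative_works[symmetric]\<close>)
    then show ?thesis by simp
  qed
  show ?thesis using that[of ?L] 1 2 B(1) by (simp add: sum_nonneg)
qed

text \<open>The integral is taken over \<open>lebesgue\<close>, so that \<open>f\<close> may be any Lebesgue measurable function;
  it may also be vector valued, so that a function and its gradient can be mollified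
  together.\<close>

definition conv :: "('a::euclidean_space \<Rightarrow> real) \<Rightarrow> ('a \<Rightarrow> 'b::euclidean_space) \<Rightarrow> 'a \<Rightarrow> 'b" where
  "conv \<eta> f x = (LINT y|lebesgue. \<eta> (x - y) *\<^sub>R f y)"

lemma borel_measurable_lebesgue: "f \<in> borel_measurable borel \<Longrightarrow> f \<in> borel_measurable lebesgue"
  by (intro measurable_completion) simp

lemma continuous_borel_measurable_lebesgue:
  "continuous_on UNIV f \<Longrightarrow> f \<in> borel_measurable lebesgue"
  by (intro borel_measurable_lebesgue borel_measurable_continuous_onI)

lemma integrable_bounded_scaleR:
  fixes f :: "'a \<Rightarrow> 'b::{banach, second_countable_topology}"
  assumes "integrable M f" "g \<in> borel_measurable M" "\<And>x. \<bar>g x\<bar> \<le> B"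
  shows "integrable M (\<lambda>x. g x *\<^sub>R f x)"
proof (rule Bochner_Integration.integrable_bound)
  show "integrable M (\<lambda>x. B * norm (f x))" using assms(1) by simp
  show "(\<lambda>x. g x *\<^sub>R f x) \<in> borel_measurable M" using assms by measurable
  have "\<bar>g x\<bar> * norm (f x) \<le> \<bar>B\<bar> * norm (f x)" for x
    using assms(3)[of x] by (intro mult_right_mono) auto
  then show "AE x in M. norm (g x *\<^sub>R f x) \<le> norm (B * norm (f x))"
    by (simp add: abs_mult)
qed

lemma measurable_kernel_shift:
  fixes \<eta> :: "'a::euclidean_space \<Rightarrow> real"
  shows "continuous_on UNIV \<eta> \<Longrightarrow> (\<lambda>y. \<eta> (x - y)) \<in> borel_measurable lebesgue"
  by (intro continuous_borel_measurable_lebesgue)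
    (auto intro!: continuous_on_compose2[of UNIV \<eta>] continuous_intros)

lemma integrable_conv:
  fixes f :: "'a::euclidean_space \<Rightarrow> 'b::euclidean_space"
  assumes "test_function UNIV \<eta>" "integrable lebesgue f"
  shows "integrable lebesgue (\<lambda>y. \<eta> (x - y) *\<^sub>R f y)"
proof -
  obtain B where "\<And>x. \<bar>\<eta> x\<bar> \<le> B" using test_function_bounded[OF assms(1)] by blast
  moreover have "(\<lambda>y. \<eta> (x - y)) \<in> borel_measurable lebesgue"
    using assms(1) by (intro measurable_kernel_shift Cinf_on_continuous_on test_function_imp_Cinf)
  ultimately show ?thesis using assms(2) by (intro integrable_bounded_scaleR) auto
qed

text \<open>Differentiation under the integral: the difference quotients of the kernel converge
  pointwise and are bounded because the kernel is Lipschitz, so dominated convergence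
  applies for a merely integrable \<open>f\<close>.\<close>

lemma conv_has_derivative:
  fixes f :: "'a::euclidean_space \<Rightarrow> 'b::euclidean_space"
  assumes \<eta>: "test_function UNIV \<eta>" and f: "integrable lebesgue f"
  shows "(conv \<eta> f has_derivative
      (\<lambda>h. \<Sum>i\<in>Basis. (h \<bullet> i) *\<^sub>R conv (\<lambda>z. frechet_derivative \<eta> (at z) i) f x)) (at x)"
    (is "(_ has_derivative ?D) _")
  unfolding has_derivative_at
proof
  show "bounded_linear ?D"
    by (intro bounded_linear_sum bounded_linear_scaleR_const bounded_linear_inner_left)
next
  obtain L where L: "L \<ge> 0" "\<And>x h. \<bar>frechet_derivative \<eta> (at x) h\<bar> \<le> L * norm h"
    "\<And>x y. \<bar>\<eta> x - \<eta> y\<bar> \<le> L * norm (x - y)"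
    using test_function_deriv_bounded[OF \<eta>] by blast
  have d: "\<eta> differentiable (at z)" for z
    using Cinf_on_differentiable[OF test_function_imp_Cinf[OF \<eta>]] by simp
  have int_d: "integrable lebesgue (\<lambda>y. frechet_derivative \<eta> (at (x - y)) i *\<^sub>R f y)" if "i \<in> Basis" for i
    by (rule integrable_conv[OF test_function_deriv[OF \<eta> that] f])
  have D_eq: "?D h = (LINT y|lebesgue. frechet_derivative \<eta> (at (x - y)) h *\<^sub>R f y)" 
   and D_int: "integrable lebesgue (\<lambda>y. frechet_derivative \<eta> (at (x - y)) h *\<^sub>R f y)" for h
  proof -
    have *: "frechet_derivative \<eta> (at (x - y)) h *\<^sub>R f y =
       (\<Sum>i\<in>Basis. (h \<bullet> i) *\<^sub>R (frechet_derivative \<eta> (at (x - y)) i *\<^sub>R f y))" for y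
      by (subst frechet_derivative_eq_sum[OF d]) (simp add: scaleR_sum_left del: scaleR_scaleR flip: scaleR_scaleR)
    show "integrable lebesgue (\<lambda>y. frechet_derivative \<eta> (at (x - y)) h *\<^sub>R f y)"
      unfolding * by (intro Bochner_Integration.integrable_sum integrable_scaleR_right int_d)
    show "?D h = (LINT y|lebesgue. frechet_derivative \<eta> (at (x - y)) h *\<^sub>R f y)"
      unfolding * conv_def
      by (subst Bochner_Integration.integral_sum)
        (auto intro!: integrable_scaleR_right int_d simp del: scaleR_scaleR)
  qed
  show "(\<lambda>h. norm (conv \<eta> f (x + h) - conv \<eta> f x - ?D h) / norm h) \<midarrow>0\<rightarrow> 0"
    unfolding tendsto_at_iff_sequentially
  proof (intro allI impI)
    fix X :: "nat \<Rightarrow> 'a" assume X: "\<forall>n. X n \<in> UNIV - {0}" "X \<longlonglongrightarrow> 0"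
    define g where "g n y = ((\<eta> (x + X n - y) - \<eta> (x - y) - frechet_derivative \<eta> (at (x - y)) (X n))
        / norm (X n)) *\<^sub>R f y" for n y
    have g_int: "integrable lebesgue (g n)" and
      g_eq: "(LINT y|lebesgue. g n y) = (conv \<eta> f (x + X n) - conv \<eta> f x - ?D (X n)) /\<^sub>R norm (X n)" for n
    proof -
      have *: "g n y = (\<eta> (x + X n - y) *\<^sub>R f y - \<eta> (x - y) *\<^sub>R f y
          - frechet_derivative \<eta> (at (x - y)) (X n) *\<^sub>R f y) /\<^sub>R norm (X n)" for y
        by (simp add: g_def scaleR_diff_left[symmetric] divide_inverse mult.commute)
      note i = integrable_conv[OF \<eta> f, of "x + X n"] integrable_conv[OF \<eta> f, of x] D_int[of "X n"]
      show "integrable lebesgue (g n)" unfolding *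
        by (intro integrable_scaleR_right Bochner_Integration.integrable_diff i)
      have "(LINT y|lebesgue. g n y) = (conv \<eta> f (x + X n) - conv \<eta> f x
          - (LINT y|lebesgue. frechet_derivative \<eta> (at (x - y)) (X n) *\<^sub>R f y)) /\<^sub>R norm (X n)"
        unfolding * conv_def using i by simp
      then show "(LINT y|lebesgue. g n y) = (conv \<eta> f (x + X n) - conv \<eta> f x - ?D (X n)) /\<^sub>R norm (X n)"
        by (simp only: D_eq)
    qed
    have "(\<lambda>n. integral\<^sup>L lebesgue (g n)) \<longlonglongrightarrow> integral\<^sup>L lebesgue (\<lambda>_::'a. 0::'b)"
    proof (rule integral_dominated_convergence[where w="\<lambda>y. 2 * L * norm (f y)"])
      show "integrable lebesgue (\<lambda>y. 2 * L * norm (f y))" using f by simp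
      show "g n \<in> borel_measurable lebesgue" for n using g_int by auto
      show "AE y in lebesgue. norm (g n y) \<le> 2 * L * norm (f y)" for n
      proof (rule AE_I2)
        fix y
        have "\<bar>\<eta> (x + X n - y) - \<eta> (x - y) - frechet_derivative \<eta> (at (x - y)) (X n)\<bar>
          \<le> L * norm (X n) + L * norm (X n)"
          using L(3)[of "x + X n - y" "x - y"] L(2)[of "x - y" "X n"] by simp
        then have "\<bar>\<eta> (x + X n - y) - \<eta> (x - y) - frechet_derivative \<eta> (at (x - y)) (X n)\<bar> / norm (X n)
          \<le> 2 * L" using X(1) by (simp add: divide_le_eq)
        then have "(\<bar>\<eta> (x + X n - y) - \<eta> (x - y) - frechet_derivative \<eta> (at (x - y)) (X n)\<bar> / norm (X n))
          * norm (f y) \<le> 2 * L * norm (f y)" by (intro mult_right_mono) auto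
        then show "norm (g n y) \<le> 2 * L * norm (f y)" by (simp add: g_def)
      qed
      show "AE y in lebesgue. (\<lambda>n. g n y) \<longlonglongrightarrow> 0"
      proof (rule AE_I2)
        fix y
        have "(\<lambda>h. norm (\<eta> ((x - y) + h) - \<eta> (x - y) - frechet_derivative \<eta> (at (x - y)) h) / norm h) \<midarrow>0\<rightarrow> 0"
          using d[of "x - y"] unfolding frechet_derivative_works has_derivative_at by blast
        then have "((\<lambda>h. norm (\<eta> ((x - y) + h) - \<eta> (x - y) - frechet_derivative \<eta> (at (x - y)) h) / norm h)
           \<circ> X) \<longlonglongrightarrow> 0"
          unfolding tendsto_at_iff_sequentially using X by blast
        then have "(\<lambda>n. norm (\<eta> (x + X n - y) - \<eta> (x - y) - frechet_derivative \<eta> (at (x - y)) (X n)) / norm (X n) * norm (f y))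
            \<longlonglongrightarrow> 0 * norm (f y)"
          by (intro tendsto_mult tendsto_const) (simp add: o_def algebra_simps)
        then have "(\<lambda>n. norm (g n y)) \<longlonglongrightarrow> 0" by (simp add: g_def)
        then show "(\<lambda>n. g n y) \<longlonglongrightarrow> 0" by (simp add: tendsto_norm_zero_iff)
      qed
    qed simp
    then have "(\<lambda>n. norm (LINT y|lebesgue. g n y)) \<longlonglongrightarrow> 0"
      by (simp add: tendsto_norm_zero)
    then show "((\<lambda>h. norm (conv \<eta> f (x + h) - conv \<eta> f x - ?D h) / norm h) \<circ> X) \<longlonglongrightarrow> 0"
      by (simp add: g_eq o_def divide_inverse mult.commute)
  qed
qed

lemma conv_deriv:
  fixes f :: "'a::euclidean_space \<Rightarrow> 'b::euclidean_space"
  assumes \<eta>: "test_function UNIV \<eta>" and f: "integrable lebesgue f" and "i \<in> Basis"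
  shows "frechet_derivative (conv \<eta> f) (at x) i = conv (\<lambda>z. frechet_derivative \<eta> (at z) i) f x"
proof -
  have "frechet_derivative (conv \<eta> f) (at x) i =
      (\<Sum>j\<in>Basis. (i \<bullet> j) *\<^sub>R conv (\<lambda>z. frechet_derivative \<eta> (at z) j) f x)"
    by (subst frechet_derivative_at[OF conv_has_derivative[OF \<eta> f, of x], symmetric]) (rule refl)
  also have "\<dots> = (\<Sum>j\<in>Basis. if j = i then conv (\<lambda>z. frechet_derivative \<eta> (at z) i) f x else 0)"
    using assms(3) by (intro sum.cong) (auto simp: inner_Basis)
  finally show ?thesis using assms(3) by simp
qed

lemma continuous_on_conv:
  assumes "test_function UNIV \<eta>" "integrable lebesgue f"
  shows "continuous_on S (conv \<eta> f)"
  by (intro continuous_at_imp_continuous_on ballI has_derivative_continuous[OF conv_has_derivative[OF assms]])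

text \<open>All derivatives fall on the kernel, whose partial derivatives are test functions again.\<close>

lemma Cinf_conv:
  fixes f :: "'a::euclidean_space \<Rightarrow> real"
  assumes "test_function UNIV \<eta>" and f: "integrable lebesgue f"
  shows "Cinf_on UNIV (conv \<eta> f)"
proof -
  have "Ck_on k UNIV (conv \<eta> f)" for k
    using assms(1)
  proof (induction k arbitrary: \<eta>)
    case 0
    then show ?case using continuous_on_conv f by simp
  next
    case (Suc k)
    have "conv \<eta> f differentiable (at x)" for x
      unfolding differentiable_def by (rule exI, rule conv_has_derivative[OF Suc.prems f])
    moreover have "Ck_on k UNIV (\<lambda>x. frechet_derivative (conv \<eta> f) (at x) i)" if i: "i \<in> Basis" for i
      using Suc.IH[OF test_function_deriv[OF Suc.prems i]] by (simp add: conv_deriv[OF Suc.prems f i])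
    ultimately show ?case by simp
  qed
  then show ?thesis by (simp add: Cinf_on_def)
qed

lemma test_function_mollifier: "r > 0 \<Longrightarrow> test_function UNIV (mollifier r :: 'a::euclidean_space \<Rightarrow> real)"
  by (rule test_functionI[of _ "cball 0 r"]) (auto simp: Cinf_mollifier mollifier_eq_0)

section \<open>Mollification converges in the mean\<close>

lemma lborel_distr_minus: "distr lborel borel (\<lambda>z. x - z) = (lborel :: 'a::euclidean_space measure)"
  by (subst (2) lborel_affine[of "-1" x]) (auto simp: density_1)

lemma nn_integral_reflect:
  assumes [measurable]: "g \<in> borel_measurable borel"
  shows "(\<integral>\<^sup>+y. g (x - y :: 'a::euclidean_space) \<partial>lborel) = (\<integral>\<^sup>+y. g y \<partial>lborel)"
  by (subst (2) lborel_distr_minus[of x, symmetric]) (simp add: nn_integral_distr)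

lemma nn_integral_translate:
  assumes [measurable]: "g \<in> borel_measurable borel"
  shows "(\<integral>\<^sup>+y. g (y - x :: 'a::euclidean_space) \<partial>lborel) = (\<integral>\<^sup>+y. g y \<partial>lborel)"
  by (subst (2) lborel_distr_plus[of "- x", symmetric]) (simp add: nn_integral_distr)

text \<open>Enclose \<open>A\<close> in an open set \<open>U\<close> with little excess. A point of \<open>A\<close> that leaves \<open>A\<close> under the
  shift either leaves \<open>U\<close>, and then was close to the boundary of \<open>U\<close>, or lands in the excess.
  Points of \<open>U\<close> close to the boundary have small measure because \<open>U\<close> has finite measure.\<close>

lemma emeasure_shift_small:
  fixes A :: "'a::euclidean_space set"
  assumes A: "A \<in> sets borel" "emeasure lborel A < \<infinity>" and e: "e > 0"
  shows "\<exists>d>0. \<forall>h. norm h < d \<longrightarrow> emeasure lborel {x\<in>A. x - h \<notin> A} \<le> ennreal e"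
proof -
  obtain U where U: "open U" "A \<subseteq> U" "emeasure lborel (U - A) < ennreal (e/2)"
    using outer_regular_lborel[OF A(1), of "e/2"] e by auto
  have [measurable]: "A \<in> sets borel" "U \<in> sets borel" using A U by auto
  have Ufin: "emeasure lborel U < \<infinity>"
  proof -
    have "emeasure lborel U = emeasure lborel (U - A) + emeasure lborel A"
      using U(2) by (subst plus_emeasure) (auto simp: Un_absorb2)
    then show ?thesis using A(2) less_trans[OF U(3) ennreal_less_top] by simp
  qed
  then have "U \<noteq> UNIV" by auto
  then have ne: "- U \<noteq> {}" by auto
  define E where "E n = {x\<in>U. infdist x (- U) \<le> 1 / real (Suc n)}" for n
  have [measurable]: "(\<lambda>x. infdist x (- U)) \<in> borel_measurable borel"
    by (intro borel_measurable_continuous_onI continuous_intros)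
  have [measurable]: "E n \<in> sets borel" for n unfolding E_def by measurable
  have "(\<lambda>n. emeasure lborel (E n)) \<longlonglongrightarrow> emeasure lborel (\<Inter>n. E n)"
  proof (rule Lim_emeasure_decseq)
    show "decseq E"
      by (auto simp: E_def decseq_def intro: order_trans[OF _ frac_le])
    show "emeasure lborel (E i) \<noteq> \<infinity>" for i
      using Ufin emeasure_mono[of "E i" U lborel] by (auto simp: E_def top_unique)
  qed auto
  moreover have "(\<Inter>n. E n) = {}"
  proof -
    have False if x: "\<And>n. x \<in> E n" for x
    proof -
      have "x \<in> U" using x[of 0] by (simp add: E_def)
      then have "infdist x (- U) > 0"
        using U(1) ne infdist_pos_not_in_closed[of "- U" x] by auto
      then obtain n where "1 / real (Suc n) < infdist x (- U)"
        using nat_approx_posE by (metis of_nat_Suc)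
      then show False using x[of n] by (auto simp: E_def)
    qed
    then show ?thesis by auto
  qed
  ultimately have "(\<lambda>n. emeasure lborel (E n)) \<longlonglongrightarrow> 0" by simp
  moreover have "0 < ennreal (e/2)" using e by simp
  ultimately have "\<forall>\<^sub>F n in sequentially. emeasure lborel (E n) < ennreal (e/2)"
    by (rule order_tendstoD(2))
  then obtain n where n: "emeasure lborel (E n) < ennreal (e/2)"
    by (auto simp: eventually_sequentially)
  show ?thesis
  proof (intro exI[of _ "1 / real (Suc n)"] conjI allI impI)
    fix h :: 'a assume h: "norm h < 1 / real (Suc n)"
    have sub: "{x\<in>A. x - h \<notin> A} \<subseteq> E n \<union> {x. x - h \<in> U - A}"
    proof
      fix x assume "x \<in> {x\<in>A. x - h \<notin> A}"
      then have x: "x \<in> A" "x - h \<notin> A" by auto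
      show "x \<in> E n \<union> {x. x - h \<in> U - A}"
      proof (cases "x - h \<in> U")
        case False
        then have "infdist x (- U) \<le> dist x (x - h)" by (intro infdist_le) auto
        then show ?thesis using x U(2) h by (auto simp: E_def dist_norm)
      qed (use x in auto)
    qed
    have "emeasure lborel {x. x - h \<in> U - A} = (\<integral>\<^sup>+x. indicator (U - A) (x - h) \<partial>lborel)"
    proof -
      have "{x. x - h \<in> U - A} \<in> sets borel" by measurable
      then have "emeasure lborel {x. x - h \<in> U - A} = (\<integral>\<^sup>+x. indicator {x. x - h \<in> U - A} x \<partial>lborel)" by simp
      then show ?thesis by (simp add: indicator_def)
    qed
    also have "\<dots> = emeasure lborel (U - A)"
      by (subst nn_integral_translate) auto
    finally have sh: "emeasure lborel {x. x - h \<in> U - A} < ennreal (e/2)" using U(3) by simp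
    have "emeasure lborel {x\<in>A. x - h \<notin> A} \<le> emeasure lborel (E n \<union> {x. x - h \<in> U - A})"
      by (intro emeasure_mono sub) measurable
    also have "\<dots> \<le> emeasure lborel (E n) + emeasure lborel {x. x - h \<in> U - A}"
      by (intro emeasure_subadditive) measurable
    also have "\<dots> \<le> ennreal (e/2) + ennreal (e/2)"
      using n sh by (intro add_mono less_imp_le)
    also have "\<dots> = ennreal e" using e by (simp flip: ennreal_plus)
    finally show "emeasure lborel {x\<in>A. x - h \<notin> A} \<le> ennreal e" .
  qed simp
qed

text \<open>Continuity of translations in \<open>L\<^sup>1\<close>, from indicators via the previous lemma, then by
  linearity and approximation.\<close>

lemma L1_translation_continuous:
  fixes f :: "'a::euclidean_space \<Rightarrow> 'b::euclidean_space"
  assumes "integrable lborel f"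
  shows "e > 0 \<Longrightarrow>
    \<exists>d>0. \<forall>h. norm h < d \<longrightarrow> (\<integral>\<^sup>+x. norm (f (x - h) - f x) \<partial>lborel) \<le> ennreal e"
  using assms
proof (induction arbitrary: e rule: integrable_induct)
  case (base A c)
  have [measurable]: "A \<in> sets borel" using base by simp
  define e' where "e' = e / (2 * (norm c + 1))"
  have e': "e' > 0" using base(3) norm_ge_zero[of c] by (auto simp: e'_def intro!: divide_pos_pos add_nonneg_pos)
  obtain d where d: "d > 0" "\<And>h. norm h < d \<Longrightarrow> emeasure lborel {x\<in>A. x - h \<notin> A} \<le> ennreal e'"
    using emeasure_shift_small[OF _ _ e', of A] base by auto
  show ?case
  proof (intro exI[of _ d] conjI allI impI d(1))
    fix h :: 'a assume h: "norm h < d"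
    have m: "indicator {x\<in>A. x - (- h) \<notin> A} \<in> borel_measurable borel" by measurable
    have "(\<integral>\<^sup>+x. norm (indicator A (x - h) *\<^sub>R c - indicator A x *\<^sub>R c) \<partial>lborel) =
       (\<integral>\<^sup>+x. ennreal (norm c) * (indicator {x\<in>A. x - h \<notin> A} x + indicator {x\<in>A. x - (- h) \<notin> A} (x - h)) \<partial>lborel)"
      by (intro nn_integral_cong) (auto simp: indicator_def)
    also have "\<dots> = ennreal (norm c) * ((\<integral>\<^sup>+x. indicator {x\<in>A. x - h \<notin> A} x \<partial>lborel) +
       (\<integral>\<^sup>+x. indicator {x\<in>A. x - (- h) \<notin> A} (x - h) \<partial>lborel))"
      by (subst nn_integral_cmult, measurable, subst nn_integral_add, measurable)
    also have "\<dots> = ennreal (norm c) * ((\<integral>\<^sup>+x. indicator {x\<in>A. x - h \<notin> A} x \<partial>lborel) +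
       (\<integral>\<^sup>+x. indicator {x\<in>A. x - (- h) \<notin> A} x \<partial>lborel))"
      by (simp only: nn_integral_translate[OF m])
    also have "\<dots> \<le> ennreal (norm c) * (ennreal e' + ennreal e')"
      using d(2)[OF h] d(2)[of "- h"] h
      by (intro mult_left_mono add_mono) (auto simp: nn_integral_indicator)
    also have "\<dots> = ennreal (norm c * (2 * e'))"
      using e' by (simp flip: ennreal_plus ennreal_mult)
    also have "\<dots> \<le> ennreal e"
    proof (rule ennreal_leI)
      have "norm c * (2 * e') = e * (norm c / (norm c + 1))"
      proof -
        have "norm c + 1 \<noteq> 0" using norm_ge_zero[of c] by linarith
        then show ?thesis unfolding e'_def by (simp add: field_simps)
      qed
      also have "\<dots> \<le> e * 1" using base(3)
        by (intro mult_left_mono) (auto simp: divide_le_eq add_nonneg_pos)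
      finally show "norm c * (2 * e') \<le> e" by simp
    qed
    finally show "(\<integral>\<^sup>+x. norm (indicator A (x - h) *\<^sub>R c - indicator A x *\<^sub>R c) \<partial>lborel) \<le> ennreal e" .
  qed
next
  case (add f g)
  have [measurable]: "f \<in> borel_measurable borel" "g \<in> borel_measurable borel" using add(1,2) by auto
  have "e/2 > 0" using add by simp
  then obtain d1 d2 where d: "d1 > 0" "d2 > 0"
    "\<And>h. norm h < d1 \<Longrightarrow> (\<integral>\<^sup>+x. norm (f (x - h) - f x) \<partial>lborel) \<le> ennreal (e/2)"
    "\<And>h. norm h < d2 \<Longrightarrow> (\<integral>\<^sup>+x. norm (g (x - h) - g x) \<partial>lborel) \<le> ennreal (e/2)"
    using add.IH(1)[of "e/2"] add.IH(2)[of "e/2"] by blast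
  show ?case
  proof (intro exI[of _ "min d1 d2"] conjI allI impI)
    fix h :: 'a assume h: "norm h < min d1 d2"
    have "(\<integral>\<^sup>+x. norm ((f (x - h) + g (x - h)) - (f x + g x)) \<partial>lborel) \<le>
       (\<integral>\<^sup>+x. ennreal (norm (f (x - h) - f x)) + ennreal (norm (g (x - h) - g x)) \<partial>lborel)"
      by (intro nn_integral_mono) (simp flip: ennreal_plus, metis add_diff_add norm_triangle_ineq)
    also have "\<dots> = (\<integral>\<^sup>+x. norm (f (x - h) - f x) \<partial>lborel) + (\<integral>\<^sup>+x. norm (g (x - h) - g x) \<partial>lborel)"
      by (subst nn_integral_add) auto
    also have "\<dots> \<le> ennreal (e/2) + ennreal (e/2)" using h d(3,4)[of h] by (intro add_mono) auto
    also have "\<dots> = ennreal e" using add.prems by (simp flip: ennreal_plus)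
    finally show "(\<integral>\<^sup>+x. norm ((f (x - h) + g (x - h)) - (f x + g x)) \<partial>lborel) \<le> ennreal e" .
  qed (use d in simp)
next
  case (lim f s)
  have [measurable]: "f \<in> borel_measurable borel" "\<And>i. s i \<in> borel_measurable borel" using lim(1,4) by auto
  have "(\<lambda>i. \<integral>\<^sup>+x. norm (f x - s i x) \<partial>lborel) \<longlonglongrightarrow> 0"
  proof (rule nn_integral_dominated_convergence_norm[where w="\<lambda>x. 2 * norm (f x)"])
    show "(\<integral>\<^sup>+x. ennreal (2 * norm (f x)) \<partial>lborel) < \<infinity>"
      using lim(4) by (simp add: integrable_iff_bounded nn_integral_cmult ennreal_mult ennreal_mult_less_top)
  qed (use lim(2,3) in auto)
  moreover have "0 < ennreal (e/3)" using lim by simp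
  ultimately have "\<forall>\<^sub>F i in sequentially. (\<integral>\<^sup>+x. norm (f x - s i x) \<partial>lborel) < ennreal (e/3)"
    by (rule order_tendstoD(2))
  then obtain i where i: "(\<integral>\<^sup>+x. norm (f x - s i x) \<partial>lborel) < ennreal (e/3)"
    by (auto simp: eventually_sequentially)
  obtain d where d: "d > 0" "\<And>h. norm h < d \<Longrightarrow> (\<integral>\<^sup>+x. norm (s i (x - h) - s i x) \<partial>lborel) \<le> ennreal (e/3)"
    using lim(5)[of "e/3" i] lim.prems by auto
  show ?case
  proof (intro exI[of _ d] conjI allI impI d(1))
    fix h :: 'a assume h: "norm h < d"
    have "(\<integral>\<^sup>+x. norm (f (x - h) - f x) \<partial>lborel) \<le>
       (\<integral>\<^sup>+x. ennreal (norm (f (x - h) - s i (x - h))) + ennreal (norm (s i (x - h) - s i x)) + ennreal (norm (f x - s i x)) \<partial>lborel)"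
    proof (intro nn_integral_mono)
      fix x
      have "norm (f (x - h) - f x) \<le> norm (f (x - h) - s i (x - h)) + norm (s i (x - h) - s i x) + norm (f x - s i x)"
        by norm
      then show "ennreal (norm (f (x - h) - f x)) \<le> ennreal (norm (f (x - h) - s i (x - h))) +
          ennreal (norm (s i (x - h) - s i x)) + ennreal (norm (f x - s i x))"
        by (simp flip: ennreal_plus)
    qed
    also have "\<dots> = (\<integral>\<^sup>+x. norm (f (x - h) - s i (x - h)) \<partial>lborel) +
       (\<integral>\<^sup>+x. norm (s i (x - h) - s i x) \<partial>lborel) + (\<integral>\<^sup>+x. norm (f x - s i x) \<partial>lborel)"
      by (subst nn_integral_add, measurable, subst nn_integral_add, measurable)
    also have "\<dots> = (\<integral>\<^sup>+x. norm (f x - s i x) \<partial>lborel) +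
       (\<integral>\<^sup>+x. norm (s i (x - h) - s i x) \<partial>lborel) + (\<integral>\<^sup>+x. norm (f x - s i x) \<partial>lborel)"
      by (subst nn_integral_translate[of "\<lambda>x. ennreal (norm (f x - s i x))"]) simp_all
    also have "\<dots> \<le> ennreal (e/3) + ennreal (e/3) + ennreal (e/3)" using h d(2)[of h] i by (intro add_mono) auto
    also have "\<dots> = ennreal e" using lim.prems by (simp flip: ennreal_plus)
    finally show "(\<integral>\<^sup>+x. norm (f (x - h) - f x) \<partial>lborel) \<le> ennreal e" .
  qed
qed

text \<open>Fubini's theorem and translation invariance are used for Borel functions, while Sobolev
  functions are only Lebesgue measurable.\<close>

lemma borel_representative:
  fixes f :: "'a::euclidean_space \<Rightarrow> 'b::euclidean_space"
  assumes f: "f \<in> borel_measurable lebesgue"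
  obtains g where "g \<in> borel_measurable borel" "AE x in lborel. f x = g x"
proof -
  have "\<exists>g. g \<in> borel_measurable borel \<and> (AE x in lborel. f x \<bullet> i = g x)" for i
  proof -
    have "(\<lambda>x. f x \<bullet> i) \<in> borel_measurable lebesgue" using f by measurable
    from completion_ex_borel_measurable_real[OF this] show ?thesis by auto
  qed
  then have "\<forall>i. \<exists>g. g \<in> borel_measurable borel \<and> (AE x in lborel. f x \<bullet> i = g x)" ..
  from choice[OF this] obtain g where
    g: "\<forall>i. g i \<in> borel_measurable borel \<and> (AE x in lborel. f x \<bullet> i = g i x)" ..
  show ?thesis
  proof (rule that[of "\<lambda>x. \<Sum>i\<in>Basis. g i x *\<^sub>R i"])
    show "(\<lambda>x. \<Sum>i\<in>Basis. g i x *\<^sub>R i) \<in> borel_measurable borel" using g by (intro borel_measurable_sum borel_measurable_scaleR) auto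
    have "AE x in lborel. \<forall>i\<in>Basis. f x \<bullet> i = g i x"
      using g by (intro AE_finite_allI) auto
    then show "AE x in lborel. f x = (\<Sum>i\<in>Basis. g i x *\<^sub>R i)"
    proof eventually_elim
      case (elim x)
      have "f x = (\<Sum>i\<in>Basis. (f x \<bullet> i) *\<^sub>R i)" by (simp add: euclidean_representation)
      also have "\<dots> = (\<Sum>i\<in>Basis. g i x *\<^sub>R i)" using elim by (intro sum.cong) auto
      finally show ?case .
    qed
  qed
qed

lemma conv_cong_AE:
  assumes "test_function UNIV \<eta>" "f \<in> borel_measurable lebesgue" "g \<in> borel_measurable lebesgue"
    "AE x in lebesgue. f x = g x"
  shows "conv \<eta> f = conv \<eta> g"
proof
  fix x
  have [measurable]: "(\<lambda>y. \<eta> (x - y)) \<in> borel_measurable lebesgue"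
    using assms(1) by (intro measurable_kernel_shift Cinf_on_continuous_on test_function_imp_Cinf)
  show "conv \<eta> f x = conv \<eta> g x" unfolding conv_def
    using assms(2-) by (intro integral_cong_AE) auto
qed

lemma borel_measurable_mollifier: "mollifier r \<in> borel_measurable borel"
  by (intro borel_measurable_continuous_onI Cinf_on_continuous_on Cinf_mollifier)

lemma integrable_mollifier_shift: "r > 0 \<Longrightarrow> integrable lborel (\<lambda>y. mollifier r (x - y :: 'a::euclidean_space))"
  and integral_mollifier_shift: "r > 0 \<Longrightarrow> (LINT y|lborel. mollifier r (x - y :: 'a)) = 1"
proof -
  assume r: "r > 0"
  have m: "(\<lambda>y. x - y) \<in> measurable lborel borel" by simp
  show "integrable lborel (\<lambda>y. mollifier r (x - y))"
    using integrable_mollifier[OF r, where 'a='a]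
      integrable_distr_eq[OF m, OF borel_measurable_mollifier[of r]]
    by (simp add: lborel_distr_minus)
  show "(LINT y|lborel. mollifier r (x - y)) = 1"
    using integral_mollifier[OF r, where 'a='a] integral_distr[OF m, OF borel_measurable_mollifier[of r]]
    by (simp add: lborel_distr_minus)
qed

text \<open>Since the mollifier has integral one, the error is an average of translation errors
  \<open>f (x - z) - f x\<close> over \<open>z\<close> in a small ball; Fubini's theorem exchanges this average with
  the \<open>L\<^sup>1\<close> norm.\<close>

theorem mollifier_L1_tendsto:
  fixes f :: "'a::euclidean_space \<Rightarrow> 'b::euclidean_space"
  assumes f: "integrable lebesgue f" and e: "e > 0"
  shows "\<exists>d>0. \<forall>r. 0 < r \<and> r < d \<longrightarrow>
    (\<integral>\<^sup>+x. norm (conv (mollifier r) f x - f x) \<partial>lebesgue) \<le> ennreal e"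
proof -
  obtain g where g[measurable]: "g \<in> borel_measurable borel" and fg: "AE x in lborel. f x = g x"
    by (rule borel_representative[OF borel_measurable_integrable[OF f]])
  have fg': "AE x in lebesgue. f x = g x" using fg by (rule AE_completion)
  have gl: "g \<in> borel_measurable lebesgue" using g by (rule borel_measurable_lebesgue)
  have g_int': "integrable lebesgue g"
    using f fg' gl by (subst integrable_cong_AE[of _ _ f]) auto
  then have g_int: "integrable lborel g" by (simp add: integrable_completion)
  obtain d where d: "d > 0"
    "\<And>h. norm h < d \<Longrightarrow> (\<integral>\<^sup>+x. norm (g (x - h) - g x) \<partial>lborel) \<le> ennreal e"
    using L1_translation_continuous[OF g_int e] by blast
  have "(\<integral>\<^sup>+x. norm (conv (mollifier r) f x - f x) \<partial>lebesgue) \<le> ennreal e" if r: "0 < r" "r < d" for r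
  proof -
    let ?\<eta> = "mollifier r :: 'a \<Rightarrow> real"
    have \<eta>: "test_function UNIV ?\<eta>" using r by (intro test_function_mollifier)
    note [measurable] = borel_measurable_mollifier[of r, where 'a='a]
    have pos: "0 \<le> ?\<eta> x" for x using mollifier_nonneg[OF r(1)] .
    have nn1: "(\<integral>\<^sup>+z. ?\<eta> z \<partial>lborel) = 1"
      using nn_integral_eq_integral[OF integrable_mollifier[OF r(1), where 'a='a]] pos
        integral_mollifier[OF r(1), where 'a='a] by simp
    have bound: "ennreal (norm (conv ?\<eta> g x - g x)) \<le> (\<integral>\<^sup>+z. ?\<eta> z * norm (g (x - z) - g x) \<partial>lborel)" for x
    proof -
      have i1: "integrable lborel (\<lambda>y. ?\<eta> (x - y) *\<^sub>R g y)"
        using integrable_conv[OF \<eta> g_int', of x] by (subst (asm) integrable_completion) auto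
      have 1: "conv ?\<eta> g x = (LINT y|lborel. ?\<eta> (x - y) *\<^sub>R g y)"
        unfolding conv_def by (rule integral_completion) simp
      have i2: "integrable lborel (\<lambda>y. ?\<eta> (x - y) *\<^sub>R g x)"
        and 2: "(LINT y|lborel. ?\<eta> (x - y) *\<^sub>R g x) = g x"
        using integrable_mollifier_shift[OF r(1), of x] integral_mollifier_shift[OF r(1), of x] by auto
      have "conv ?\<eta> g x - g x = (LINT y|lborel. ?\<eta> (x - y) *\<^sub>R g y - ?\<eta> (x - y) *\<^sub>R g x)"
        using 1 2 i1 i2 by simp
      then have "ennreal (norm (conv ?\<eta> g x - g x)) \<le>
          (\<integral>\<^sup>+y. norm (?\<eta> (x - y) *\<^sub>R g y - ?\<eta> (x - y) *\<^sub>R g x) \<partial>lborel)"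
        using integral_norm_bound_ennreal[OF Bochner_Integration.integrable_diff[OF i1 i2]] by simp
      also have "\<dots> = (\<integral>\<^sup>+y. (\<lambda>z. ennreal (?\<eta> z * norm (g (x - z) - g x))) (x - y) \<partial>lborel)"
        using pos by (intro nn_integral_cong) (simp flip: scaleR_diff_right)
      also have "\<dots> = (\<integral>\<^sup>+z. ?\<eta> z * norm (g (x - z) - g x) \<partial>lborel)"
        by (subst nn_integral_reflect) auto
      finally show ?thesis .
    qed
    have "(\<integral>\<^sup>+x. norm (conv ?\<eta> f x - f x) \<partial>lebesgue) = (\<integral>\<^sup>+x. norm (conv ?\<eta> g x - g x) \<partial>lebesgue)"
      using conv_cong_AE[OF \<eta> _ gl fg'] f fg' by (intro nn_integral_cong_AE) auto
    also have "\<dots> = (\<integral>\<^sup>+x. norm (conv ?\<eta> g x - g x) \<partial>lborel)"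
      by (rule nn_integral_completion)
    also have "\<dots> \<le> (\<integral>\<^sup>+x. (\<integral>\<^sup>+z. ?\<eta> z * norm (g (x - z) - g x) \<partial>lborel) \<partial>lborel)"
      by (intro nn_integral_mono bound)
    also have "\<dots> = (\<integral>\<^sup>+z. (\<integral>\<^sup>+x. ?\<eta> z * norm (g (x - z) - g x) \<partial>lborel) \<partial>lborel)"
      by (rule lborel_pair.Fubini') measurable
    also have "\<dots> \<le> (\<integral>\<^sup>+z. ?\<eta> z * ennreal e \<partial>lborel)"
    proof (intro nn_integral_mono)
      fix z :: 'a
      have "(\<integral>\<^sup>+x. ?\<eta> z * norm (g (x - z) - g x) \<partial>lborel) = ?\<eta> z * (\<integral>\<^sup>+x. norm (g (x - z) - g x) \<partial>lborel)"
        using pos by (simp add: ennreal_mult nn_integral_cmult)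
      also have "\<dots> \<le> ?\<eta> z * ennreal e"
      proof (cases "norm z < d")
        case True then show ?thesis using d(2) by (intro mult_left_mono) auto
      next
        case False
        then have "?\<eta> z = 0" using r by (intro mollifier_eq_0) auto
        then show ?thesis by simp
      qed
      finally show "(\<integral>\<^sup>+x. ?\<eta> z * norm (g (x - z) - g x) \<partial>lborel) \<le> ?\<eta> z * ennreal e" .
    qed
    also have "\<dots> = ennreal e" using nn1 by (simp add: nn_integral_multc)
    finally show ?thesis .
  qed
  then show ?thesis using d(1) by blast
qed

section \<open>Weak gradients\<close>

definition gradient :: "('a::euclidean_space \<Rightarrow> real) \<Rightarrow> 'a \<Rightarrow> 'a" where
  "gradient f x = (\<Sum>i\<in>Basis. frechet_derivative f (at x) i *\<^sub>R i)"

lemma gradient_inner: "i \<in> Basis \<Longrightarrow> gradient f x \<bullet> i = frechet_derivative f (at x) i"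
  by (simp add: gradient_def inner_sum_left inner_Basis if_distrib cong: if_cong)

lemma frechet_derivative_mult_apply:
  fixes f g :: "'a::euclidean_space \<Rightarrow> real"
  assumes "f differentiable (at x)" "g differentiable (at x)"
  shows "frechet_derivative (\<lambda>x. f x * g x) (at x) i =
    f x * frechet_derivative g (at x) i + frechet_derivative f (at x) i * g x"
  by (subst frechet_derivative_at[OF has_derivative_mult[OF assms[unfolded frechet_derivative_works]], symmetric])
    (rule refl)

lemma test_function_mult:
  assumes "test_function S \<zeta>" "Cinf_on UNIV \<psi>"
  shows "test_function S (\<lambda>x. \<zeta> x * \<psi> x)"
proof -
  obtain K where K: "compact K" "K \<subseteq> S" "\<And>x. x \<notin> K \<Longrightarrow> \<zeta> x = 0"
    using test_functionE[OF assms(1)] by metis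
  show ?thesis
    using assms K by (intro test_functionI[of _ K] Cinf_on_mult) (auto simp: test_function_imp_Cinf)
qed

text \<open>The product is smooth near each point of \<open>S\<close>, and it vanishes off the compact support of
  \<open>\<psi>\<close>; these two open sets cover the space.\<close>

lemma test_function_zero_extension:
  assumes S: "open S" and \<psi>: "test_function S \<psi>" and v: "Cinf_on S v"
  shows "test_function S (\<lambda>x. if x \<in> S then v x * \<psi> x else 0)" (is "test_function S ?F")
proof -
  obtain K where K: "compact K" "K \<subseteq> S" "\<And>x. x \<notin> K \<Longrightarrow> \<psi> x = 0"
    using test_functionE[OF \<psi>] by metis
  have "Ck_on k UNIV ?F" for k
  proof (rule Ck_on_local)
    fix x :: 'a
    show "\<exists>U. open U \<and> x \<in> U \<and> Ck_on k U ?F"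
    proof (cases "x \<in> S")
      case True
      have "Ck_on k S v" "Ck_on k UNIV \<psi>" using v test_function_imp_Cinf[OF \<psi>] by (auto simp: Cinf_on_def)
      then have "Ck_on k S (\<lambda>x. v x * \<psi> x)"
        by (intro Ck_on_mult S) (auto intro: Ck_on_subset)
      then have "Ck_on k S ?F" by (rule Ck_on_cong[OF S, rotated]) simp
      then show ?thesis using S True by blast
    next
      case False
      have o: "open (- K)" using K(1) compact_imp_closed by blast
      have "Ck_on k (- K) ?F"
        by (rule Ck_on_cong[OF o _ Ck_on_const[of _ _ 0]]) (use K in auto)
      then show ?thesis using o False K(2) by blast
    qed
  qed
  then show ?thesis
    by (intro test_functionI[OF _ K(1,2)]) (use K in \<open>auto simp: Cinf_on_def\<close>)
qed

lemma integrable_test_function: "test_function S \<psi> \<Longrightarrow> integrable lebesgue (\<psi> :: 'a::euclidean_space \<Rightarrow> real)"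
proof -
  assume \<psi>: "test_function S \<psi>"
  obtain K where K: "compact K" "K \<subseteq> S" "\<And>x. x \<notin> K \<Longrightarrow> \<psi> x = 0"
    using test_functionE[OF \<psi>] by metis
  have c: "continuous_on UNIV \<psi>" using \<psi> by (intro Cinf_on_continuous_on test_function_imp_Cinf)
  have "integrable lborel (\<lambda>x. indicator K x *\<^sub>R \<psi> x)"
    by (rule borel_integrable_compact[OF K(1) continuous_on_subset[OF c]]) simp
  moreover have "(\<lambda>x. indicator K x *\<^sub>R \<psi> x) = \<psi>" using K(3) by (force simp: indicator_def)
  ultimately have "integrable lborel \<psi>" by simp
  then show ?thesis
    using borel_measurable_continuous_onI[OF c] by (simp add: integrable_completion)
qed

text \<open>By translation invariance every difference quotient has integral zero, and dominated
  convergence passes this to the derivative.\<close>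

lemma integral_deriv_test_function:
  fixes \<psi> :: "'a::euclidean_space \<Rightarrow> real"
  assumes \<psi>: "test_function S \<psi>" and i: "i \<in> Basis"
  shows "(LINT x|lebesgue. frechet_derivative \<psi> (at x) i) = 0"
proof -
  obtain K where K: "compact K" "K \<subseteq> S" "\<And>x. x \<notin> K \<Longrightarrow> \<psi> x = 0"
    using test_functionE[OF \<psi>] by metis
  obtain R where R: "\<And>x. x \<in> K \<Longrightarrow> norm x \<le> R"
    using compact_imp_bounded[OF K(1)] by (auto simp: bounded_iff)
  obtain L where L: "L \<ge> 0" "\<And>x y. \<bar>\<psi> x - \<psi> y\<bar> \<le> L * norm (x - y)"
    using test_function_deriv_bounded[OF \<psi>] by metis
  have d: "(\<psi> has_derivative frechet_derivative \<psi> (at x)) (at x)" for x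
    using Cinf_on_has_derivative[OF test_function_imp_Cinf[OF \<psi>]] by simp
  have [measurable]: "\<psi> \<in> borel_measurable borel"
    using \<psi> by (intro borel_measurable_continuous_onI Cinf_on_continuous_on test_function_imp_Cinf)
  have \<psi>_int: "integrable lborel \<psi>"
    using integrable_test_function[OF \<psi>] by (simp add: integrable_completion)
  have sh: "integrable lborel (\<lambda>x. \<psi> (h + x))" "(LINT x|lborel. \<psi> (h + x)) = (LINT x|lborel. \<psi> x)" for h
  proof -
    have m: "(+) h \<in> measurable lborel borel" by simp
    show "integrable lborel (\<lambda>x. \<psi> (h + x))"
      using \<psi>_int integrable_distr_eq[OF m, of \<psi>] by (simp add: lborel_distr_plus)
    show "(LINT x|lborel. \<psi> (h + x)) = (LINT x|lborel. \<psi> x)"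
      using integral_distr[OF m, of \<psi>] by (simp add: lborel_distr_plus)
  qed
  define t where "t n = 1 / real (Suc n)" for n
  have t: "t n > 0" "t n \<le> 1" for n by (auto simp: t_def)
  have t0: "t \<longlonglongrightarrow> 0" unfolding t_def by (rule LIMSEQ_Suc[OF lim_1_over_n])
  define g where "g n x = (\<psi> (t n *\<^sub>R i + x) - \<psi> x) / t n" for n x
  have g_int: "integrable lborel (g n)" and g0: "integral\<^sup>L lborel (g n) = 0" for n
    unfolding g_def using sh[of "t n *\<^sub>R i"] \<psi>_int by auto
  have lim: "(\<lambda>n. g n x) \<longlonglongrightarrow> frechet_derivative \<psi> (at x) i" for x
  proof -
    have "((\<lambda>h. (\<psi> (x + h *\<^sub>R i) - \<psi> x) /\<^sub>R h) \<longlongrightarrow> frechet_derivative \<psi> (at x) i) (at 0)"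
    proof -
      have "((\<lambda>h. \<psi> (x + h *\<^sub>R i)) has_derivative (\<lambda>h. frechet_derivative \<psi> (at x) (h *\<^sub>R i))) (at 0)"
        by (rule has_derivative_compose[of "\<lambda>h. x + h *\<^sub>R i" _ 0 UNIV \<psi>])
          (use d in \<open>auto intro!: derivative_eq_intros\<close>)
      moreover have "frechet_derivative \<psi> (at x) (h *\<^sub>R i) = frechet_derivative \<psi> (at x) i * h" for h
        using linear_cmul[OF has_derivative_linear[OF d]] by simp
      ultimately have "((\<lambda>h. \<psi> (x + h *\<^sub>R i)) has_field_derivative frechet_derivative \<psi> (at x) i) (at 0)"
        by (simp add: has_field_derivative_def)
      then show ?thesis by (simp add: DERIV_def divide_inverse mult.commute)
    qed
    moreover have "\<forall>n. t n \<in> UNIV - {0}" using t(1) by (simp add: less_imp_neq[symmetric])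
    ultimately have "((\<lambda>h. (\<psi> (x + h *\<^sub>R i) - \<psi> x) /\<^sub>R h) \<circ> t) \<longlonglongrightarrow> frechet_derivative \<psi> (at x) i"
      using t0 unfolding tendsto_at_iff_sequentially by blast
    then show ?thesis by (simp add: g_def o_def divide_inverse add.commute mult.commute)
  qed
  have "(\<lambda>n. integral\<^sup>L lborel (g n)) \<longlonglongrightarrow> integral\<^sup>L lborel (\<lambda>x. frechet_derivative \<psi> (at x) i)"
  proof (rule integral_dominated_convergence[where w="\<lambda>x. indicator (cball 0 (R + 1)) x *\<^sub>R L"])
    show "integrable lborel (\<lambda>x::'a. indicator (cball 0 (R + 1)) x *\<^sub>R L)"
      by (rule borel_integrable_compact) auto
    show gm: "g n \<in> borel_measurable lborel" for n using g_int by auto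
    show "(\<lambda>x. frechet_derivative \<psi> (at x) i) \<in> borel_measurable lborel"
      using \<psi> i by (simp, intro borel_measurable_continuous_onI Cinf_on_continuous_on
          test_function_imp_Cinf test_function_deriv)
    show "AE x in lborel. (\<lambda>n. g n x) \<longlonglongrightarrow> frechet_derivative \<psi> (at x) i" using lim by simp
    show "AE x in lborel. norm (g n x) \<le> indicator (cball 0 (R + 1)) x *\<^sub>R L" for n
    proof (rule AE_I2)
      fix x
      have "\<bar>\<psi> (t n *\<^sub>R i + x) - \<psi> x\<bar> \<le> L * t n" using L(2)[of "t n *\<^sub>R i + x" x] t(1)[of n] i by simp
      then have 1: "norm (g n x) \<le> L" using t(1)[of n] by (simp add: g_def divide_le_eq)
      have 2: "g n x = 0" if "norm x > R + 1"
      proof -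
        have "norm (t n *\<^sub>R i + x) \<ge> norm x - norm (t n *\<^sub>R i)"
          by (metis add.commute norm_diff_ineq)
        then have "norm (t n *\<^sub>R i + x) > R" using that t[of n] i by simp
        then have "t n *\<^sub>R i + x \<notin> K" "x \<notin> K" using R[of "t n *\<^sub>R i + x"] R[of x] that by auto
        then have "\<psi> (t n *\<^sub>R i + x) = 0" "\<psi> x = 0" using K(3) by auto
        then show ?thesis by (simp add: g_def)
      qed
      show "norm (g n x) \<le> indicator (cball 0 (R + 1)) x *\<^sub>R L"
        using 1 2 by (auto simp: indicator_def)
    qed
  qed
  then have "(LINT x|lborel. frechet_derivative \<psi> (at x) i) = 0"
    by (simp add: g0 LIMSEQ_const_iff)
  moreover have "(\<lambda>x. frechet_derivative \<psi> (at x) i) \<in> borel_measurable borel"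
    using Cinf_on_continuous_on[OF test_function_imp_Cinf[OF test_function_deriv[OF \<psi> i]]]
    by (rule borel_measurable_continuous_onI)
  ultimately show ?thesis by (simp add: integral_completion)
qed

lemma set_lebesgue_integral_eq_outside:
  assumes "\<And>x. x \<notin> S \<Longrightarrow> f x = 0"
  shows "(LINT x:S|M. f x) = (LINT x|M. f x)"
  unfolding set_lebesgue_integral_def
  by (rule Bochner_Integration.integral_cong) (use assms in \<open>auto simp: indicator_def\<close>)

lemma continuous_imp_locally_integrable_on:
  fixes v :: "'a::euclidean_space \<Rightarrow> 'b::euclidean_space"
  assumes "continuous_on S v" shows "locally_integrable_on S v"
  unfolding locally_integrable_on_def set_integrable_def
proof (intro allI impI, elim conjE)
  fix K assume K: "compact K" "K \<subseteq> S"
  have "integrable lborel (\<lambda>x. indicator K x *\<^sub>R v x)"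
    by (rule borel_integrable_compact[OF K(1) continuous_on_subset[OF assms K(2)]])
  then show "integrable lebesgue (\<lambda>x. indicator K x *\<^sub>R v x)"
    using borel_measurable_integrable by (subst integrable_completion) auto
qed

text \<open>Integration by parts: extend \<open>v \<psi>\<close> by zero to a test function and integrate its
  derivative.\<close>

lemma has_weak_gradient_smooth:
  fixes v :: "'a::euclidean_space \<Rightarrow> real"
  assumes S: "open S" and v: "Cinf_on S v"
  shows "has_weak_gradient S v (gradient v)"
  unfolding has_weak_gradient_def
proof (intro conjI allI impI ballI)
  show "locally_integrable_on S v"
    by (intro continuous_imp_locally_integrable_on Cinf_on_continuous_on v)
  show "locally_integrable_on S (gradient v)"
    unfolding gradient_def[abs_def]
    by (intro continuous_imp_locally_integrable_on continuous_intros Cinf_on_continuous_on Cinf_on_deriv v)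
next
  fix \<psi> and i :: 'a assume \<psi>: "test_function S \<psi>" and i: "i \<in> Basis"
  let ?d = "\<lambda>f x. frechet_derivative f (at x) i"
  let ?E = "\<lambda>f x. if x \<in> S then f x else (0::real)"
  obtain K where K: "compact K" "K \<subseteq> S" "\<And>x. x \<notin> K \<Longrightarrow> \<psi> x = 0"
    using test_functionE[OF \<psi>] by metis
  have d\<psi>: "test_function S (?d \<psi>)" by (rule test_function_deriv[OF \<psi> i])
  have 1: "test_function S (?E (\<lambda>x. v x * \<psi> x))" by (rule test_function_zero_extension[OF S \<psi> v])
  have 2: "test_function S (?E (\<lambda>x. v x * ?d \<psi> x))" by (rule test_function_zero_extension[OF S d\<psi> v])
  have 3: "test_function S (?E (\<lambda>x. ?d v x * \<psi> x))"
    by (rule test_function_zero_extension[OF S \<psi> Cinf_on_deriv[OF v i]])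
  have eq: "?d (?E (\<lambda>x. v x * \<psi> x)) x = ?E (\<lambda>x. v x * ?d \<psi> x) x + ?E (\<lambda>x. ?d v x * \<psi> x) x" for x
  proof (cases "x \<in> S")
    case True
    have vd: "v differentiable at x" "\<psi> differentiable at x"
      using Cinf_on_differentiable[OF v True] Cinf_on_differentiable[OF test_function_imp_Cinf[OF \<psi>]] by auto
    have "?d (?E (\<lambda>x. v x * \<psi> x)) x = ?d (\<lambda>x. v x * \<psi> x) x"
    proof (rule arg_cong[where f="\<lambda>D. D i"], rule frechet_derivative_transform_within_open[symmetric, OF _ S True])
      show "(\<lambda>x. v x * \<psi> x) differentiable at x" using vd by simp
    qed simp
    then show ?thesis using True frechet_derivative_mult_apply[OF vd] by simp
  next
    case False
    have "frechet_derivative (?E (\<lambda>x. v x * \<psi> x)) (at x) = (\<lambda>_. 0)"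
      by (rule frechet_derivative_eq_0_outside[OF compact_imp_closed[OF K(1)]]) (use K False in auto)
    then show ?thesis using False by simp
  qed
  have "0 = (LINT x|lebesgue. ?d (?E (\<lambda>x. v x * \<psi> x)) x)"
    using integral_deriv_test_function[OF 1 i] by simp
  also have "\<dots> = (LINT x|lebesgue. ?E (\<lambda>x. v x * ?d \<psi> x) x) + (LINT x|lebesgue. ?E (\<lambda>x. ?d v x * \<psi> x) x)"
    unfolding eq by (rule Bochner_Integration.integral_add) (use integrable_test_function 2 3 in blast)+
  also have "(LINT x|lebesgue. ?E (\<lambda>x. v x * ?d \<psi> x) x) = (LINT x:S|lebesgue. v x * ?d \<psi> x)"
    unfolding set_lebesgue_integral_def
    by (intro Bochner_Integration.integral_cong) (auto simp: indicator_def)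
  also have "(LINT x|lebesgue. ?E (\<lambda>x. ?d v x * \<psi> x) x) = (LINT x:S|lebesgue. (gradient v x \<bullet> i) * \<psi> x)"
    unfolding set_lebesgue_integral_def gradient_inner[OF i]
    by (intro Bochner_Integration.integral_cong) (auto simp: indicator_def)
  finally show "(LINT x:S|lebesgue. v x * ?d \<psi> x) = - (LINT x:S|lebesgue. (gradient v x \<bullet> i) * \<psi> x)"
    by simp
qed

lemma integrable_inner: "integrable M f \<Longrightarrow> integrable M (\<lambda>x. f x \<bullet> c)"
  by (rule integrable_inner_left)

lemma integrable_cutoff:
  fixes u :: "'a::euclidean_space \<Rightarrow> 'b::euclidean_space"
  assumes "locally_integrable_on S u" and \<zeta>: "test_function S \<zeta>"
  shows "integrable lebesgue (\<lambda>x. \<zeta> x *\<^sub>R u x)"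
proof -
  obtain K where K: "compact K" "K \<subseteq> S" "\<And>x. x \<notin> K \<Longrightarrow> \<zeta> x = 0"
    using test_functionE[OF \<zeta>] by metis
  obtain B where B: "\<And>x. \<bar>\<zeta> x\<bar> \<le> B" using test_function_bounded[OF \<zeta>] by metis
  have "integrable lebesgue (\<lambda>x. indicator K x *\<^sub>R u x)"
    using assms(1) K unfolding locally_integrable_on_def set_integrable_def by blast
  moreover have "\<zeta> \<in> borel_measurable lebesgue"
    using \<zeta> by (intro continuous_borel_measurable_lebesgue Cinf_on_continuous_on test_function_imp_Cinf)
  ultimately have "integrable lebesgue (\<lambda>x. \<zeta> x *\<^sub>R (indicator K x *\<^sub>R u x))"
    using B by (rule integrable_bounded_scaleR)
  moreover have "\<zeta> x *\<^sub>R (indicator K x *\<^sub>R u x) = \<zeta> x *\<^sub>R u x" for x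
    using K(3)[of x] by (auto simp: indicator_def)
  ultimately show ?thesis by (simp only:)
qed

lemma test_function_gradient_integrable:
  fixes u :: "'a::euclidean_space \<Rightarrow> real"
  assumes "locally_integrable_on S u" and \<zeta>: "test_function S \<zeta>"
  shows "integrable lebesgue (\<lambda>x. u x *\<^sub>R gradient \<zeta> x)"
proof -
  have "integrable lebesgue (\<lambda>x. \<Sum>i\<in>Basis. (frechet_derivative \<zeta> (at x) i *\<^sub>R u x) *\<^sub>R i)"
    by (intro Bochner_Integration.integrable_sum integrable_scaleR_left
        integrable_cutoff[OF assms(1) test_function_deriv[OF \<zeta>]])
  then show ?thesis by (simp add: gradient_def scaleR_sum_right mult.commute)
qed

text \<open>Test the weak gradient of \<open>u\<close> with \<open>\<zeta> \<psi>\<close>, which is a test function in \<open>S\<close> for every smooth \<open>\<psi>\<close>,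
  in particular for a shifted kernel. The bounds on \<open>\<psi>\<close> make the separate integrals exist.\<close>

lemma weak_gradient_cutoff:
  fixes u :: "'a::euclidean_space \<Rightarrow> real"
  assumes uG: "has_weak_gradient S u G" and \<zeta>: "test_function S \<zeta>" and \<psi>: "Cinf_on UNIV \<psi>"
    and \<psi>_bdd: "\<And>x. \<bar>\<psi> x\<bar> \<le> B" "\<And>x i. i \<in> Basis \<Longrightarrow> \<bar>frechet_derivative \<psi> (at x) i\<bar> \<le> B"
    and i: "i \<in> Basis"
  shows "(LINT x|lebesgue. (\<zeta> x * u x) * frechet_derivative \<psi> (at x) i) =
    - (LINT x|lebesgue. ((\<zeta> x *\<^sub>R G x + u x *\<^sub>R gradient \<zeta> x) \<bullet> i) * \<psi> x)"
proof -
  let ?d = "\<lambda>f x. frechet_derivative f (at x) i"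
  obtain K where K: "compact K" "K \<subseteq> S" "\<And>x. x \<notin> K \<Longrightarrow> \<zeta> x = 0"
    using test_functionE[OF \<zeta>] by metis
  have u: "locally_integrable_on S u" and G: "locally_integrable_on S G"
    using uG by (auto simp: has_weak_gradient_def)
  have m: "\<psi> \<in> borel_measurable lebesgue" "?d \<psi> \<in> borel_measurable lebesgue"
    using \<psi> Cinf_on_deriv[OF \<psi> i] by (auto intro!: continuous_borel_measurable_lebesgue Cinf_on_continuous_on)
  have \<zeta>0: "\<zeta> x = 0" "?d \<zeta> x = 0" if "x \<notin> S" for x
  proof -
    have "x \<notin> K" using that K(2) by auto
    then show "\<zeta> x = 0" "?d \<zeta> x = 0"
      using K(3) frechet_derivative_eq_0_outside[of K \<zeta> x, OF compact_imp_closed[OF K(1)] K(3)] by auto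
  qed
  have d\<zeta>: "?d (\<lambda>x. \<zeta> x * \<psi> x) x = \<zeta> x * ?d \<psi> x + ?d \<zeta> x * \<psi> x" for x
    using Cinf_on_differentiable[OF test_function_imp_Cinf[OF \<zeta>]] Cinf_on_differentiable[OF \<psi>]
    by (intro frechet_derivative_mult_apply) auto
  have i1: "integrable lebesgue (\<lambda>x. (\<zeta> x * u x) * ?d \<psi> x)"
    using integrable_bounded_scaleR[OF integrable_cutoff[OF u \<zeta>] m(2) \<psi>_bdd(2)[OF i]]
    by (simp add: mult_ac)
  have i2: "integrable lebesgue (\<lambda>x. (u x * ?d \<zeta> x) * \<psi> x)"
    using integrable_bounded_scaleR[OF integrable_cutoff[OF u test_function_deriv[OF \<zeta> i]] m(1) \<psi>_bdd(1)]
    by (simp add: mult_ac)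
  have i3: "integrable lebesgue (\<lambda>x. (\<zeta> x * (G x \<bullet> i)) * \<psi> x)"
    using integrable_bounded_scaleR[OF integrable_inner[OF integrable_cutoff[OF G \<zeta>], of i] m(1) \<psi>_bdd(1)]
    by (simp add: mult_ac)
  have "(LINT x|lebesgue. (\<zeta> x * u x) * ?d \<psi> x) + (LINT x|lebesgue. (u x * ?d \<zeta> x) * \<psi> x) =
      (LINT x|lebesgue. u x * ?d (\<lambda>x. \<zeta> x * \<psi> x) x)"
    unfolding Bochner_Integration.integral_add[OF i1 i2, symmetric] d\<zeta> by (simp add: algebra_simps)
  also have "\<dots> = (LINT x:S|lebesgue. u x * ?d (\<lambda>x. \<zeta> x * \<psi> x) x)"
    by (rule set_lebesgue_integral_eq_outside[symmetric]) (simp add: d\<zeta> \<zeta>0)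
  also have "\<dots> = - (LINT x:S|lebesgue. (G x \<bullet> i) * (\<zeta> x * \<psi> x))"
    using uG test_function_mult[OF \<zeta> \<psi>] i unfolding has_weak_gradient_def by blast
  also have "(LINT x:S|lebesgue. (G x \<bullet> i) * (\<zeta> x * \<psi> x)) = (LINT x|lebesgue. (\<zeta> x * (G x \<bullet> i)) * \<psi> x)"
    by (subst set_lebesgue_integral_eq_outside) (simp_all add: \<zeta>0 mult_ac)
  finally have "(LINT x|lebesgue. (\<zeta> x * u x) * ?d \<psi> x) =
     - ((LINT x|lebesgue. (\<zeta> x * (G x \<bullet> i)) * \<psi> x) + (LINT x|lebesgue. (u x * ?d \<zeta> x) * \<psi> x))"
    by simp
  also have "\<dots> = - (LINT x|lebesgue. ((\<zeta> x *\<^sub>R G x + u x *\<^sub>R gradient \<zeta> x) \<bullet> i) * \<psi> x)"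
    unfolding Bochner_Integration.integral_add[OF i3 i2, symmetric]
    by (simp add: inner_add_left gradient_inner[OF i] distrib_right)
  finally show ?thesis .
qed

lemma integrable_cutoff_gradient:
  assumes "has_weak_gradient S u G" and "test_function S \<zeta>"
  shows "integrable lebesgue (\<lambda>x. \<zeta> x *\<^sub>R G x + u x *\<^sub>R gradient \<zeta> x)"
    "integrable lebesgue (\<lambda>x. \<zeta> x * u x)"
  using assms integrable_cutoff[of S G \<zeta>] integrable_cutoff[of S u \<zeta>] test_function_gradient_integrable[of S u \<zeta>]
  unfolding has_weak_gradient_def by auto

text \<open>\<open>weak_gradient_cutoff\<close> with \<open>\<psi> y = \<eta> (x - y)\<close>, whose derivative in \<open>y\<close> is minus that of \<open>\<eta>\<close>.\<close>

lemma gradient_conv_cutoff: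
  fixes u :: "'a::euclidean_space \<Rightarrow> real"
  assumes uG: "has_weak_gradient S u G" and \<zeta>: "test_function S \<zeta>" and \<eta>: "test_function UNIV \<eta>"
  shows "gradient (conv \<eta> (\<lambda>x. \<zeta> x * u x)) x = conv \<eta> (\<lambda>x. \<zeta> x *\<^sub>R G x + u x *\<^sub>R gradient \<zeta> x) x"
proof (rule euclidean_eqI)
  fix i :: 'a assume i: "i \<in> Basis"
  let ?f = "\<lambda>x. \<zeta> x * u x" and ?f' = "\<lambda>x. \<zeta> x *\<^sub>R G x + u x *\<^sub>R gradient \<zeta> x"
  let ?\<psi> = "\<lambda>y. \<eta> (x - y)"
  have d\<eta>: "(\<eta> has_derivative frechet_derivative \<eta> (at y)) (at y)" for y
    using Cinf_on_has_derivative[OF test_function_imp_Cinf[OF \<eta>]] by simp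
  have \<psi>: "Cinf_on UNIV ?\<psi>"
    using Ck_on_affine[where c="-1" and a=x and f=\<eta>] test_function_imp_Cinf[OF \<eta>] by (auto simp: Cinf_on_def)
  have d\<psi>: "frechet_derivative ?\<psi> (at y) j = - frechet_derivative \<eta> (at (x - y)) j" for y j
  proof -
    have "(?\<psi> has_derivative (\<lambda>h. frechet_derivative \<eta> (at (x - y)) (- h))) (at y)"
      by (rule has_derivative_compose[of "\<lambda>y. x - y", OF _ d\<eta>]) (auto intro!: derivative_eq_intros)
    then have "frechet_derivative ?\<psi> (at y) = (\<lambda>h. frechet_derivative \<eta> (at (x - y)) (- h))"
      using frechet_derivative_at by metis
    then show ?thesis using linear_neg[OF has_derivative_linear[OF d\<eta>]] by simp
  qed
  obtain L where L: "\<And>x h. \<bar>frechet_derivative \<eta> (at x) h\<bar> \<le> L * norm h"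
    using test_function_deriv_bounded[OF \<eta>] by metis
  obtain B where B: "\<And>x. \<bar>\<eta> x\<bar> \<le> B" using test_function_bounded[OF \<eta>] by metis
  have b1: "\<bar>?\<psi> y\<bar> \<le> max B L" for y using B[of "x - y"] by simp
  have b2: "\<bar>frechet_derivative ?\<psi> (at y) j\<bar> \<le> max B L" if "j \<in> Basis" for y j
    using L[of "x - y" j] that by (simp add: d\<psi>)
  note int = integrable_cutoff_gradient[OF uG \<zeta>]
  have "gradient (conv \<eta> ?f) x \<bullet> i = conv (\<lambda>z. frechet_derivative \<eta> (at z) i) ?f x"
    by (simp only: gradient_inner[OF i] conv_deriv[OF \<eta> int(2) i])
  also have "\<dots> = - (LINT y|lebesgue. ?f y * frechet_derivative ?\<psi> (at y) i)"
    by (simp add: conv_def d\<psi> mult.commute)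
  also have "\<dots> = (LINT y|lebesgue. (?f' y \<bullet> i) * ?\<psi> y)"
    by (simp only: weak_gradient_cutoff[OF uG \<zeta> \<psi> b1 b2 i] minus_minus)
  also have "\<dots> = (LINT y|lebesgue. (?\<psi> y *\<^sub>R ?f' y) \<bullet> i)"
    by (simp add: mult.commute)
  also have "\<dots> = conv \<eta> ?f' x \<bullet> i"
    unfolding conv_def by (rule integral_inner_left) (intro integrable_conv \<eta> int)
  finally show "gradient (conv \<eta> ?f) x \<bullet> i = conv \<eta> ?f' x \<bullet> i" .
qed

text \<open>Mollify the indicator of \<open>{x. 1 / (n + 1) \<le> infdist x (- S)}\<close> with half that distance as
  radius.\<close>

lemma smooth_cutoffs:
  fixes S :: "'a::euclidean_space set"
  assumes S: "open S" "bounded S"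
  obtains \<kappa> :: "nat \<Rightarrow> 'a \<Rightarrow> real" where "\<And>n. test_function S (\<kappa> n)"
    "\<And>n x. 2 / real (Suc n) < infdist x (- S) \<Longrightarrow> \<kappa> n x = 1"
proof -
  have "S \<noteq> UNIV" using S(2) not_bounded_UNIV by blast
  then have ne: "- S \<noteq> {}" by auto
  have comp: "compact {x. a \<le> infdist x (- S)}" and sub: "{x. a \<le> infdist x (- S)} \<subseteq> S" if a: "a > 0" for a
  proof -
    show sub: "{x. a \<le> infdist x (- S)} \<subseteq> S" 
    proof
      fix x assume "x \<in> {x. a \<le> infdist x (- S)}"
      then show "x \<in> S" using a infdist_zero[of x "- S"] by (cases "x \<in> S") auto
    qed
    have "closed {x. a \<le> infdist x (- S)}" by (intro closed_Collect_le continuous_intros)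
    then show "compact {x. a \<le> infdist x (- S)}"
      using sub S(2) bounded_subset compact_eq_bounded_closed by blast
  qed
  have "\<exists>\<kappa>. test_function S \<kappa> \<and> (\<forall>x. 2 / real (Suc n) < infdist x (- S) \<longrightarrow> \<kappa> x = 1)" for n
  proof -
    define r where "r = 1 / (2 * real (Suc n))"
    have r: "r > 0" by (simp add: r_def)
    define A where "A = {x. 2 * r \<le> infdist x (- S)}"
    have A: "compact A" unfolding A_def using comp[of "2 * r"] r by simp
    have int: "integrable lebesgue (indicator A :: 'a \<Rightarrow> real)"
      using lmeasurable_compact[OF A] by (auto simp: fmeasurable_def)
    define \<kappa> where "\<kappa> = conv (mollifier r) (indicator A :: 'a \<Rightarrow> real)"
    have tri: "infdist x (- S) \<le> infdist y (- S) + dist x y" for x y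
      by (rule infdist_triangle)
    have "Cinf_on UNIV \<kappa>"
      unfolding \<kappa>_def by (rule Cinf_conv[OF test_function_mollifier[OF r] int])
    moreover have "\<kappa> x = 0" if x: "x \<notin> {x. r \<le> infdist x (- S)}" for x
    proof -
      have "mollifier r (x - y) *\<^sub>R (indicator A y :: real) = 0" for y :: 'a
      proof (cases "y \<in> A")
        case True
        then have "r \<le> norm (x - y)" using tri[of y x] x by (auto simp: A_def dist_norm norm_minus_commute)
        then show ?thesis using mollifier_eq_0[OF r, of "x - y"] by simp
      qed simp
      then show ?thesis unfolding \<kappa>_def conv_def by (simp only:) simp
    qed
    ultimately have "test_function S \<kappa>"
      by (intro test_functionI[OF _ comp[OF r] sub[OF r]])
    moreover have "\<kappa> x = 1" if x: "2 / real (Suc n) < infdist x (- S)" for x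
    proof -
      have "4 * r = 2 / real (Suc n)" by (simp add: r_def field_simps)
      then have x': "4 * r < infdist x (- S)" using x by simp
      have "mollifier r (x - y) *\<^sub>R (indicator A y :: real) = mollifier r (x - y)" for y :: 'a
      proof (cases "y \<in> A")
        case False
        then have "r \<le> norm (x - y)" using tri[of x y] x' r by (auto simp: A_def dist_norm)
        then show ?thesis using mollifier_eq_0[OF r, of "x - y"] by simp
      qed simp
      then have "\<kappa> x = (LINT y|lebesgue. mollifier r (x - y))"
        unfolding \<kappa>_def conv_def by (simp only:)
      also have "\<dots> = (LINT y|lborel. mollifier r (x - y))"
        by (rule integral_completion) (use borel_measurable_mollifier[of r, where 'a='a] in measurable)
      finally show ?thesis using integral_mollifier_shift[OF r] by simp
    qed
    ultimately show ?thesis by blast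
  qed
  then have "\<forall>n. \<exists>\<kappa>. test_function S \<kappa> \<and> (\<forall>x. 2 / real (Suc n) < infdist x (- S) \<longrightarrow> \<kappa> x = 1)" by blast
  from choice[OF this] obtain \<kappa> where
    "\<forall>n. test_function S (\<kappa> n) \<and> (\<forall>x. 2 / real (Suc n) < infdist x (- S) \<longrightarrow> \<kappa> n x = 1)" ..
  then show ?thesis by (intro that[of \<kappa>]) auto
qed

lemma infdist_exhaustion:
  assumes "open S" "- S \<noteq> {}" "x \<in> S"
  obtains n where "2 / real (Suc n) < infdist x (- S)"
proof -
  have "infdist x (- S) > 0"
    using assms infdist_pos_not_in_closed[of "- S" x] by auto
  then have "infdist x (- S) / 2 > 0" by simp
  then obtain n where "1 / real (Suc n) < infdist x (- S) / 2"
    using nat_approx_posE by (metis of_nat_Suc)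
  then show ?thesis using that[of n] by simp
qed

text \<open>For a cutoff \<open>\<kappa>\<close>, the mollifications of \<open>\<kappa> G + u \<nabla>\<kappa>\<close> and of \<open>\<kappa> G' + u \<nabla>\<kappa>\<close> are both the
  gradient of the mollified \<open>\<kappa> u\<close>. So \<open>\<kappa> (G - G')\<close> has vanishing mollifications of every
  radius, and these converge to it in \<open>L\<^sup>1\<close>.\<close>

lemma weak_gradient_unique:
  fixes u :: "'a::euclidean_space \<Rightarrow> real"
  assumes S: "open S" "bounded S" and G: "has_weak_gradient S u G" and G': "has_weak_gradient S u G'"
  shows "AE x in lebesgue. x \<in> S \<longrightarrow> G x = G' x"
proof -
  have "S \<noteq> UNIV" using S(2) not_bounded_UNIV by blast
  then have ne: "- S \<noteq> {}" by auto
  obtain \<kappa> :: "nat \<Rightarrow> 'a \<Rightarrow> real" where \<kappa>: "\<And>n. test_function S (\<kappa> n)"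
    "\<And>n x. 2 / real (Suc n) < infdist x (- S) \<Longrightarrow> \<kappa> n x = 1"
    using smooth_cutoffs[OF S] by metis
  have "AE x in lebesgue. \<kappa> n x *\<^sub>R (G x - G' x) = 0" for n
  proof -
    let ?w = "\<lambda>x. \<kappa> n x *\<^sub>R (G x - G' x)"
    let ?g = "\<lambda>G x. \<kappa> n x *\<^sub>R G x + u x *\<^sub>R gradient (\<kappa> n) x"
    have ig: "integrable lebesgue (?g G)" "integrable lebesgue (?g G')"
      using integrable_cutoff_gradient[OF _ \<kappa>(1)] G G' by blast+
    have w_eq: "?w = (\<lambda>x. ?g G x - ?g G' x)" by (auto simp: algebra_simps)
    have iw: "integrable lebesgue ?w" unfolding w_eq using ig by (rule Bochner_Integration.integrable_diff)
    have conv0: "conv (mollifier r) ?w x = 0" if r: "r > 0" for r x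
    proof -
      note t = test_function_mollifier[OF r, where 'a='a]
      have "conv (mollifier r) ?w x = conv (mollifier r) (?g G) x - conv (mollifier r) (?g G') x"
      proof -
        have "mollifier r (x - y) *\<^sub>R ?w y = mollifier r (x - y) *\<^sub>R ?g G y - mollifier r (x - y) *\<^sub>R ?g G' y" for y
          by (simp add: algebra_simps)
        then show ?thesis unfolding conv_def
          using Bochner_Integration.integral_diff[OF integrable_conv[OF t ig(1)] integrable_conv[OF t ig(2)]]
          by (simp only:)
      qed
      also have "\<dots> = 0"
        by (simp only: gradient_conv_cutoff[OF G \<kappa>(1) t, symmetric] gradient_conv_cutoff[OF G' \<kappa>(1) t, symmetric]) simp
      finally show ?thesis .
    qed
    have small: "(\<integral>\<^sup>+x. norm (?w x) \<partial>lebesgue) \<le> ennreal e" if e: "e > 0" for e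
    proof -
      obtain d where d: "d > 0" "\<forall>r. 0 < r \<and> r < d \<longrightarrow>
          (\<integral>\<^sup>+x. norm (conv (mollifier r) ?w x - ?w x) \<partial>lebesgue) \<le> ennreal e"
        using mollifier_L1_tendsto[OF iw e] by blast
      then show ?thesis using d(2)[rule_format, of "d/2"] conv0[of "d/2"] by simp
    qed
    have "(\<integral>\<^sup>+x. norm (?w x) \<partial>lebesgue) \<le> 0"
      by (rule ennreal_le_epsilon) (simp only: add_0 small)
    then have 0: "(\<integral>\<^sup>+x. ennreal (norm (?w x)) \<partial>lebesgue) = 0" by simp
    have "(\<lambda>x. ennreal (norm (?w x))) \<in> borel_measurable lebesgue"
      using borel_measurable_integrable[OF iw] by measurable
    from nn_integral_0_iff_AE[OF this] 0 have "AE x in lebesgue. ennreal (norm (?w x)) = 0" by blast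
    then show ?thesis by eventually_elim simp
  qed
  then have "AE x in lebesgue. \<forall>n. \<kappa> n x *\<^sub>R (G x - G' x) = 0" by (simp only: AE_all_countable) simp
  then show ?thesis
  proof eventually_elim
    case (elim x)
    show ?case
    proof
      assume "x \<in> S"
      then obtain n where "2 / real (Suc n) < infdist x (- S)"
        using infdist_exhaustion[OF S(1) ne] by metis
      then show "G x = G' x" using elim \<kappa>(2)[of n x] by (metis eq_iff_diff_eq_0 scaleR_one)
    qed
  qed
qed

lemma has_weak_gradient_diff:
  fixes u v :: "'a::euclidean_space \<Rightarrow> real"
  assumes u: "has_weak_gradient S u G" and v: "has_weak_gradient S v G'"
  shows "has_weak_gradient S (\<lambda>x. u x - v x) (\<lambda>x. G x - G' x)"
proof -
  have l: "locally_integrable_on S u" "locally_integrable_on S v" "locally_integrable_on S G" "locally_integrable_on S G'"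
    using u v by (auto simp: has_weak_gradient_def)
  show ?thesis
    unfolding has_weak_gradient_def
  proof (intro conjI allI impI ballI)
    show "locally_integrable_on S (\<lambda>x. u x - v x)" "locally_integrable_on S (\<lambda>x. G x - G' x)"
      using l unfolding locally_integrable_on_def set_integrable_def by (auto simp: scaleR_diff_right right_diff_distrib)
  next
    fix \<psi> and i :: 'a assume \<psi>: "test_function S \<psi>" and i: "i \<in> Basis"
    let ?d = "\<lambda>x. frechet_derivative \<psi> (at x) i"
    note d\<psi> = test_function_deriv[OF \<psi> i]
    have z: "\<psi> x = 0" "?d x = 0" if "x \<notin> S" for x
      using that test_functionE[OF \<psi>] test_functionE[OF d\<psi>] by (metis subsetD)+
    have i1: "integrable lebesgue (\<lambda>x. w x * ?d x)" if "locally_integrable_on S w" for w :: "'a \<Rightarrow> real"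
      using integrable_cutoff[OF that d\<psi>] by (simp add: mult.commute)
    have i2: "integrable lebesgue (\<lambda>x. (W x \<bullet> i) * \<psi> x)" if "locally_integrable_on S W" for W :: "'a \<Rightarrow> 'a"
      using integrable_inner[OF integrable_cutoff[OF that \<psi>], of i] by (simp add: mult.commute)
    have "(LINT x:S|lebesgue. (u x - v x) * ?d x) = (LINT x|lebesgue. u x * ?d x) - (LINT x|lebesgue. v x * ?d x)"
      by (subst set_lebesgue_integral_eq_outside)
        (auto simp: z left_diff_distrib intro!: Bochner_Integration.integral_diff i1 l)
    also have "\<dots> = (LINT x:S|lebesgue. u x * ?d x) - (LINT x:S|lebesgue. v x * ?d x)"
      by (subst (1 2) set_lebesgue_integral_eq_outside) (auto simp: z)
    also have "\<dots> = - (LINT x:S|lebesgue. (G x \<bullet> i) * \<psi> x) + (LINT x:S|lebesgue. (G' x \<bullet> i) * \<psi> x)"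
      using u v \<psi> i unfolding has_weak_gradient_def by simp
    also have "\<dots> = - (LINT x|lebesgue. (G x \<bullet> i) * \<psi> x) + (LINT x|lebesgue. (G' x \<bullet> i) * \<psi> x)"
      by (subst (1 2) set_lebesgue_integral_eq_outside) (auto simp: z)
    also have "\<dots> = - ((LINT x|lebesgue. (G x \<bullet> i) * \<psi> x) - (LINT x|lebesgue. (G' x \<bullet> i) * \<psi> x))" by simp
    also have "\<dots> = - (LINT x|lebesgue. ((G x - G' x) \<bullet> i) * \<psi> x)"
      by (subst Bochner_Integration.integral_diff[symmetric])
        (auto intro!: i2 l simp: inner_diff_left left_diff_distrib)
    also have "\<dots> = - (LINT x:S|lebesgue. ((G x - G' x) \<bullet> i) * \<psi> x)"
      by (subst set_lebesgue_integral_eq_outside) (auto simp: z)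
    finally show "(LINT x:S|lebesgue. (u x - v x) * ?d x) = - (LINT x:S|lebesgue. ((G x - G' x) \<bullet> i) * \<psi> x)" .
  qed
qed

section \<open>Modular convergence of mollifications\<close>

text \<open>What the approximation argument uses of the integrand. Convexity in \<open>t\<close> is replaced by
  the weaker monotonicity of \<open>H x t / t\<close>, and the last assumption is the comparison between
  nearby points from which (A1) follows as well.\<close>

locale modular_function =
  fixes S :: "'a::euclidean_space set" and H :: "'a \<Rightarrow> real \<Rightarrow> real"
  assumes open_S: "open S" and bounded_S: "bounded S"
    and H_nonneg: "x \<in> S \<Longrightarrow> 0 \<le> t \<Longrightarrow> 0 \<le> H x t"
    and H_zero: "x \<in> S \<Longrightarrow> H x 0 = 0"
    and H_ratio: "x \<in> S \<Longrightarrow> 0 < s \<Longrightarrow> s \<le> t \<Longrightarrow> t * H x s \<le> s * H x t"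
    and H_doubling: "1 \<le> L \<Longrightarrow> \<exists>C\<ge>0. \<forall>x\<in>S. \<forall>t\<ge>0. H x (L * t) \<le> C * H x t"
    and H_lower: "x \<in> S \<Longrightarrow> 0 \<le> t \<Longrightarrow> t \<le> 1 + H x t"
    and H_measurable: "f \<in> borel_measurable (lebesgue_on S) \<Longrightarrow>
        (\<lambda>x. H x \<bar>f x\<bar>) \<in> borel_measurable (lebesgue_on S)"
    and H_comparison: "0 \<le> K \<Longrightarrow> \<exists>C\<ge>0. \<forall>x\<in>S. \<forall>y\<in>S. \<forall>r t. 0 < r \<and> r \<le> 1 \<and> dist x y \<le> r \<and> 0 \<le> t \<and>
        H y t \<le> K * (1 / r) ^ DIM('a) \<longrightarrow> H x t \<le> C * (1 + H y t)"
begin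

lemma sets_S[measurable]: "S \<in> sets lebesgue" and sets_S': "S \<inter> space lebesgue \<in> sets lebesgue"
  using open_S by auto

lemma modular_eq: "modular S H u = (\<integral>\<^sup>+x. ennreal (H x \<bar>u x\<bar>) \<partial>lebesgue_on S)"
  unfolding modular_def using nn_integral_restrict_space[OF sets_S'] by simp

lemma H_mono: "x \<in> S \<Longrightarrow> 0 \<le> s \<Longrightarrow> s \<le> t \<Longrightarrow> H x s \<le> H x t"
proof (cases "s = 0")
  case False
  assume *: "x \<in> S" "0 \<le> s" "s \<le> t"
  with False have s: "0 < s" by simp
  have "t * H x s \<le> s * H x t" by (rule H_ratio) (use * s in auto)
  also have "\<dots> \<le> t * H x t" using * H_nonneg[of x t] by (intro mult_right_mono) auto
  finally show ?thesis using s * by simp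
qed (auto simp: H_zero H_nonneg)

lemma H_le_linear: "x \<in> S \<Longrightarrow> 0 \<le> t \<Longrightarrow> t \<le> 1 \<Longrightarrow> H x t \<le> t * H x 1"
  using H_ratio[of x t 1] H_zero[of x] by (cases "t = 0") auto

lemma H_quasi_triangle: "\<exists>D\<ge>0. \<forall>x\<in>S. \<forall>s\<ge>0. \<forall>t\<ge>0. H x (s + t) \<le> D * (H x s + H x t)"
proof -
  obtain D where D: "D \<ge> 0" "\<And>x t. x \<in> S \<Longrightarrow> t \<ge> 0 \<Longrightarrow> H x (2 * t) \<le> D * H x t"
    using H_doubling[of 2] by auto
  have "H x (s + t) \<le> D * (H x s + H x t)" if x: "x \<in> S" and st: "s \<ge> 0" "t \<ge> 0" for x s t
  proof -
    have "H x (s + t) \<le> H x (2 * max s t)" using st by (intro H_mono x) auto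
    also have "\<dots> \<le> D * H x (max s t)" using st x by (intro D(2)) auto
    also have "\<dots> \<le> D * (H x s + H x t)"
      using D(1) H_nonneg[OF x st(1)] H_nonneg[OF x st(2)] by (intro mult_left_mono) (auto simp: max_def)
    finally show ?thesis .
  qed
  then show ?thesis using D(1) by blast
qed

text \<open>Doubling and the quasi-triangle inequality in the one form needed for closure
  properties of the modular.\<close>

lemma H_linear_bound:
  assumes "0 \<le> A"
  shows "\<exists>C\<ge>0. \<forall>x\<in>S. \<forall>s\<ge>0. \<forall>t\<ge>0. H x (A * (s + t)) \<le> C * (H x s + H x t)"
proof -
  obtain D where D: "D \<ge> 0" "\<And>x s t. x \<in> S \<Longrightarrow> s \<ge> 0 \<Longrightarrow> t \<ge> 0 \<Longrightarrow> H x (s + t) \<le> D * (H x s + H x t)"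
    using H_quasi_triangle by blast
  obtain C where C: "C \<ge> 0" "\<And>x t. x \<in> S \<Longrightarrow> t \<ge> 0 \<Longrightarrow> H x (max 1 A * t) \<le> C * H x t"
    using H_doubling[of "max 1 A"] by auto
  have "H x (A * (s + t)) \<le> (C * D) * (H x s + H x t)" if x: "x \<in> S" and st: "s \<ge> 0" "t \<ge> 0" for x s t
  proof -
    have "H x (A * (s + t)) \<le> H x (max 1 A * (s + t))"
      using st assms by (intro H_mono x mult_right_mono) auto
    also have "\<dots> \<le> C * H x (s + t)" using st x by (intro C(2)) auto
    also have "\<dots> \<le> C * (D * (H x s + H x t))" using D(2)[OF x st] C(1) by (rule mult_left_mono)
    finally show ?thesis by (simp add: mult.assoc)
  qed
  then show ?thesis using C(1) D(1) by (intro exI[of _ "C * D"]) auto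
qed

lemma H_measurable_ennreal:
  "f \<in> borel_measurable (lebesgue_on S) \<Longrightarrow> (\<lambda>x. ennreal (H x \<bar>f x\<bar>)) \<in> borel_measurable (lebesgue_on S)"
  using H_measurable by measurable

lemma modular_finite:
  assumes m: "u1 \<in> borel_measurable (lebesgue_on S)" "u2 \<in> borel_measurable (lebesgue_on S)"
    and fin: "modular S H u1 < \<infinity>" "modular S H u2 < \<infinity>"
    and le: "\<And>x. x \<in> S \<Longrightarrow> \<bar>w x\<bar> \<le> A * (\<bar>u1 x\<bar> + \<bar>u2 x\<bar>)" and A: "0 \<le> A"
  shows "modular S H w < \<infinity>"
proof -
  obtain C where C: "C \<ge> 0" "\<And>x s t. x \<in> S \<Longrightarrow> s \<ge> 0 \<Longrightarrow> t \<ge> 0 \<Longrightarrow> H x (A * (s + t)) \<le> C * (H x s + H x t)"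
    using H_linear_bound[OF A] by blast
  note [measurable] = H_measurable_ennreal[OF m(1)] H_measurable_ennreal[OF m(2)]
  have "modular S H w \<le> (\<integral>\<^sup>+x. ennreal C * (ennreal (H x \<bar>u1 x\<bar>) + ennreal (H x \<bar>u2 x\<bar>)) \<partial>lebesgue_on S)"
    unfolding modular_eq
  proof (rule nn_integral_mono)
    fix x assume "x \<in> space (lebesgue_on S)"
    then have x: "x \<in> S" by simp
    have "H x \<bar>w x\<bar> \<le> H x (A * (\<bar>u1 x\<bar> + \<bar>u2 x\<bar>))" by (intro H_mono x le) auto
    also have "\<dots> \<le> C * (H x \<bar>u1 x\<bar> + H x \<bar>u2 x\<bar>)" by (intro C x) auto
    finally show "ennreal (H x \<bar>w x\<bar>) \<le> ennreal C * (ennreal (H x \<bar>u1 x\<bar>) + ennreal (H x \<bar>u2 x\<bar>))"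
      using C(1) H_nonneg[OF x] by (simp add: ennreal_leI flip: ennreal_plus ennreal_mult)
  qed
  also have "\<dots> = ennreal C * (modular S H u1 + modular S H u2)"
    unfolding modular_eq by (simp add: nn_integral_cmult nn_integral_add)
  also have "\<dots> < \<infinity>" using fin by (simp add: ennreal_mult_less_top)
  finally show ?thesis .
qed

lemma emeasure_S_finite: "emeasure lebesgue S < \<infinity>"
  using bounded_S open_S by (metis bounded_set_imp_lmeasurable fmeasurableD2 infinity_ennreal_def sets_S top.not_eq_extremum)

lemma modular_integrable:
  fixes f :: "'a \<Rightarrow> 'b::euclidean_space"
  assumes f: "f \<in> borel_measurable lebesgue" and zero: "\<And>x. x \<notin> S \<Longrightarrow> f x = 0"
    and fin: "modular S H (\<lambda>x. norm (f x)) < \<infinity>"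
  shows "integrable lebesgue (\<lambda>x. if x \<in> S then H x (norm (f x)) else 0)" (is "integrable _ ?F")
    and "integrable lebesgue f"
proof -
  have "(\<lambda>x. norm (f x)) \<in> borel_measurable (lebesgue_on S)"
    using f by (intro measurable_restrict_space1) measurable
  from H_measurable[OF this] have "(\<lambda>x. H x (norm (f x))) \<in> borel_measurable (lebesgue_on S)" by simp
  then have m: "?F \<in> borel_measurable lebesgue"
    using measurable_restrict_space_iff[OF sets_S', of 0 borel "\<lambda>x. H x (norm (f x))"] by simp
  have "(\<integral>\<^sup>+x. norm (?F x) \<partial>lebesgue) = modular S H (\<lambda>x. norm (f x))"
    unfolding modular_def using H_nonneg by (intro nn_integral_cong) (auto simp: indicator_def)
  then show F: "integrable lebesgue ?F" using m fin by (auto simp: integrable_iff_bounded)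
  have "integrable lebesgue (\<lambda>x. indicator S x + ?F x)"
    using emeasure_S_finite by (intro Bochner_Integration.integrable_add F integrable_real_indicator) auto
  then show "integrable lebesgue f"
  proof (rule Bochner_Integration.integrable_bound)
    show "AE x in lebesgue. norm (f x) \<le> norm (indicator S x + ?F x)"
    proof (rule AE_I2)
      fix x show "norm (f x) \<le> norm (indicator S x + ?F x)"
        using zero[of x] H_lower[of x "norm (f x)"] by (cases "x \<in> S") auto
    qed
  qed (rule f)
qed

text \<open>Let \<open>a\<close> be the mollification of \<open>\<bar>f\<bar>\<close> at \<open>x\<close>, let \<open>s = a / 2\<close>, and let \<open>M\<close> be the mollification
  of \<open>F\<close> at \<open>x\<close>. If \<open>m\<close> were a lower bound above \<open>M\<close> for \<open>H y s\<close> on the ball, then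
  \<open>m * t \<le> s * (m + H y t)\<close> for every \<open>t\<close>, by distinguishing \<open>t \<le> s\<close> and \<open>t > s\<close>. Averaging this
  with \<open>t = \<bar>f y\<bar>\<close> gives \<open>2 s m \<le> s (m + M)\<close>, that is \<open>m \<le> M\<close>, a contradiction. So
  \<open>H y s \<le> M + 1\<close> for some \<open>y\<close>, and \<open>M\<close> is at most of order \<open>r\<^sup>-\<^sup>N\<close>, which puts the comparison
  between \<open>x\<close> and \<open>y\<close> within reach.\<close>

lemma H_conv_le:
  fixes f :: "'a \<Rightarrow> 'b::euclidean_space"
  assumes f: "f \<in> borel_measurable lebesgue" and zero: "\<And>x. x \<notin> S \<Longrightarrow> f x = 0"
    and fin: "modular S H (\<lambda>x. norm (f x)) < \<infinity>"
  defines "F \<equiv> \<lambda>x. if x \<in> S then H x (norm (f x)) else 0"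
  shows "\<exists>C\<ge>0. \<forall>x\<in>S. \<forall>r. 0 < r \<and> r \<le> 1 \<longrightarrow>
    H x (norm (conv (mollifier r) f x)) \<le> C * (1 + conv (mollifier r) F x)"
proof -
  have F_int: "integrable lebesgue F" and f_int: "integrable lebesgue f"
    using modular_integrable[OF f zero fin] by (auto simp: F_def)
  have F_nonneg: "0 \<le> F x" for x using H_nonneg by (simp add: F_def)
  obtain B where B: "B \<ge> 0" "\<And>r x. r > 0 \<Longrightarrow> mollifier r (x::'a) \<le> B * (1/r) ^ DIM('a)"
    using mollifier_le by blast
  define I where "I = (LINT x|lebesgue. F x)"
  have I: "I \<ge> 0" unfolding I_def using F_nonneg by simp
  define K where "K = B * I + 1"
  have K: "K \<ge> 0" using B I by (simp add: K_def)
  obtain C0 where C0: "C0 \<ge> 0" "\<And>x y r t. x \<in> S \<Longrightarrow> y \<in> S \<Longrightarrow> 0 < r \<Longrightarrow> r \<le> 1 \<Longrightarrow> dist x y \<le> r \<Longrightarrow> 0 \<le> t \<Longrightarrow>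
        H y t \<le> K * (1 / r) ^ DIM('a) \<Longrightarrow> H x t \<le> C0 * (1 + H y t)"
    using H_comparison[OF K] by blast
  obtain D where D: "D \<ge> 0" "\<And>x t. x \<in> S \<Longrightarrow> t \<ge> 0 \<Longrightarrow> H x (2 * t) \<le> D * H x t"
    using H_doubling[of 2] by auto
  have "H x (norm (conv (mollifier r) f x)) \<le> (D * C0 * 2) * (1 + conv (mollifier r) F x)"
    if x: "x \<in> S" and r: "0 < r" "r \<le> 1" for x r
  proof -
    let ?\<eta> = "\<lambda>y. mollifier r (x - y)"
    have t: "test_function UNIV (mollifier r :: 'a \<Rightarrow> real)" by (rule test_function_mollifier[OF r(1)])
    have \<eta>0: "0 \<le> ?\<eta> y" for y by (rule mollifier_nonneg[OF r(1)])
    have \<eta>m: "?\<eta> \<in> borel_measurable borel"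
      using borel_measurable_mollifier[of r, where 'a='a] by measurable
    have \<eta>_int: "integrable lebesgue ?\<eta>" "(LINT y|lebesgue. ?\<eta> y) = 1"
      using integrable_mollifier_shift[OF r(1), of x] integral_mollifier_shift[OF r(1), of x] \<eta>m
      by (simp_all add: integrable_completion integral_completion)
    have F_i: "integrable lebesgue (\<lambda>y. ?\<eta> y * F y)"
      using integrable_conv[OF t F_int, of x] by simp
    have nf_i: "integrable lebesgue (\<lambda>y. ?\<eta> y * norm (f y))"
      using integrable_conv[OF t integrable_norm[OF f_int], of x] by simp
    define a where "a = (LINT y|lebesgue. ?\<eta> y * norm (f y))"
    define M where "M = conv (mollifier r) F x"
    have M_eq: "M = (LINT y|lebesgue. ?\<eta> y * F y)" by (simp add: M_def conv_def)
    have M0: "M \<ge> 0" unfolding M_eq using \<eta>0 F_nonneg by (intro Bochner_Integration.integral_nonneg) auto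
    have "M \<le> (LINT y|lebesgue. (B * (1/r) ^ DIM('a)) * F y)"
      unfolding M_eq using B(2)[OF r(1)] F_nonneg F_i F_int
      by (intro integral_mono) (auto intro: mult_right_mono)
    then have M_le: "M \<le> B * I * (1/r) ^ DIM('a)" by (simp add: I_def mult_ac)
    have na: "norm (conv (mollifier r) f x) \<le> a"
      unfolding conv_def a_def using \<eta>0 by (intro order_trans[OF integral_norm_bound]) simp
    have a0: "a \<ge> 0" using na norm_ge_zero order_trans by blast
    show ?thesis
    proof (cases "a = 0")
      case True
      then show ?thesis using na H_zero[OF x] D C0 M0 by (simp add: M_def)
    next
      case False
      define s where "s = a / 2"
      have s: "s > 0" using False a0 by (simp add: s_def)
      have "\<exists>y\<in>S. dist x y \<le> r \<and> H y s \<le> M + 1"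
      proof (rule ccontr)
        assume neg: "\<not> (\<exists>y\<in>S. dist x y \<le> r \<and> H y s \<le> M + 1)"
        have pw: "(M + 1) * (?\<eta> y * norm (f y)) \<le> s * ((M + 1) * ?\<eta> y + ?\<eta> y * F y)" for y
        proof (cases "y \<in> S \<and> dist x y \<le> r")
          case True
          then have Hy: "H y s > M + 1" using neg by auto
          have "(M + 1) * norm (f y) \<le> s * ((M + 1) + F y)"
          proof (cases "norm (f y) \<le> s")
            case True
            then have "(M + 1) * norm (f y) \<le> (M + 1) * s" using M0 by (intro mult_left_mono) auto
            also have "\<dots> \<le> s * ((M + 1) + F y)" using s F_nonneg[of y] by (simp add: algebra_simps)
            finally show ?thesis .
          next
            case False
            have "(M + 1) * norm (f y) \<le> norm (f y) * H y s"
              using Hy mult_right_mono[of "M + 1" "H y s" "norm (f y)"] by (simp add: mult.commute)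
            also have "\<dots> \<le> s * H y (norm (f y))" using True False s by (intro H_ratio) auto
            also have "\<dots> \<le> s * ((M + 1) + F y)" using True s M0 by (intro mult_left_mono) (auto simp: F_def)
            finally show ?thesis .
          qed
          from mult_left_mono[OF this \<eta>0[of y]] show ?thesis by (simp add: algebra_simps)
        next
          case False
          then have "f y = 0 \<or> ?\<eta> y = 0"
            using zero[of y] mollifier_eq_0[OF r(1), of "x - y"] by (auto simp: dist_norm)
          then show ?thesis using s M0 \<eta>0[of y] F_nonneg[of y] by auto
        qed
        have "(M + 1) * a \<le> s * ((M + 1) + M)"
        proof -
          have "(M + 1) * a = (LINT y|lebesgue. (M + 1) * (?\<eta> y * norm (f y)))" by (simp add: a_def)
          also have "\<dots> \<le> (LINT y|lebesgue. s * ((M + 1) * ?\<eta> y + ?\<eta> y * F y))"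
            using nf_i F_i \<eta>_int pw by (intro integral_mono) auto
          also have "\<dots> = s * ((M + 1) + M)" using F_i \<eta>_int by (simp add: M_eq)
          finally show ?thesis .
        qed
        moreover have "a = 2 * s" by (simp add: s_def)
        ultimately have "s * (2 * (M + 1)) \<le> s * ((M + 1) + M)" by (simp add: algebra_simps)
        then show False using s by simp
      qed
      then obtain y where y: "y \<in> S" "dist x y \<le> r" "H y s \<le> M + 1" by blast
      have "1 \<le> (1 / r) ^ DIM('a)" using r by (intro one_le_power) auto
      then have "H y s \<le> K * (1 / r) ^ DIM('a)"
        using y(3) M_le by (simp add: K_def distrib_right)
      then have "H x s \<le> C0 * (1 + H y s)" using s by (intro C0(2)[OF x y(1) r y(2)]) auto
      also have "\<dots> \<le> C0 * (2 * (1 + M))" using y(3) M0 C0(1) by (intro mult_left_mono) auto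
      finally have Hs: "H x s \<le> C0 * (2 * (1 + M))" .
      have "H x (norm (conv (mollifier r) f x)) \<le> H x (2 * s)" using na by (intro H_mono x) (auto simp: s_def)
      also have "\<dots> \<le> D * H x s" using s by (intro D x) auto
      also have "\<dots> \<le> D * (C0 * (2 * (1 + M)))" using Hs D(1) by (rule mult_left_mono)
      finally show ?thesis by (simp add: M_def mult_ac)
    qed
  qed
  then show ?thesis using D(1) C0(1) by (intro exI[of _ "D * C0 * 2"]) auto
qed

lemma nn_integral_lebesgue_on_le: "(\<integral>\<^sup>+x. f x \<partial>lebesgue_on S) \<le> (\<integral>\<^sup>+x. f x \<partial>lebesgue)"
  unfolding nn_integral_restrict_space[OF sets_S']
  by (intro nn_integral_mono) (auto simp: indicator_def)

text \<open>The pointwise estimate bounds the integrand \<open>h\<close> of the error by \<open>C (1 + 2 F) + C \<bar>E\<bar>\<close>,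
  where \<open>E\<close> is the error of mollifying \<open>F = H (\<cdot>, \<bar>f\<bar>)\<close>, small in \<open>L\<^sup>1\<close>. The excess of \<open>h\<close> over
  \<open>C \<bar>E\<bar>\<close> is dominated by an integrable function and tends to zero almost everywhere along
  a subsequence.\<close>

lemma modular_mollifier_tendsto_unscaled:
  fixes f :: "'a \<Rightarrow> 'b::euclidean_space"
  assumes f: "f \<in> borel_measurable lebesgue" and zero: "\<And>x. x \<notin> S \<Longrightarrow> f x = 0"
    and fin: "modular S H (\<lambda>x. norm (f x)) < \<infinity>" and \<delta>: "\<delta> > 0" and r0: "r0 > 0"
  shows "\<exists>r. 0 < r \<and> r < r0 \<and> modular S H (\<lambda>x. norm (conv (mollifier r) f x - f x)) \<le> ennreal \<delta>"
proof -
  define F where "F x = (if x \<in> S then H x (norm (f x)) else 0)" for x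
  have F_int: "integrable lebesgue F" and f_int: "integrable lebesgue f"
    using modular_integrable[OF f zero fin] by (auto simp: F_def[abs_def])
  have F_nonneg: "0 \<le> F x" for x using H_nonneg by (simp add: F_def)
  obtain C1 where C1: "C1 \<ge> 0" "\<And>x r. x \<in> S \<Longrightarrow> 0 < r \<Longrightarrow> r \<le> 1 \<Longrightarrow>
      H x (norm (conv (mollifier r) f x)) \<le> C1 * (1 + conv (mollifier r) F x)"
    using H_conv_le[OF f zero fin] unfolding F_def[abs_def] by blast
  obtain D where D: "D \<ge> 0" "\<And>x s t. x \<in> S \<Longrightarrow> s \<ge> 0 \<Longrightarrow> t \<ge> 0 \<Longrightarrow> H x (s + t) \<le> D * (H x s + H x t)"
    using H_quasi_triangle by blast
  define C where "C = D * (C1 + 1)"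
  have C: "C \<ge> 0" using D C1 by (simp add: C_def)
  let ?P = "\<lambda>n r. 0 < r \<and> r < min r0 1 \<and>
     (\<integral>\<^sup>+x. norm (conv (mollifier r) f x - f x) \<partial>lebesgue) \<le> ennreal (1 / real (Suc n)) \<and>
     (\<integral>\<^sup>+x. norm (conv (mollifier r) F x - F x) \<partial>lebesgue) \<le> ennreal (1 / real (Suc n))"
  have ex: "\<exists>r. ?P n r" for n
  proof -
    have p: "1 / real (Suc n) > 0" by simp
    obtain d1 where d1: "d1 > 0" "\<And>r. 0 < r \<Longrightarrow> r < d1 \<Longrightarrow>
        (\<integral>\<^sup>+x. norm (conv (mollifier r) f x - f x) \<partial>lebesgue) \<le> ennreal (1 / real (Suc n))"
      using mollifier_L1_tendsto[OF f_int p] by auto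
    obtain d2 where d2: "d2 > 0" "\<And>r. 0 < r \<Longrightarrow> r < d2 \<Longrightarrow>
        (\<integral>\<^sup>+x. norm (conv (mollifier r) F x - F x) \<partial>lebesgue) \<le> ennreal (1 / real (Suc n))"
      using mollifier_L1_tendsto[OF F_int p] by auto
    define r where "r = min (min r0 1) (min d1 d2) / 2"
    have "0 < r" "r < min r0 1" "r < d1" "r < d2" using r0 d1(1) d2(1) by (auto simp: r_def)
    then show ?thesis using d1(2) d2(2) by blast
  qed
  from choice[OF allI[OF ex]] obtain r where "\<forall>n. ?P n (r n)" ..
  then have r: "\<And>n. 0 < r n" "\<And>n. r n < min r0 1"
    "\<And>n. (\<integral>\<^sup>+x. norm (conv (mollifier (r n)) f x - f x) \<partial>lebesgue) \<le> ennreal (1 / real (Suc n))"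
    "\<And>n. (\<integral>\<^sup>+x. norm (conv (mollifier (r n)) F x - F x) \<partial>lebesgue) \<le> ennreal (1 / real (Suc n))"
    by simp_all
  have conv_m: "conv (mollifier (r n)) g \<in> borel_measurable lebesgue" if "integrable lebesgue g" for n
    and g :: "'a \<Rightarrow> 'c::euclidean_space"
    by (intro continuous_borel_measurable_lebesgue continuous_on_conv test_function_mollifier r that)
  define u where "u n x = conv (mollifier (r n)) f x - f x" for n x
  define E where "E n x = conv (mollifier (r n)) F x - F x" for n x
  have um: "u n \<in> borel_measurable lebesgue" for n unfolding u_def using conv_m[OF f_int] f by measurable
  have Em: "E n \<in> borel_measurable lebesgue" for n
    unfolding E_def using conv_m[OF F_int] borel_measurable_integrable[OF F_int] by measurable
  have u_int: "integrable lebesgue (u n)" for n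
    using um r(3)[of n] by (auto simp: integrable_iff_bounded u_def intro: le_less_trans)
  have u_lim: "(\<lambda>n. LINT x|lebesgue. norm (u n x)) \<longlonglongrightarrow> 0"
  proof (rule tendsto_sandwich[OF _ _ tendsto_const LIMSEQ_Suc[OF lim_1_over_n]])
    have "(LINT x|lebesgue. norm (u n x)) \<le> 1 / real (Suc n)" for n
    proof -
      have "ennreal (LINT x|lebesgue. norm (u n x)) = (\<integral>\<^sup>+x. norm (u n x) \<partial>lebesgue)"
        by (rule nn_integral_eq_integral[symmetric]) (use u_int in auto)
      also have "\<dots> \<le> ennreal (1 / real (Suc n))" using r(3) by (simp add: u_def)
      finally show ?thesis by (subst (asm) ennreal_le_iff) auto
    qed
    then show "\<forall>\<^sub>F n in sequentially. (LINT x|lebesgue. norm (u n x)) \<le> 1 / real (Suc n)" by simp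
  qed auto
  obtain k where k: "strict_mono k" "AE x in lebesgue. (\<lambda>n. u (k n) x) \<longlonglongrightarrow> 0"
    using tendsto_L1_AE_subseq[of lebesgue u, OF u_int u_lim] by blast
  define h where "h n x = H x (norm (u (k n) x))" for n x
  have hm: "h n \<in> borel_measurable (lebesgue_on S)" for n
  proof -
    have "(\<lambda>x. norm (u (k n) x)) \<in> borel_measurable (lebesgue_on S)"
      using um[of "k n"] by (intro measurable_restrict_space1) measurable
    from H_measurable[OF this] show ?thesis by (simp add: h_def[abs_def])
  qed
  have Em': "(\<lambda>x. E n x) \<in> borel_measurable (lebesgue_on S)" for n
    by (rule measurable_restrict_space1[OF Em])
  have Fm': "F \<in> borel_measurable (lebesgue_on S)"
    by (rule measurable_restrict_space1[OF borel_measurable_integrable[OF F_int]])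
  have h_le: "h n x \<le> C * (1 + 2 * F x) + C * \<bar>E (k n) x\<bar>" if x: "x \<in> S" for n x
  proof -
    let ?c = "conv (mollifier (r (k n)))"
    have "h n x \<le> H x (norm (?c f x) + norm (f x))"
      unfolding h_def u_def by (intro H_mono x norm_triangle_ineq4) auto
    also have "\<dots> \<le> D * (H x (norm (?c f x)) + F x)" using D(2)[OF x, of "norm (?c f x)" "norm (f x)"] x by (simp add: F_def)
    also have "\<dots> \<le> D * (C1 * (1 + ?c F x) + F x)"
      using C1(2)[OF x, of "r (k n)"] r(1)[of "k n"] r(2)[of "k n"] D(1) by (intro mult_left_mono add_mono) auto
    also have "\<dots> \<le> D * ((C1 + 1) * (1 + 2 * F x + \<bar>E (k n) x\<bar>))"
    proof (rule mult_left_mono[OF _ D(1)])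
      have "?c F x \<le> F x + \<bar>E (k n) x\<bar>" by (simp add: E_def)
      then have "C1 * (1 + ?c F x) \<le> C1 * (1 + 2 * F x + \<bar>E (k n) x\<bar>)"
        using C1(1) F_nonneg[of x] by (intro mult_left_mono) auto
      then show "C1 * (1 + ?c F x) + F x \<le> (C1 + 1) * (1 + 2 * F x + \<bar>E (k n) x\<bar>)"
        using F_nonneg[of x] by (simp add: distrib_right)
    qed
    finally show ?thesis by (simp add: C_def algebra_simps)
  qed
  define g where "g n x = max 0 (h n x - C * \<bar>E (k n) x\<bar>)" for n x
  have gm: "g n \<in> borel_measurable (lebesgue_on S)" for n
    unfolding g_def using hm[of n] Em'[of "k n"] by measurable
  have "(\<lambda>n. \<integral>\<^sup>+x. ennreal (norm (0 - g n x)) \<partial>lebesgue_on S) \<longlonglongrightarrow> 0"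
  proof (rule nn_integral_dominated_convergence_norm[where w="\<lambda>x. C * (1 + 2 * F x)"])
    show "(\<lambda>x. C * (1 + 2 * F x)) \<in> borel_measurable (lebesgue_on S)" using Fm' by measurable
    show "AE x in lebesgue_on S. norm (g n x) \<le> C * (1 + 2 * F x)" for n
    proof (rule AE_I2)
      fix x assume "x \<in> space (lebesgue_on S)"
      then have x: "x \<in> S" by simp
      show "norm (g n x) \<le> C * (1 + 2 * F x)"
        using h_le[OF x, of n] C F_nonneg[of x] by (simp add: g_def)
    qed
    have "(\<integral>\<^sup>+x. ennreal (C * (1 + 2 * F x)) \<partial>lebesgue_on S) =
        (\<integral>\<^sup>+x. ennreal (indicator S x * (C * (1 + 2 * F x))) \<partial>lebesgue)"
      unfolding nn_integral_restrict_space[OF sets_S'] by (intro nn_integral_cong) (auto simp: indicator_def)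
    also have "\<dots> < \<infinity>"
    proof -
      have "integrable lebesgue (\<lambda>x. C * (indicator S x + 2 * F x))"
        using F_int emeasure_S_finite by (intro integrable_mult_right Bochner_Integration.integrable_add integrable_real_indicator) auto
      moreover have "(\<lambda>x. C * (indicator S x + 2 * F x)) = (\<lambda>x. indicator S x * (C * (1 + 2 * F x)))"
        by (auto simp: indicator_def F_def)
      ultimately have i: "integrable lebesgue (\<lambda>x. indicator S x * (C * (1 + 2 * F x)))" by simp
      have "AE x in lebesgue. 0 \<le> indicator S x * (C * (1 + 2 * F x))"
        using C F_nonneg by (intro AE_I2 mult_nonneg_nonneg) (auto intro!: add_nonneg_nonneg)
      from nn_integral_eq_integral[OF i this] show ?thesis by simp
    qed
    finally show "(\<integral>\<^sup>+x. ennreal (C * (1 + 2 * F x)) \<partial>lebesgue_on S) < \<infinity>" .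
    have "AE x in lebesgue_on S. (\<lambda>n. u (k n) x) \<longlonglongrightarrow> 0"
      unfolding AE_restrict_space_iff[OF sets_S'] using k(2) by eventually_elim simp
    moreover have "AE x in lebesgue_on S. x \<in> S" by (rule AE_I2) simp
    ultimately show "AE x in lebesgue_on S. (\<lambda>n. g n x) \<longlonglongrightarrow> 0"
    proof eventually_elim
      case (elim x)
      have nu: "(\<lambda>n. norm (u (k n) x)) \<longlonglongrightarrow> 0" using elim(1) by (rule tendsto_norm_zero)
      have hl: "(\<lambda>n. h n x) \<longlonglongrightarrow> 0"
      proof (rule tendsto_sandwich[OF _ _ tendsto_const])
        show "\<forall>\<^sub>F n in sequentially. 0 \<le> h n x" using H_nonneg[OF elim(2)] by (simp add: h_def)
        have "\<forall>\<^sub>F n in sequentially. norm (u (k n) x) < 1" using nu by (rule order_tendstoD) simp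
        then show "\<forall>\<^sub>F n in sequentially. h n x \<le> norm (u (k n) x) * H x 1"
          by eventually_elim (auto simp: h_def intro!: H_le_linear[OF elim(2)])
        show "(\<lambda>n. norm (u (k n) x) * H x 1) \<longlonglongrightarrow> 0" using tendsto_mult_left_zero[OF nu] .
      qed
      show ?case
      proof (rule tendsto_sandwich[OF _ _ tendsto_const hl])
        show "\<forall>\<^sub>F n in sequentially. g n x \<le> h n x"
          using H_nonneg[OF elim(2)] C by (simp add: g_def h_def)
      qed (simp add: g_def)
    qed
  qed (use gm in auto)
  moreover have "0 < ennreal (\<delta>/2)" using \<delta> by simp
  ultimately have "\<forall>\<^sub>F n in sequentially. (\<integral>\<^sup>+x. ennreal (norm (0 - g n x)) \<partial>lebesgue_on S) < ennreal (\<delta>/2)"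
    by (rule order_tendstoD(2))
  moreover have "\<forall>\<^sub>F n in sequentially. C * (1 / real (Suc n)) < \<delta>/2"
    using tendsto_mult_right_zero[OF LIMSEQ_Suc[OF lim_1_over_n[where 'a=real]], of C] \<delta>
    by (intro order_tendstoD(2)) auto
  ultimately have "\<forall>\<^sub>F n in sequentially. (\<integral>\<^sup>+x. ennreal (norm (0 - g n x)) \<partial>lebesgue_on S) < ennreal (\<delta>/2) \<and>
      C * (1 / real (Suc n)) < \<delta>/2"
    by (rule eventually_conj)
  then obtain n where n: "(\<integral>\<^sup>+x. ennreal (norm (0 - g n x)) \<partial>lebesgue_on S) < ennreal (\<delta>/2)"
    "C * (1 / real (Suc n)) < \<delta>/2"
    by (auto simp: eventually_sequentially)
  have "modular S H (\<lambda>x. norm (u (k n) x)) = (\<integral>\<^sup>+x. ennreal (h n x) \<partial>lebesgue_on S)"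
    by (simp add: modular_eq h_def)
  also have "\<dots> \<le> (\<integral>\<^sup>+x. ennreal (norm (0 - g n x)) + ennreal C * ennreal \<bar>E (k n) x\<bar> \<partial>lebesgue_on S)"
    using C by (intro nn_integral_mono) (auto simp: g_def simp flip: ennreal_mult ennreal_plus intro!: ennreal_leI)
  also have "\<dots> = (\<integral>\<^sup>+x. ennreal (norm (0 - g n x)) \<partial>lebesgue_on S) + ennreal C * (\<integral>\<^sup>+x. ennreal \<bar>E (k n) x\<bar> \<partial>lebesgue_on S)"
    using gm[of n] Em'[of "k n"] by (subst nn_integral_add) (auto simp: nn_integral_cmult)
  also have "\<dots> \<le> ennreal (\<delta>/2) + ennreal C * ennreal (1 / real (Suc n))"
  proof (intro add_mono mult_left_mono)
    have "(\<integral>\<^sup>+x. ennreal \<bar>E (k n) x\<bar> \<partial>lebesgue_on S) \<le> (\<integral>\<^sup>+x. ennreal \<bar>E (k n) x\<bar> \<partial>lebesgue)"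
      by (rule nn_integral_lebesgue_on_le)
    also have "\<dots> \<le> ennreal (1 / real (Suc (k n)))" using r(4)[of "k n"] by (simp add: E_def)
    also have "\<dots> \<le> ennreal (1 / real (Suc n))"
      using seq_suble[OF k(1), of n] by (intro ennreal_leI) (simp add: frac_le)
    finally show "(\<integral>\<^sup>+x. ennreal \<bar>E (k n) x\<bar> \<partial>lebesgue_on S) \<le> ennreal (1 / real (Suc n))" .
  qed (use n in auto)
  also have "\<dots> = ennreal (\<delta>/2 + C * (1 / real (Suc n)))" using \<delta> C by (simp flip: ennreal_mult ennreal_plus)
  also have "\<dots> \<le> ennreal \<delta>" using n(2) by (intro ennreal_leI) linarith
  finally have "modular S H (\<lambda>x. norm (u (k n) x)) \<le> ennreal \<delta>" .
  then show ?thesis using r(1)[of "k n"] r(2)[of "k n"] unfolding u_def by (intro exI[of _ "r (k n)"]) auto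
qed

lemma conv_scaleR: "conv \<eta> (\<lambda>x. c *\<^sub>R f x) x = c *\<^sub>R conv \<eta> f x"
  unfolding conv_def by (subst integral_scaleR_right[symmetric]) (simp add: mult.commute)

lemma modular_mollifier_tendsto:
  fixes f :: "'a \<Rightarrow> 'b::euclidean_space"
  assumes f: "f \<in> borel_measurable lebesgue" and zero: "\<And>x. x \<notin> S \<Longrightarrow> f x = 0"
    and fin: "modular S H (\<lambda>x. norm (f x)) < \<infinity>" and \<delta>: "\<delta> > 0" and r0: "r0 > 0" and c: "c \<ge> 0"
  shows "\<exists>r. 0 < r \<and> r < r0 \<and> modular S H (\<lambda>x. c * norm (conv (mollifier r) f x - f x)) \<le> ennreal \<delta>"
proof -
  have m: "(\<lambda>x. norm (f x)) \<in> borel_measurable (lebesgue_on S)"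
    using f by (intro measurable_restrict_space1) measurable
  have "modular S H (\<lambda>x. norm (c *\<^sub>R f x)) < \<infinity>"
    by (rule modular_finite[OF m m fin fin _ c]) (use c in auto)
  moreover have "(\<lambda>x. c *\<^sub>R f x) \<in> borel_measurable lebesgue" using f by measurable
  ultimately obtain r where "0 < r" "r < r0"
    "modular S H (\<lambda>x. norm (conv (mollifier r) (\<lambda>x. c *\<^sub>R f x) x - c *\<^sub>R f x)) \<le> ennreal \<delta>"
    using modular_mollifier_tendsto_unscaled[of "\<lambda>x. c *\<^sub>R f x" \<delta> r0] zero \<delta> r0 by auto
  then show ?thesis using c by (intro exI[of _ r]) (simp add: conv_scaleR flip: scaleR_diff_right)
qed

text \<open>A replacement for countable convexity: with \<open>s\<^sub>k = 2\<^sup>k\<^sup>+\<^sup>1 a\<^sub>k\<close>, the sum of the \<open>a\<^sub>k\<close> is at most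
  the largest \<open>s\<^sub>k\<close>, and monotonicity of \<open>H x\<close> suffices.\<close>

lemma H_sum_le:
  assumes x: "x \<in> S" and a: "\<And>k. 0 \<le> a k"
  shows "ennreal (H x (\<Sum>k<n. a k)) \<le> (\<Sum>k. ennreal (H x (2 ^ Suc k * a k)))"
proof (cases n)
  case 0
  then show ?thesis using H_zero[OF x] by simp
next
  case (Suc m)
  let ?s = "\<lambda>k. 2 ^ Suc k * a k"
  have fin: "finite (?s ` {..<n})" "?s ` {..<n} \<noteq> {}" using Suc by auto
  define M where "M = Max (?s ` {..<n})"
  obtain j where j: "j < n" "M = ?s j" using Max_in[OF fin] unfolding M_def by auto
  have M: "M \<ge> 0" using j a by simp
  have le: "?s k \<le> M" if "k < n" for k unfolding M_def using fin that by (intro Max_ge) auto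
  have "(\<Sum>k<n. a k) \<le> (\<Sum>k<n. (1/2) ^ Suc k * M)"
  proof (rule sum_mono)
    fix k assume "k \<in> {..<n}"
    then have "(1/2) ^ Suc k * ?s k \<le> (1/2) ^ Suc k * M" using le by (intro mult_left_mono) auto
    then show "a k \<le> (1/2) ^ Suc k * M" by (simp add: power_one_over)
  qed
  also have "\<dots> = (\<Sum>k<n. (1/2) ^ Suc k) * M" by (simp add: sum_distrib_right)
  also have "\<dots> \<le> 1 * M"
  proof (rule mult_right_mono[OF _ M])
    have "(\<Sum>k<n. (1/2::real) ^ Suc k) \<le> (\<Sum>k. (1/2) ^ Suc k)"
      using power_half_series by (intro sum_le_suminf) (auto simp: sums_iff)
    also have "\<dots> = 1" using power_half_series by (simp add: sums_iff)
    finally show "(\<Sum>k<n. (1/2::real) ^ Suc k) \<le> 1" .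
  qed
  finally have "H x (\<Sum>k<n. a k) \<le> H x (?s j)"
    using a by (intro H_mono x) (auto simp: j intro!: sum_nonneg)
  then have "ennreal (H x (\<Sum>k<n. a k)) \<le> ennreal (H x (?s j))" by (rule ennreal_leI)
  also have "\<dots> \<le> (\<Sum>k. ennreal (H x (?s k)))"
    using sum_le_suminf[of "\<lambda>k. ennreal (H x (?s k))" "{j}"] by simp
  finally show ?thesis .
qed

end

section \<open>Smooth approximation in the Sobolev space\<close>

lemma gradient_cong:
  assumes "open U" "x \<in> U" "\<And>y. y \<in> U \<Longrightarrow> f y = g y" "f differentiable (at x)"
  shows "gradient f x = gradient g x"
  unfolding gradient_def
  using frechet_derivative_transform_within_open[OF assms(4,1,2,3)] by simp

lemma gradient_sum:
  assumes "\<And>k. k \<in> J \<Longrightarrow> f k differentiable (at x)"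
  shows "gradient (\<lambda>y. \<Sum>k\<in>J. f k y) x = (\<Sum>k\<in>J. gradient (f k) x)"
proof -
  have "((\<lambda>y. \<Sum>k\<in>J. f k y) has_derivative (\<lambda>h. \<Sum>k\<in>J. frechet_derivative (f k) (at x) h)) (at x)"
    by (rule has_derivative_sum) (use assms in \<open>simp add: frechet_derivative_works[symmetric]\<close>)
  then have "frechet_derivative (\<lambda>y. \<Sum>k\<in>J. f k y) (at x) = (\<lambda>h. \<Sum>k\<in>J. frechet_derivative (f k) (at x) h)"
    by (rule frechet_derivative_at[symmetric])
  then show ?thesis
    unfolding gradient_def by (simp add: scaleR_sum_left sum.swap[of _ _ J])
qed

lemma test_function_diff:
  assumes "test_function S f" "test_function S g"
  shows "test_function S (\<lambda>x. f x - g x)"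
proof -
  obtain K where K: "compact K" "K \<subseteq> S" "\<And>x. x \<notin> K \<Longrightarrow> f x = 0" using test_functionE[OF assms(1)] by metis
  obtain L where L: "compact L" "L \<subseteq> S" "\<And>x. x \<notin> L \<Longrightarrow> g x = 0" using test_functionE[OF assms(2)] by metis
  have "Cinf_on UNIV (\<lambda>x. f x - g x)"
    using test_function_imp_Cinf[OF assms(1)] test_function_imp_Cinf[OF assms(2)]
    unfolding Cinf_on_def by (auto intro: Ck_on_minus)
  then show ?thesis
    by (rule test_functionI[of _ "K \<union> L"]) (use K L in auto)
qed

lemma gradient_eq_0:
  assumes "open U" "x \<in> U" "\<And>y. y \<in> U \<Longrightarrow> f y = c"
  shows "gradient f x = 0"
proof -
  have "gradient (\<lambda>_. c) x = gradient f x"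
    by (rule gradient_cong[OF assms(1,2)]) (use assms(3) in auto)
  then show ?thesis by (simp add: gradient_def)
qed

text \<open>Differences of consecutive cutoffs telescope to a cutoff, so that they add up to one
  without any normalisation. They may change sign, which is harmless here.\<close>

lemma smooth_partition_of_unity:
  fixes S :: "'a::euclidean_space set"
  assumes S: "open S" "bounded S"
  obtains \<zeta> :: "nat \<Rightarrow> 'a \<Rightarrow> real" where "\<And>k. test_function S (\<zeta> k)"
    "\<And>k x. 2 / real (Suc k) < infdist x (- S) \<Longrightarrow> \<zeta> (Suc k) x = 0"
    "\<And>n x. 2 / real (Suc n) < infdist x (- S) \<Longrightarrow> (\<Sum>k\<le>n. \<zeta> k x) = 1"
    "\<And>n x. 2 / real (Suc n) < infdist x (- S) \<Longrightarrow> (\<Sum>k\<le>n. gradient (\<zeta> k) x) = 0"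
proof -
  obtain \<kappa> :: "nat \<Rightarrow> 'a \<Rightarrow> real" where \<kappa>: "\<And>n. test_function S (\<kappa> n)"
    "\<And>n x. 2 / real (Suc n) < infdist x (- S) \<Longrightarrow> \<kappa> n x = 1"
    using smooth_cutoffs[OF S] by metis
  define \<zeta> where "\<zeta> k x = (case k of 0 \<Rightarrow> \<kappa> 0 x | Suc j \<Rightarrow> \<kappa> (Suc j) x - \<kappa> j x)" for k x
  have sum: "(\<Sum>k\<le>n. \<zeta> k x) = \<kappa> n x" for n x
    by (induction n) (auto simp: \<zeta>_def)
  have test: "test_function S (\<zeta> k)" for k
    by (cases k) (auto simp: \<zeta>_def[abs_def] intro: test_function_diff \<kappa>)
  have d: "\<zeta> k differentiable (at x)" for k x
    using Cinf_on_differentiable[OF test_function_imp_Cinf[OF test]] by simp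
  show ?thesis
  proof (rule that[of \<zeta>])
    show "test_function S (\<zeta> k)" for k by (rule test)
    show "\<zeta> (Suc k) x = 0" if "2 / real (Suc k) < infdist x (- S)" for k x
    proof -
      have "2 / real (Suc (Suc k)) \<le> 2 / real (Suc k)" by (intro divide_left_mono) auto
      then have "2 / real (Suc (Suc k)) < infdist x (- S)" using that by linarith
      then show ?thesis using \<kappa>(2) that by (simp add: \<zeta>_def)
    qed
    show "(\<Sum>k\<le>n. \<zeta> k x) = 1" if "2 / real (Suc n) < infdist x (- S)" for n x
      using \<kappa>(2)[OF that] by (simp add: sum)
    show "(\<Sum>k\<le>n. gradient (\<zeta> k) x) = 0" if "2 / real (Suc n) < infdist x (- S)" for n x
    proof -
      have "open {x. 2 / real (Suc n) < infdist x (- S)}" by (intro open_Collect_less continuous_intros)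
      then have "gradient (\<kappa> n) x = 0"
        by (rule gradient_eq_0) (use that \<kappa>(2) in auto)
      moreover have "gradient (\<lambda>y. \<Sum>k\<le>n. \<zeta> k y) x = (\<Sum>k\<le>n. gradient (\<zeta> k) x)"
        by (rule gradient_sum) (rule d)
      ultimately show ?thesis by (simp add: sum[abs_def])
    qed
  qed
qed

text \<open>Pairing a function with its gradient lets one radius serve both.\<close>

lemma conv_Pair:
  fixes f :: "'a::euclidean_space \<Rightarrow> 'b::euclidean_space" and g :: "'a \<Rightarrow> 'c::euclidean_space"
  assumes \<eta>: "test_function UNIV \<eta>" and f: "integrable lebesgue f" and g: "integrable lebesgue g"
  shows "conv \<eta> (\<lambda>x. (f x, g x)) x = (conv \<eta> f x, conv \<eta> g x)"
proof -
  have i1: "integrable lebesgue (\<lambda>y. (f y, 0::'c))"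
    using integrable_bounded_linear[OF bounded_linear_Pair[OF bounded_linear_ident bounded_linear_zero] f] .
  have i2: "integrable lebesgue (\<lambda>y. (0::'b, g y))"
    using integrable_bounded_linear[OF bounded_linear_Pair[OF bounded_linear_zero bounded_linear_ident] g] .
  have "integrable lebesgue (\<lambda>y. (f y, 0) + (0, g y))" by (intro Bochner_Integration.integrable_add i1 i2)
  then have i: "integrable lebesgue (\<lambda>y. (f y, g y))" by simp
  have "fst (conv \<eta> (\<lambda>x. (f x, g x)) x) = conv \<eta> f x"
    unfolding conv_def
    by (subst integral_bounded_linear[OF bounded_linear_fst integrable_conv[OF \<eta> i], symmetric]) simp
  moreover have "snd (conv \<eta> (\<lambda>x. (f x, g x)) x) = conv \<eta> g x"
    unfolding conv_def
    by (subst integral_bounded_linear[OF bounded_linear_snd integrable_conv[OF \<eta> i], symmetric]) simp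
  ultimately show ?thesis by (metis prod.collapse)
qed

lemma borel_measurable_lebesgue_on_locally_integrable:
  fixes G :: "'a::euclidean_space \<Rightarrow> 'b::euclidean_space"
  assumes S: "open S" "bounded S" and G: "locally_integrable_on S G"
  shows "G \<in> borel_measurable (lebesgue_on S)"
proof -
  obtain \<zeta> :: "nat \<Rightarrow> 'a \<Rightarrow> real" where \<zeta>: "\<And>k. test_function S (\<zeta> k)"
    "\<And>n x. 2 / real (Suc n) < infdist x (- S) \<Longrightarrow> \<zeta> n x = 1"
    using smooth_cutoffs[OF S] by metis
  have "S \<noteq> UNIV" using S(2) not_bounded_UNIV by blast
  then have ne: "- S \<noteq> {}" by auto
  show ?thesis
  proof (rule borel_measurable_LIMSEQ_metric[where f="\<lambda>n x. \<zeta> n x *\<^sub>R G x"])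
    show "(\<lambda>x. \<zeta> n x *\<^sub>R G x) \<in> borel_measurable (lebesgue_on S)" for n
      by (rule measurable_restrict_space1[OF borel_measurable_integrable[OF integrable_cutoff[OF G \<zeta>(1)]]])
    fix x assume "x \<in> space (lebesgue_on S)"
    then have "x \<in> S" by simp
    then obtain n where n: "2 / real (Suc n) < infdist x (- S)"
      using infdist_exhaustion[OF S(1) ne] by metis
    have "\<zeta> m x = 1" if "m \<ge> n" for m
    proof -
      have "2 / real (Suc m) \<le> 2 / real (Suc n)" using that by (intro divide_left_mono) auto
      then show ?thesis using \<zeta>(2)[of m x] n by linarith
    qed
    then have "\<forall>\<^sub>F m in sequentially. \<zeta> m x *\<^sub>R G x = G x"
      by (intro eventually_sequentiallyI[of n]) simp
    then show "(\<lambda>n. \<zeta> n x *\<^sub>R G x) \<longlonglongrightarrow> G x" by (rule tendsto_eventually)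
  qed
qed

context modular_function begin

lemma modular_cong_AE:
  assumes "AE x in lebesgue. x \<in> S \<longrightarrow> \<bar>u x\<bar> = \<bar>w x\<bar>"
  shows "modular S H u = modular S H w"
  unfolding modular_def
  by (rule nn_integral_cong_AE) (use assms in \<open>eventually_elim, auto simp: indicator_def\<close>)

lemma modular_mono: "(\<And>x. x \<in> S \<Longrightarrow> \<bar>u x\<bar> \<le> \<bar>w x\<bar>) \<Longrightarrow> modular S H u \<le> modular S H w"
  unfolding modular_eq by (intro nn_integral_mono ennreal_leI H_mono) auto

text \<open>The approximation \<open>v\<close> is the sum of the pieces \<open>\<zeta>\<^sub>k u\<close>, mollified with radii
  \<open>r\<^sub>k < 1 / (k + 1)\<close>. These radii keep the sum locally finite. They are also so small that
  the \<open>k\<close>-th error, multiplied by \<open>2\<^sup>k\<^sup>+\<^sup>1 / l\<close>, has modular at most \<open>2\<^sup>-\<^sup>k\<^sup>-\<^sup>2\<close>; by \<open>H_sum_le\<close>, the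
  total error divided by \<open>l\<close> then has modular at most \<open>1 / 2\<close>, for the function and for the
  gradient.\<close>

theorem smooth_approximation:
  assumes u: "u \<in> MO_Sobolev S H" and \<epsilon>: "\<epsilon> > 0"
  shows "\<exists>v. Cinf_on S v \<and> v \<in> MO_Sobolev S H \<and> MO_Sobolev_norm S H (\<lambda>x. u x - v x) < \<epsilon>"
proof -
  define G where "G = weak_gradient S u"
  have wg: "has_weak_gradient S z (weak_gradient S z)" if "has_weak_gradient S z Z" for z Z
    unfolding weak_gradient_def by (rule someI[of "\<lambda>G. has_weak_gradient S z G", OF that])
  have uG: "has_weak_gradient S u G"
    using u wg unfolding MO_Sobolev_def G_def by blast
  have um: "u \<in> borel_measurable (lebesgue_on S)" and u_fin: "modular S H u < \<infinity>"
    and Gm: "(\<lambda>x. norm (G x)) \<in> borel_measurable (lebesgue_on S)" and G_fin: "modular S H (\<lambda>x. norm (G x)) < \<infinity>"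
    using u by (auto simp: MO_Sobolev_def MO_space_def G_def)
  have "S \<noteq> UNIV" using bounded_S not_bounded_UNIV by blast
  then have ne: "- S \<noteq> {}" by auto
  define l where "l = \<epsilon> / 2"
  have l: "l > 0" using \<epsilon> by (simp add: l_def)
  obtain \<zeta> :: "nat \<Rightarrow> 'a \<Rightarrow> real" where \<zeta>: "\<And>k. test_function S (\<zeta> k)"
    "\<And>k x. 2 / real (Suc k) < infdist x (- S) \<Longrightarrow> \<zeta> (Suc k) x = 0"
    "\<And>n x. 2 / real (Suc n) < infdist x (- S) \<Longrightarrow> (\<Sum>k\<le>n. \<zeta> k x) = 1"
    "\<And>n x. 2 / real (Suc n) < infdist x (- S) \<Longrightarrow> (\<Sum>k\<le>n. gradient (\<zeta> k) x) = 0"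
    using smooth_partition_of_unity[OF open_S bounded_S] by metis
  define f where "f k x = \<zeta> k x * u x" for k x
  define g where "g k x = \<zeta> k x *\<^sub>R G x + u x *\<^sub>R gradient (\<zeta> k) x" for k x
  have f_int: "integrable lebesgue (f k)" and g_int: "integrable lebesgue (g k)" for k
    using integrable_cutoff_gradient[OF uG \<zeta>(1)] by (simp_all add: f_def[abs_def] g_def[abs_def])
  have hm: "(\<lambda>x. (f k x, g k x)) \<in> borel_measurable lebesgue" for k
    using f_int[of k] g_int[of k] by (intro borel_measurable_Pair) auto
  have \<zeta>0: "\<zeta> k x = 0" "gradient (\<zeta> k) x = 0" if "x \<notin> S" for k x
  proof -
    obtain K where K: "compact K" "K \<subseteq> S" "\<And>x. x \<notin> K \<Longrightarrow> \<zeta> k x = 0" using test_functionE[OF \<zeta>(1)] by metis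
    have xK: "x \<notin> K" using that K(2) by auto
    show "\<zeta> k x = 0" using K(3) xK .
    have "open (- K)" using K(1) compact_imp_closed by blast
    then show "gradient (\<zeta> k) x = 0" by (rule gradient_eq_0) (use K(3) xK in auto)
  qed
  have h0: "(f k x, g k x) = 0" if "x \<notin> S" for k x
    using \<zeta>0[OF that] by (simp add: f_def g_def zero_prod_def)
  have h_fin: "modular S H (\<lambda>x. norm (f k x, g k x)) < \<infinity>" for k
  proof -
    obtain B where B: "B \<ge> 0" "\<And>x. \<bar>\<zeta> k x\<bar> \<le> B" using test_function_bounded[OF \<zeta>(1)] by metis
    obtain L where L: "L \<ge> 0" "\<And>x h. \<bar>frechet_derivative (\<zeta> k) (at x) h\<bar> \<le> L * norm h"
      using test_function_deriv_bounded[OF \<zeta>(1)] by metis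
    have gr: "norm (gradient (\<zeta> k) x) \<le> L * DIM('a)" for x
    proof -
      have "norm (gradient (\<zeta> k) x) \<le> (\<Sum>i\<in>Basis. norm (frechet_derivative (\<zeta> k) (at x) i *\<^sub>R i))"
        unfolding gradient_def by (rule norm_sum)
      also have "\<dots> \<le> (\<Sum>i\<in>(Basis::'a set). L)"
      proof (rule sum_mono)
        fix i :: 'a assume "i \<in> Basis"
        then show "norm (frechet_derivative (\<zeta> k) (at x) i *\<^sub>R i) \<le> L" using L(2)[of x i] by simp
      qed
      finally show ?thesis by (simp add: mult.commute)
    qed
    show ?thesis
    proof (rule modular_finite[OF um Gm u_fin G_fin, of _ "B + L * DIM('a)"])
      fix x
      have "norm (f k x, g k x) \<le> norm (f k x) + norm (g k x)" by (rule norm_Pair_le)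
      also have "norm (f k x) \<le> B * \<bar>u x\<bar>" using B by (simp add: f_def abs_mult mult_right_mono)
      also have "norm (g k x) \<le> B * norm (G x) + \<bar>u x\<bar> * (L * DIM('a))"
        unfolding g_def using B gr by (intro norm_triangle_le add_mono) (auto intro!: mult_mono)
      finally have "norm (f k x, g k x) \<le> B * \<bar>u x\<bar> + (B * norm (G x) + \<bar>u x\<bar> * (L * DIM('a)))" by simp
      also have "\<dots> \<le> (B + L * DIM('a)) * (\<bar>u x\<bar> + norm (G x))"
        using L(1) by (simp add: algebra_simps)
      finally show "\<bar>norm (f k x, g k x)\<bar> \<le> (B + L * DIM('a)) * (\<bar>u x\<bar> + \<bar>norm (G x)\<bar>)" by simp
    qed (use B L in auto)
  qed
  define c where "c k = 2 ^ Suc k / l" for k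
  let ?P = "\<lambda>k r. 0 < r \<and> r < 1 / real (Suc k) \<and>
      modular S H (\<lambda>x. c k * norm (conv (mollifier r) (\<lambda>x. (f k x, g k x)) x - (f k x, g k x)))
        \<le> ennreal ((1/2) ^ Suc k * (1/2))"
  have ex: "\<exists>r. ?P k r" for k
    by (rule modular_mollifier_tendsto[OF hm h0 h_fin]) (use l in \<open>auto simp: c_def\<close>)
  from choice[OF allI[OF ex]] obtain r where r_all: "\<forall>k. ?P k (r k)" ..
  then have r: "0 < r k" "r k < 1 / real (Suc k)" for k by auto
  note t = test_function_mollifier[OF r(1)]
  define w where "w k x = norm (conv (mollifier (r k)) (\<lambda>x. (f k x, g k x)) x - (f k x, g k x))" for k x
  have w_le: "modular S H (\<lambda>x. c k * w k x) \<le> ennreal ((1/2) ^ Suc k * (1/2))" for k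
    using r_all by (simp add: w_def)
  have w_eq: "w k x = norm (conv (mollifier (r k)) (f k) x - f k x, conv (mollifier (r k)) (g k) x - g k x)" for k x
    by (simp add: w_def conv_Pair[OF t f_int g_int])
  have wm: "w k \<in> borel_measurable (lebesgue_on S)" for k
  proof -
    have "integrable lebesgue (\<lambda>x. (f k x, g k x))" by (rule modular_integrable(2)[OF hm h0 h_fin])
    then have "conv (mollifier (r k)) (\<lambda>x. (f k x, g k x)) \<in> borel_measurable lebesgue"
      by (intro continuous_borel_measurable_lebesgue continuous_on_conv t)
    then have "w k \<in> borel_measurable lebesgue" unfolding w_def using hm[of k] by measurable
    then show ?thesis by (rule measurable_restrict_space1)
  qed
  define v where "v x = (\<Sum>k. conv (mollifier (r k)) (f k) x)" for x
  \<comment> \<open>The piece \<open>k + 1\<close> lives where the distance to the complement is at most \<open>2 / (k + 1)\<close>, its mollification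
    where it is at most \<open>3 / (k + 1)\<close>; so only finitely many pieces are seen on the open sets \<open>U n\<close>.\<close>
  define U where "U n = {x. 3 / real (Suc n) < infdist x (- S)}" for n
  have U_open: "open (U n)" for n unfolding U_def by (intro open_Collect_less continuous_intros)
  have U_sub: "U n \<subseteq> S" for n
  proof
    fix x assume "x \<in> U n"
    then have "0 < infdist x (- S)" unfolding U_def by (auto intro: le_less_trans[rotated])
    then show "x \<in> S" using infdist_zero[of x "- S"] by (cases "x \<in> S") auto
  qed
  have U_cover: "\<exists>n. x \<in> U n" if "x \<in> S" for x
  proof -
    have "infdist x (- S) > 0" using that ne open_S infdist_pos_not_in_closed[of "- S" x] by auto
    then obtain n where "1 / real (Suc n) < infdist x (- S) / 3"
      using nat_approx_posE[of "infdist x (- S) / 3"] by auto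
    then show ?thesis by (auto simp: U_def)
  qed
  have conv0: "conv (mollifier (r (Suc k))) (f (Suc k)) x = 0" if x: "x \<in> U n" and k: "n \<le> k" for n k x
  proof -
    have "mollifier (r (Suc k)) (x - y) *\<^sub>R f (Suc k) y = 0" for y
    proof (cases "norm (x - y) < r (Suc k)")
      case True
      have "r (Suc k) < 1 / real (Suc (Suc k))" by (rule r)
      also have "\<dots> \<le> 1 / real (Suc k)" by (intro divide_left_mono) auto
      finally have 1: "norm (x - y) < 1 / real (Suc k)" using True by simp
      have "3 / real (Suc k) \<le> 3 / real (Suc n)" using k by (intro divide_left_mono) auto
      then have "3 / real (Suc k) < infdist x (- S)" using x by (simp add: U_def)
      moreover have "infdist x (- S) \<le> infdist y (- S) + dist x y" by (rule infdist_triangle)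
      ultimately have "3 / real (Suc k) < infdist y (- S) + 1 / real (Suc k)" using 1 by (simp add: dist_norm)
      moreover have "3 / real (Suc k) = 2 / real (Suc k) + 1 / real (Suc k)" by (simp flip: add_divide_distrib)
      ultimately have "2 / real (Suc k) < infdist y (- S)" by linarith
      then show ?thesis using \<zeta>(2) by (simp add: f_def)
    qed (use mollifier_eq_0[OF r(1)[of "Suc k"], of "x - y"] in simp)
    then show ?thesis unfolding conv_def by (simp only:) simp
  qed
  have v_eq: "v x = (\<Sum>k\<le>n. conv (mollifier (r k)) (f k) x)" if x: "x \<in> U n" for n x
    unfolding v_def
  proof (rule suminf_finite)
    fix k assume "k \<notin> {..n}"
    then obtain j where "k = Suc j" "n \<le> j" by (cases k) auto
    then show "conv (mollifier (r k)) (f k) x = 0" using conv0[OF x] by simp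
  qed simp
  have conv_Cinf: "Cinf_on UNIV (conv (mollifier (r k)) (f k))" for k by (rule Cinf_conv[OF t f_int])
  have v_Cinf: "Cinf_on S v"
    unfolding Cinf_on_def
  proof (intro allI Ck_on_local)
    fix k x assume "x \<in> S"
    then obtain n where n: "x \<in> U n" using U_cover by blast
    have "Ck_on k (U n) (\<lambda>x. \<Sum>j\<le>n. conv (mollifier (r j)) (f j) x)"
    proof (rule Ck_on_sum[OF U_open])
      show "Ck_on k (U n) (conv (mollifier (r j)) (f j))" for j
        using conv_Cinf[of j] Ck_on_subset[of k UNIV _ "U n"] by (simp add: Cinf_on_def)
    qed
    then have "Ck_on k (U n) v" by (rule Ck_on_cong[OF U_open, rotated]) (rule v_eq[symmetric])
    then show "\<exists>U. open U \<and> x \<in> U \<and> Ck_on k U v" using U_open n by blast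
  qed
  have gv_eq: "gradient v x = (\<Sum>k\<le>n. conv (mollifier (r k)) (g k) x)" if x: "x \<in> U n" for n x
  proof -
    have d: "conv (mollifier (r k)) (f k) differentiable (at x)" for k
      using Cinf_on_differentiable[OF conv_Cinf] by simp
    have "gradient v x = gradient (\<lambda>x. \<Sum>k\<le>n. conv (mollifier (r k)) (f k) x) x"
      by (rule gradient_cong[OF U_open x v_eq]) (use Cinf_on_differentiable[OF v_Cinf] U_sub x in auto)
    also have "\<dots> = (\<Sum>k\<le>n. gradient (conv (mollifier (r k)) (f k)) x)" by (rule gradient_sum[OF d])
    also have "\<dots> = (\<Sum>k\<le>n. conv (mollifier (r k)) (g k) x)"
      unfolding f_def[abs_def] g_def[abs_def] by (simp only: gradient_conv_cutoff[OF uG \<zeta>(1) t])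
    finally show ?thesis .
  qed
  define W where "W x = norm (v x - u x, gradient v x - G x)" for x
  have W_le: "W x \<le> (\<Sum>k<Suc n. w k x)" if x: "x \<in> U n" for n x
  proof -
    have "2 / real (Suc n) \<le> 3 / real (Suc n)" by (intro divide_right_mono) auto
    then have x2: "2 / real (Suc n) < infdist x (- S)" using x by (simp add: U_def)
    have us: "u x = (\<Sum>k\<le>n. f k x)"
      unfolding f_def using \<zeta>(3)[OF x2] by (simp flip: sum_distrib_right)
    have Gs: "G x = (\<Sum>k\<le>n. g k x)"
      unfolding g_def using \<zeta>(3)[OF x2] \<zeta>(4)[OF x2]
      by (simp add: sum.distrib flip: scaleR_sum_left scaleR_sum_right)
    have "(v x - u x, gradient v x - G x) =
      (\<Sum>k\<le>n. (conv (mollifier (r k)) (f k) x - f k x, conv (mollifier (r k)) (g k) x - g k x))"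
      unfolding v_eq[OF x] gv_eq[OF x] us Gs by (simp add: sum_prod sum_subtractf)
    then have "W x \<le> (\<Sum>k\<le>n. w k x)" unfolding W_def w_eq by (simp only: norm_sum)
    then show ?thesis by (simp add: lessThan_Suc_atMost)
  qed
  have "modular S H (\<lambda>x. W x / l) \<le> (\<integral>\<^sup>+x. (\<Sum>k. ennreal (H x \<bar>c k * w k x\<bar>)) \<partial>lebesgue_on S)"
    unfolding modular_eq
  proof (rule nn_integral_mono)
    fix x assume "x \<in> space (lebesgue_on S)"
    then have x: "x \<in> S" by simp
    then obtain n where n: "x \<in> U n" using U_cover by blast
    have "H x \<bar>W x / l\<bar> \<le> H x (\<Sum>k<Suc n. w k x / l)"
      using W_le[OF n] l by (intro H_mono x) (auto simp: W_def divide_right_mono simp flip: sum_divide_distrib simp del: sum.lessThan_Suc)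
    then have "ennreal (H x \<bar>W x / l\<bar>) \<le> ennreal (H x (\<Sum>k<Suc n. w k x / l))" by (rule ennreal_leI)
    also have "\<dots> \<le> (\<Sum>k. ennreal (H x (2 ^ Suc k * (w k x / l))))"
      by (rule H_sum_le[OF x]) (use l in \<open>simp add: w_def\<close>)
    also have "\<dots> = (\<Sum>k. ennreal (H x \<bar>c k * w k x\<bar>))"
      using l by (simp add: c_def w_def abs_mult)
    finally show "ennreal (H x \<bar>W x / l\<bar>) \<le> (\<Sum>k. ennreal (H x \<bar>c k * w k x\<bar>))" .
  qed
  also have "\<dots> = (\<Sum>k. modular S H (\<lambda>x. c k * w k x))"
    unfolding modular_eq
    by (rule nn_integral_suminf) (intro H_measurable_ennreal borel_measurable_times borel_measurable_const wm)
  also have "\<dots> \<le> (\<Sum>k. ennreal ((1/2) ^ Suc k * (1/2)))"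
    by (intro suminf_le w_le) auto
  also have "\<dots> = ennreal (1 * (1/2))"
    using sums_mult2[OF power_half_series, of "1/2"] by (intro suminf_ennreal_eq) auto
  finally have W_half: "modular S H (\<lambda>x. W x / l) \<le> ennreal (1/2)" by simp
  have gvS: "has_weak_gradient S v (gradient v)" by (rule has_weak_gradient_smooth[OF open_S v_Cinf])
  have v_m: "v \<in> borel_measurable (lebesgue_on S)" and gv_m: "gradient v \<in> borel_measurable (lebesgue_on S)"
    and G_m: "G \<in> borel_measurable (lebesgue_on S)"
    using gvS uG unfolding has_weak_gradient_def
    by (auto intro: borel_measurable_lebesgue_on_locally_integrable[OF open_S bounded_S])
  have Wl_m: "(\<lambda>x. W x / l) \<in> borel_measurable (lebesgue_on S)"
    unfolding W_def using v_m um gv_m G_m by measurable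
  have Wl_fin: "modular S H (\<lambda>x. W x / l) < \<infinity>" using le_less_trans[OF W_half ennreal_less_top] by simp
  have W1: "\<bar>v x - u x\<bar> \<le> W x" and W2: "norm (gradient v x - G x) \<le> W x" for x
    using norm_fst_le[of "v x - u x" "gradient v x - G x"] norm_snd_le[of "gradient v x - G x" "v x - u x"]
    by (auto simp: W_def)
  have W0: "0 \<le> W x" for x by (simp add: W_def)
  have le_max: "a + W x \<le> (1 + l) * (a + W x / l)" if "0 \<le> a" for a x
    using that l W0[of x] by (simp add: field_simps)
  have v_fin: "modular S H v < \<infinity>"
  proof (rule modular_finite[OF um Wl_m u_fin Wl_fin])
    show "\<bar>v x\<bar> \<le> (1 + l) * (\<bar>u x\<bar> + \<bar>W x / l\<bar>)" for x
      using W1[of x] le_max[of "\<bar>u x\<bar>" x] W0[of x] l by simp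
  qed (use l in simp)
  have gv_fin: "modular S H (\<lambda>x. norm (gradient v x)) < \<infinity>"
  proof (rule modular_finite[OF Gm Wl_m G_fin Wl_fin])
    fix x
    have "norm (gradient v x) \<le> norm (G x) + norm (gradient v x - G x)"
      by (metis add.commute diff_add_cancel norm_triangle_ineq)
    then show "\<bar>norm (gradient v x)\<bar> \<le> (1 + l) * (\<bar>norm (G x)\<bar> + \<bar>W x / l\<bar>)"
      using W2[of x] le_max[of "norm (G x)" x] W0[of x] l by simp
  qed (use l in simp)
  have v_AE: "AE x in lebesgue. x \<in> S \<longrightarrow> weak_gradient S v x = gradient v x"
    by (rule weak_gradient_unique[OF open_S bounded_S wg[OF gvS] gvS])
  have "modular S H (\<lambda>x. norm (weak_gradient S v x)) = modular S H (\<lambda>x. norm (gradient v x))"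
    by (rule modular_cong_AE) (use v_AE in \<open>eventually_elim, auto\<close>)
  moreover have "(\<lambda>x. norm (weak_gradient S v x)) \<in> borel_measurable (lebesgue_on S)"
  proof -
    have "weak_gradient S v \<in> borel_measurable (lebesgue_on S)"
      using wg[OF gvS] unfolding has_weak_gradient_def
      by (auto intro: borel_measurable_lebesgue_on_locally_integrable[OF open_S bounded_S])
    then show ?thesis by measurable
  qed
  ultimately have v_in: "v \<in> MO_Sobolev S H"
    using v_m v_fin gv_fin gvS by (auto simp: MO_Sobolev_def MO_space_def)
  note dS = has_weak_gradient_diff[OF uG gvS]
  have d_AE: "AE x in lebesgue. x \<in> S \<longrightarrow> weak_gradient S (\<lambda>x. u x - v x) x = G x - gradient v x"
    by (rule weak_gradient_unique[OF open_S bounded_S wg[OF dS] dS])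
  have "modular S H (\<lambda>x. (u x - v x) / l) \<le> modular S H (\<lambda>x. W x / l)"
    by (rule modular_mono) (use W1 W0 l in \<open>auto simp: abs_minus_commute intro!: divide_right_mono\<close>)
  then have 1: "modular S H (\<lambda>x. (u x - v x) / l) \<le> ennreal (1/2)" using W_half by (rule order_trans)
  have "modular S H (\<lambda>x. norm (weak_gradient S (\<lambda>x. u x - v x) x) / l) = modular S H (\<lambda>x. norm (G x - gradient v x) / l)"
    by (rule modular_cong_AE) (use d_AE in \<open>eventually_elim, auto\<close>)
  also have "\<dots> \<le> modular S H (\<lambda>x. W x / l)"
    by (rule modular_mono) (use W2 W0 l in \<open>auto simp: norm_minus_commute intro!: divide_right_mono\<close>)
  finally have 2: "modular S H (\<lambda>x. norm (weak_gradient S (\<lambda>x. u x - v x) x) / l) \<le> ennreal (1/2)"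
    using W_half by (rule order_trans)
  have "modular S H (\<lambda>x. (u x - v x) / l) + modular S H (\<lambda>x. norm (weak_gradient S (\<lambda>x. u x - v x) x) / l)
      \<le> ennreal (1/2) + ennreal (1/2)"
    by (rule add_mono[OF 1 2])
  also have "\<dots> = ennreal (1/2 + 1/2)" by (rule ennreal_plus[symmetric]) auto
  also have "\<dots> = 1" by simp
  finally have "MO_Sobolev_norm S H (\<lambda>x. u x - v x) \<le> l"
    unfolding MO_Sobolev_norm_def using l by (intro cInf_lower) (auto intro!: bdd_belowI[of _ 0])
  then have "MO_Sobolev_norm S H (\<lambda>x. u x - v x) < \<epsilon>" using \<epsilon> by (simp add: l_def)
  then show ?thesis using v_Cinf v_in by blast
qed

end

section \<open>The logarithmic double phase integrand\<close>

lemma hoelder_on_imp_continuous_on: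
  assumes "hoelder_on \<gamma> T f"
  shows "continuous_on T f"
  unfolding continuous_on_def
proof
  fix x assume x: "x \<in> T"
  obtain c where c: "\<And>x y. x \<in> T \<Longrightarrow> y \<in> T \<Longrightarrow> \<bar>f x - f y\<bar> \<le> c * dist x y powr \<gamma>" and \<gamma>: "\<gamma> > 0"
    using assms unfolding hoelder_on_def by blast
  have d: "((\<lambda>y. dist y x) \<longlongrightarrow> 0) (at x within T)"
    using tendsto_dist[OF tendsto_ident_at[of x T] tendsto_const[of x]] by simp
  have "((\<lambda>y. dist y x powr \<gamma>) \<longlongrightarrow> 0) (at x within T)"
    by (rule tendsto_zero_powrI[OF d tendsto_const _ \<gamma>]) simp
  then have "((\<lambda>y. c * dist y x powr \<gamma>) \<longlongrightarrow> 0) (at x within T)"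
    by (rule tendsto_mult_right_zero)
  then have "((\<lambda>y. f y - f x) \<longlongrightarrow> 0) (at x within T)"
  proof (rule Lim_null_comparison[rotated])
    show "\<forall>\<^sub>F y in at x within T. norm (f y - f x) \<le> c * dist y x powr \<gamma>"
      using c x by (auto simp: eventually_at_filter)
  qed
  then show "(f \<longlongrightarrow> f x) (at x within T)" by (rule LIM_zero_cancel)
qed

lemma hoelder_onE:
  assumes "hoelder_on \<gamma> T f"
  obtains c where "0 < \<gamma>" "0 \<le> c" "\<And>x y r. x \<in> T \<Longrightarrow> y \<in> T \<Longrightarrow> dist x y \<le> r \<Longrightarrow> \<bar>f x - f y\<bar> \<le> c * r powr \<gamma>"
proof -
  obtain c where c: "\<And>x y. x \<in> T \<Longrightarrow> y \<in> T \<Longrightarrow> \<bar>f x - f y\<bar> \<le> c * dist x y powr \<gamma>" and \<gamma>: "\<gamma> > 0"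
    using assms unfolding hoelder_on_def by blast
  have "\<bar>f x - f y\<bar> \<le> \<bar>c\<bar> * r powr \<gamma>" if "x \<in> T" "y \<in> T" "dist x y \<le> r" for x y r
  proof -
    have "\<bar>f x - f y\<bar> \<le> \<bar>c\<bar> * dist x y powr \<gamma>"
      using c[OF that(1,2)] mult_right_mono[OF abs_ge_self[of c], of "dist x y powr \<gamma>"] by simp
    also have "\<dots> \<le> \<bar>c\<bar> * r powr \<gamma>" using that \<gamma> by (intro mult_left_mono powr_mono2) auto
    finally show ?thesis .
  qed
  then show ?thesis using that[of "\<bar>c\<bar>"] \<gamma> by auto
qed

lemma ln_exp1_ge_1: "0 \<le> t \<Longrightarrow> 1 \<le> ln (exp 1 + t :: real)"
  by (subst ln_exp[of 1, symmetric], subst ln_le_cancel_iff) (auto intro: add_pos_nonneg)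

lemma powr_ratio_mono:
  fixes s t p :: real
  assumes "0 < s" "s \<le> t" "1 \<le> p"
  shows "t * s powr p \<le> s * t powr p"
proof -
  have "t * s powr p = t * (s * s powr (p - 1))" using assms by (simp add: powr_diff)
  also have "\<dots> \<le> t * (s * t powr (p - 1))" using assms by (intro mult_left_mono powr_mono2) auto
  also have "\<dots> = s * t powr p" using assms by (simp add: powr_diff)
  finally show ?thesis .
qed

lemma H_log_nonneg: "0 \<le> \<mu> x \<Longrightarrow> 0 \<le> t \<Longrightarrow> 0 \<le> H_log p q \<mu> x t"
  using ln_exp1_ge_1[of t] by (simp add: H_log_def)

lemma H_log_ratio:
  assumes "1 \<le> p x" "1 \<le> q x" "0 \<le> \<mu> x" "0 < s" "s \<le> t"
  shows "t * H_log p q \<mu> x s \<le> s * H_log p q \<mu> x t"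
proof -
  have "t * s powr p x \<le> s * t powr p x" by (rule powr_ratio_mono) (use assms in auto)
  moreover have "(t * s powr q x) * ln (exp 1 + s) \<le> (s * t powr q x) * ln (exp 1 + t)"
  proof (rule mult_mono[OF powr_ratio_mono])
    show "ln (exp 1 + s) \<le> ln (exp 1 + t)" using assms by (subst ln_le_cancel_iff) (auto intro: add_pos_nonneg)
    show "0 \<le> ln (exp 1 + s)" using ln_exp1_ge_1[of s] assms by simp
  qed (use assms in auto)
  then have "\<mu> x * ((t * s powr q x) * ln (exp 1 + s)) \<le> \<mu> x * ((s * t powr q x) * ln (exp 1 + t))"
    using assms(3) by (rule mult_left_mono)
  ultimately show ?thesis by (simp add: H_log_def algebra_simps)
qed

lemma H_log_scale:
  assumes "p x \<le> Q" "q x \<le> Q" "0 \<le> \<mu> x" "1 \<le> L" "0 \<le> t"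
  shows "H_log p q \<mu> x (L * t) \<le> (L powr Q * (1 + ln L)) * H_log p q \<mu> x t"
proof -
  have lnL: "0 \<le> ln L" using assms by simp
  have ln1: "1 \<le> ln (exp 1 + t)" by (rule ln_exp1_ge_1[OF assms(5)])
  have "exp 1 + L * t \<le> L * (exp 1 + t)" using assms(4) by (simp add: distrib_left)
  then have "ln (exp 1 + L * t) \<le> ln (L * (exp 1 + t))"
    using assms by (subst ln_le_cancel_iff) (auto intro!: add_pos_nonneg mult_pos_pos)
  also have "\<dots> = ln L + ln (exp 1 + t)" using assms add_pos_nonneg[of "exp 1" t] by (simp add: ln_mult)
  also have "\<dots> \<le> (1 + ln L) * ln (exp 1 + t)"
    using mult_left_mono[OF ln1 lnL] by (simp add: distrib_right)
  finally have l: "ln (exp 1 + L * t) \<le> (1 + ln L) * ln (exp 1 + t)" .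
  have P: "(L * t) powr a \<le> L powr Q * t powr a" if "a \<le> Q" for a
    using assms that by (simp add: powr_mult) (intro mult_right_mono powr_mono, auto)
  have "(L * t) powr p x \<le> (L powr Q * (1 + ln L)) * t powr p x"
  proof -
    have "L powr Q * t powr p x * 1 \<le> L powr Q * t powr p x * (1 + ln L)"
      using lnL by (intro mult_left_mono) auto
    then show ?thesis using P[OF assms(1)] by (simp add: mult_ac)
  qed
  moreover have "\<mu> x * ((L * t) powr q x * ln (exp 1 + L * t)) \<le>
      \<mu> x * ((L powr Q * t powr q x) * ((1 + ln L) * ln (exp 1 + t)))"
    using P[OF assms(2)] l assms ln_exp1_ge_1[of "L * t"]
    by (intro mult_left_mono mult_mono) auto
  ultimately show ?thesis by (simp add: H_log_def algebra_simps)
qed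

text \<open>Hoelder continuity implies log-Hoelder continuity: \<open>r\<^sup>\<alpha> ln (1 / r)\<close> is bounded, and \<open>ln t\<close>
  is at most of order \<open>1 + ln (1 / r)\<close>.\<close>

lemma powr_small_exponent_bounded:
  fixes \<alpha> c K R :: real
  assumes \<alpha>: "\<alpha> > 0" and c: "c \<ge> 0" and K: "K \<ge> 1"
  shows "\<exists>C\<ge>1. \<forall>r t. 0 < r \<and> r \<le> R \<and> 1 \<le> t \<and> t \<le> K * (1/r) ^ N \<longrightarrow> t powr (c * r powr \<alpha>) \<le> C"
proof -
  define C where "C = exp (c * (\<bar>R\<bar> powr \<alpha> * ln K + real N / \<alpha>))"
  have "t powr (c * r powr \<alpha>) \<le> C" if r: "0 < r" "r \<le> R" and t: "1 \<le> t" "t \<le> K * (1/r) ^ N" for r t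
  proof -
    have "ln t \<le> ln (K * (1/r) ^ N)" using t by (subst ln_le_cancel_iff) auto
    also have "\<dots> = ln K + real N * ln (1/r)" using r K by (subst ln_mult) (auto simp: ln_realpow)
    finally have lt: "ln t \<le> ln K + real N * ln (1/r)" .
    have "\<alpha> * ln (1/r) = ln (r powr (- \<alpha>))" using r by (simp add: ln_powr ln_div)
    also have "\<dots> \<le> r powr (- \<alpha>)" using ln_le_minus_one[of "r powr (- \<alpha>)"] r by simp
    finally have "r powr \<alpha> * (\<alpha> * ln (1/r)) \<le> r powr \<alpha> * r powr (- \<alpha>)" by (intro mult_left_mono) auto
    also have "\<dots> = 1" using r by (simp flip: powr_add)
    finally have lr: "r powr \<alpha> * ln (1/r) \<le> 1 / \<alpha>" using \<alpha> by (simp add: field_simps)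
    have "r powr \<alpha> * ln t \<le> r powr \<alpha> * (ln K + real N * ln (1/r))" using lt by (intro mult_left_mono) auto
    also have "\<dots> = r powr \<alpha> * ln K + real N * (r powr \<alpha> * ln (1/r))" by (simp add: algebra_simps)
    also have "\<dots> \<le> \<bar>R\<bar> powr \<alpha> * ln K + real N * (1 / \<alpha>)"
      using lr K r \<alpha> by (intro add_mono mult_right_mono mult_left_mono powr_mono2) auto
    finally have "c * (r powr \<alpha> * ln t) \<le> c * (\<bar>R\<bar> powr \<alpha> * ln K + real N / \<alpha>)"
      using c by (intro mult_left_mono) auto
    then show ?thesis using t by (simp add: powr_def C_def mult_ac)
  qed
  moreover have "1 \<le> C" using c K \<alpha> by (auto simp: C_def intro!: mult_nonneg_nonneg add_nonneg_nonneg)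
  ultimately show ?thesis by blast
qed

lemma ln_le_powr:
  fixes t \<sigma> :: real
  assumes "\<sigma> > 0" "t \<ge> 1"
  shows "ln (exp 1 + t) \<le> 4 powr \<sigma> / \<sigma> * t powr \<sigma>"
proof -
  have pos: "exp 1 + t > 0" using assms by (intro add_pos_pos) auto
  have "\<sigma> * ln (exp 1 + t) = ln ((exp 1 + t) powr \<sigma>)" using pos by (simp add: ln_powr)
  also have "\<dots> \<le> (exp 1 + t) powr \<sigma>" using ln_le_minus_one[of "(exp 1 + t) powr \<sigma>"] pos by simp
  also have "\<dots> \<le> (4 * t) powr \<sigma>"
    using assms exp_le pos by (intro powr_mono2) auto
  also have "\<dots> = 4 powr \<sigma> * t powr \<sigma>" using assms by (simp add: powr_mult)
  finally show ?thesis using assms by (simp add: field_simps)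
qed

text \<open>For \<open>t < 1\<close> the left side is bounded. For \<open>t \<ge> 1\<close> the size bound gives \<open>t\<^sup>p\<^sup>(\<^sup>y\<^sup>) \<le> A\<close> with
  \<open>A = L r\<^sup>-\<^sup>N\<close>, so \<open>t \<le> A\<close>. In the term with \<open>r\<^sup>\<gamma>\<close>, the bound \<open>q \<le> \<kappa> p\<close> costs \<open>A\<^sup>\<kappa>\<^sup>-\<^sup>1\<close> and the
  logarithm costs \<open>A\<^sup>\<sigma>\<close>; the exponent \<open>\<sigma> = \<gamma> / N - (\<kappa> - 1)\<close> is chosen so that the product \<open>A\<^sup>\<gamma>\<^sup>/\<^sup>N\<close>
  cancels \<open>r\<^sup>\<gamma>\<close> exactly, and the hypothesis on \<open>\<kappa>\<close> makes it positive.\<close>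

lemma H_log_comparison:
  fixes p q \<mu> :: "'a::metric_space \<Rightarrow> real" and N :: nat
  assumes hp: "hoelder_on \<alpha>p T p" and hq: "hoelder_on \<alpha>q T q" and h\<mu>: "hoelder_on \<gamma> T \<mu>"
    and pq: "\<And>x. x \<in> T \<Longrightarrow> 1 \<le> p x \<and> p x \<le> q x" and \<mu>: "\<And>x. x \<in> T \<Longrightarrow> 0 \<le> \<mu> x \<and> \<mu> x \<le> M"
    and \<kappa>: "\<And>x. x \<in> T \<Longrightarrow> q x \<le> \<kappa> * p x" "1 \<le> \<kappa>" "\<kappa> < 1 + \<gamma> / real N" and N: "N > 0"
  shows "\<exists>C\<ge>0. \<forall>x\<in>T. \<forall>y\<in>T. \<forall>r t. 0 < r \<and> r \<le> R \<and> dist x y \<le> r \<and> 0 \<le> t \<and>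
        H_log p q \<mu> y t \<le> K * (1 / r) ^ N \<longrightarrow> H_log p q \<mu> x t \<le> C * (1 + H_log p q \<mu> y t)"
proof -
  obtain cp where cp: "0 < \<alpha>p" "0 \<le> cp" "\<And>x y r. x \<in> T \<Longrightarrow> y \<in> T \<Longrightarrow> dist x y \<le> r \<Longrightarrow> \<bar>p x - p y\<bar> \<le> cp * r powr \<alpha>p"
    using hoelder_onE[OF hp] by metis
  obtain cq where cq: "0 < \<alpha>q" "0 \<le> cq" "\<And>x y r. x \<in> T \<Longrightarrow> y \<in> T \<Longrightarrow> dist x y \<le> r \<Longrightarrow> \<bar>q x - q y\<bar> \<le> cq * r powr \<alpha>q"
    using hoelder_onE[OF hq] by metis
  obtain c\<mu> where c\<mu>: "0 < \<gamma>" "0 \<le> c\<mu>" "\<And>x y r. x \<in> T \<Longrightarrow> y \<in> T \<Longrightarrow> dist x y \<le> r \<Longrightarrow> \<bar>\<mu> x - \<mu> y\<bar> \<le> c\<mu> * r powr \<gamma>"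
    using hoelder_onE[OF h\<mu>] by metis
  define L where "L = max 1 K"
  have L: "L \<ge> 1" "K \<le> L" by (auto simp: L_def)
  obtain Cp where Cp: "Cp \<ge> 1" "\<And>r t. 0 < r \<Longrightarrow> r \<le> R \<Longrightarrow> 1 \<le> t \<Longrightarrow> t \<le> L * (1/r) ^ N \<Longrightarrow> t powr (cp * r powr \<alpha>p) \<le> Cp"
    using powr_small_exponent_bounded[OF cp(1,2) L(1), of R N] by blast
  obtain Cq where Cq: "Cq \<ge> 1" "\<And>r t. 0 < r \<Longrightarrow> r \<le> R \<Longrightarrow> 1 \<le> t \<Longrightarrow> t \<le> L * (1/r) ^ N \<Longrightarrow> t powr (cq * r powr \<alpha>q) \<le> Cq"
    using powr_small_exponent_bounded[OF cq(1,2) L(1), of R N] by blast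
  define \<sigma> where "\<sigma> = \<gamma> / real N - (\<kappa> - 1)"
  have \<sigma>: "\<sigma> > 0" using \<kappa>(3) by (simp add: \<sigma>_def)
  define X where "X = c\<mu> * (Cp powr \<kappa> * (4 powr \<sigma> / \<sigma>) * L powr (\<gamma> / real N))"
  have X: "X \<ge> 0" using c\<mu>(2) \<sigma> by (simp add: X_def)
  define Y where "Y = 1 + \<bar>M\<bar> * ln (exp 1 + 1)"
  have ln2: "ln (exp 1 + 1 :: real) \<ge> 1" by (rule ln_exp1_ge_1) simp
  have Y: "Y \<ge> 0" using ln2 by (simp add: Y_def)
  define C where "C = Cp + Cq + X + Y"
  have "H_log p q \<mu> x t \<le> C * (1 + H_log p q \<mu> y t)"
    if x: "x \<in> T" and y: "y \<in> T" and r: "0 < r" "r \<le> R" and d: "dist x y \<le> r" and t: "0 \<le> t"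
      and Hy: "H_log p q \<mu> y t \<le> K * (1 / r) ^ N" for x y r t
  proof -
    let ?h = "H_log p q \<mu> y t"
    have h0: "?h \<ge> 0" using \<mu>[OF y] t by (intro H_log_nonneg) auto
    show ?thesis
    proof (cases "t < 1")
      case True
      have "H_log p q \<mu> x t \<le> 1 + \<bar>M\<bar> * (1 * ln (exp 1 + 1))"
        unfolding H_log_def mult.assoc
      proof (intro add_mono mult_mono)
        show "t powr p x \<le> 1" "t powr q x \<le> 1" using True t pq[OF x] by (auto intro!: powr_le1)
        show "\<mu> x \<le> \<bar>M\<bar>" using \<mu>[OF x] by auto
        show "ln (exp 1 + t) \<le> ln (exp 1 + 1)" using True t by (subst ln_le_cancel_iff) (auto intro: add_pos_nonneg)
      qed (use ln_exp1_ge_1[OF t] \<mu>[OF x] in auto)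
      also have "\<dots> = Y * 1" by (simp add: Y_def)
      also have "\<dots> \<le> C * (1 + ?h)"
        using Cp(1) Cq(1) X Y h0 by (intro mult_mono) (auto simp: C_def)
      finally show ?thesis .
    next
      case False
      then have t1: "1 \<le> t" by simp
      have ln1: "1 \<le> ln (exp 1 + t)" by (rule ln_exp1_ge_1[OF t])
      define A where "A = L * (1/r) ^ N"
      have A: "A > 0" using L r by (simp add: A_def)
      have tp_h: "t powr p y \<le> ?h"
        using \<mu>[OF y] ln1 by (auto simp: H_log_def)
      have h_A: "?h \<le> A"
      proof -
        have "K * (1/r) ^ N \<le> L * (1/r) ^ N" using L(2) r by (intro mult_right_mono) auto
        then show ?thesis unfolding A_def by (rule order_trans[OF Hy])
      qed
      have "t powr 1 \<le> t powr p y" using t1 pq[OF y] by (intro powr_mono) auto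
      then have t_A: "t \<le> A" using t1 tp_h h_A by simp
      have tp: "t powr p x \<le> Cp * t powr p y"
      proof -
        have "t powr p x \<le> t powr (cp * r powr \<alpha>p + p y)"
          using cp(3)[OF x y d] t1 by (intro powr_mono) auto
        also have "\<dots> = t powr (cp * r powr \<alpha>p) * t powr p y" by (rule powr_add)
        also have "\<dots> \<le> Cp * t powr p y"
          using Cp(2)[OF r t1] t_A by (intro mult_right_mono) (auto simp: A_def)
        finally show ?thesis .
      qed
      have tq: "t powr q x \<le> Cq * t powr q y"
      proof -
        have "t powr q x \<le> t powr (cq * r powr \<alpha>q + q y)"
          using cq(3)[OF x y d] t1 by (intro powr_mono) auto
        also have "\<dots> = t powr (cq * r powr \<alpha>q) * t powr q y" by (rule powr_add)
        also have "\<dots> \<le> Cq * t powr q y"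
          using Cq(2)[OF r t1] t_A by (intro mult_right_mono) (auto simp: A_def)
        finally show ?thesis .
      qed
      have 1: "t powr p x \<le> Cp * ?h"
        using tp tp_h Cp(1) by (meson mult_left_mono order_trans zero_le_one)
      have 2: "\<mu> y * (t powr q x * ln (exp 1 + t)) \<le> Cq * ?h"
      proof -
        have "\<mu> y * (t powr q x * ln (exp 1 + t)) \<le> \<mu> y * ((Cq * t powr q y) * ln (exp 1 + t))"
          using tq \<mu>[OF y] ln1 by (intro mult_left_mono mult_right_mono) auto
        also have "\<dots> = Cq * (\<mu> y * t powr q y * ln (exp 1 + t))" by (simp add: mult_ac)
        also have "\<dots> \<le> Cq * ?h" using Cq(1) by (intro mult_left_mono) (auto simp: H_log_def)
        finally show ?thesis .
      qed
      have 3: "(c\<mu> * r powr \<gamma>) * (t powr q x * ln (exp 1 + t)) \<le> X * ?h"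
      proof -
        have "t powr q x \<le> t powr (p x * \<kappa>)" using \<kappa>(1)[OF x] t1 by (intro powr_mono) (auto simp: mult.commute)
        also have "\<dots> = (t powr p x) powr \<kappa>" by (simp add: powr_powr)
        also have "\<dots> \<le> (Cp * t powr p y) powr \<kappa>" using tp \<kappa>(2) by (intro powr_mono2) auto
        also have "\<dots> = Cp powr \<kappa> * ((t powr p y) powr (1 + (\<kappa> - 1)))" using Cp(1) by (simp add: powr_mult)
        also have "(t powr p y) powr (1 + (\<kappa> - 1)) = t powr p y * (t powr p y) powr (\<kappa> - 1)"
          using t1 by (subst powr_add) simp
        also have "Cp powr \<kappa> * (t powr p y * (t powr p y) powr (\<kappa> - 1)) \<le> Cp powr \<kappa> * (?h * A powr (\<kappa> - 1))"
          using tp_h h_A \<kappa>(2) h0 by (intro mult_left_mono mult_mono powr_mono2) auto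
        finally have a: "t powr q x \<le> Cp powr \<kappa> * (?h * A powr (\<kappa> - 1))" .
        have "ln (exp 1 + t) \<le> 4 powr \<sigma> / \<sigma> * t powr \<sigma>" by (rule ln_le_powr[OF \<sigma> t1])
        also have "\<dots> \<le> 4 powr \<sigma> / \<sigma> * A powr \<sigma>" using \<sigma> t1 t_A by (intro mult_left_mono powr_mono2) auto
        finally have b: "ln (exp 1 + t) \<le> 4 powr \<sigma> / \<sigma> * A powr \<sigma>" .
        have "(c\<mu> * r powr \<gamma>) * (t powr q x * ln (exp 1 + t)) \<le>
            (c\<mu> * r powr \<gamma>) * ((Cp powr \<kappa> * (?h * A powr (\<kappa> - 1))) * (4 powr \<sigma> / \<sigma> * A powr \<sigma>))"
          using a b c\<mu>(2) ln1 h0 by (intro mult_left_mono mult_mono) auto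
        also have "\<dots> = c\<mu> * (Cp powr \<kappa> * (4 powr \<sigma> / \<sigma>)) * ?h * (r powr \<gamma> * (A powr (\<kappa> - 1) * A powr \<sigma>))"
          by (simp add: mult_ac)
        also have "A powr (\<kappa> - 1) * A powr \<sigma> = A powr (\<gamma> / real N)" by (simp add: \<sigma>_def flip: powr_add)
        also have "\<dots> = L powr (\<gamma> / real N) * r powr (- \<gamma>)"
        proof -
          have "(1/r) ^ N = r powr (- real N)" using r by (simp add: powr_minus powr_realpow power_one_over inverse_eq_divide)
          then have "A powr (\<gamma> / real N) = L powr (\<gamma> / real N) * (r powr (- real N)) powr (\<gamma> / real N)"
            using L r by (simp add: A_def powr_mult)
          also have "(r powr (- real N)) powr (\<gamma> / real N) = r powr (- \<gamma>)" using N by (simp add: powr_powr)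
          finally show ?thesis .
        qed
        also have "r powr \<gamma> * (L powr (\<gamma> / real N) * r powr (- \<gamma>)) = L powr (\<gamma> / real N)"
          using r by (simp add: powr_minus)
        finally show ?thesis by (simp add: X_def mult_ac)
      qed
      have "\<mu> x \<le> \<mu> y + c\<mu> * r powr \<gamma>" using c\<mu>(3)[OF x y d] by auto
      then have "\<mu> x * (t powr q x * ln (exp 1 + t)) \<le> (\<mu> y + c\<mu> * r powr \<gamma>) * (t powr q x * ln (exp 1 + t))"
        using ln1 by (intro mult_right_mono) auto
      also have "\<dots> \<le> Cq * ?h + X * ?h" using 2 3 by (simp add: distrib_right)
      finally have "H_log p q \<mu> x t \<le> Cp * ?h + (Cq * ?h + X * ?h)"
        using 1 by (simp add: H_log_def mult.assoc)
      also have "\<dots> \<le> C * ?h" using Y h0 by (simp add: C_def distrib_right)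
      also have "\<dots> \<le> C * (1 + ?h)" using Cp(1) Cq(1) X Y by (intro mult_left_mono) (auto simp: C_def)
      finally show ?thesis .
    qed
  qed
  moreover have "C \<ge> 0" using Cp(1) Cq(1) X Y by (simp add: C_def)
  ultimately show ?thesis by blast
qed

text \<open>If \<open>H x (\<tau> / b) < s\<close>, the comparison gives \<open>H y (\<tau> / b) \<le> 2 C s\<close>, and the monotone ratio
  turns this into \<open>H y \<tau> \<le> 2 b C s < s\<close> when \<open>b\<close> is small. So every \<open>\<tau>\<close> that competes in the
  infimum at \<open>y\<close> yields the competitor \<open>\<tau> / b\<close> at \<open>x\<close>.\<close>

lemma cond_A1_of_comparison:
  fixes H :: "'a::euclidean_space \<Rightarrow> real \<Rightarrow> real"
  assumes ratio: "\<And>x s t. x \<in> S \<Longrightarrow> 0 < s \<Longrightarrow> s \<le> t \<Longrightarrow> t * H x s \<le> s * H x t"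
    and zero: "\<And>x. x \<in> S \<Longrightarrow> H x 0 = 0"
    and nonneg: "\<And>x t. x \<in> S \<Longrightarrow> 0 \<le> t \<Longrightarrow> 0 \<le> H x t"
    and comparison: "\<And>K R. \<exists>C\<ge>0. \<forall>x\<in>S. \<forall>y\<in>S. \<forall>r t. 0 < r \<and> r \<le> R \<and> dist x y \<le> r \<and> 0 \<le> t \<and>
        H y t \<le> K * (1 / r) ^ DIM('a) \<longrightarrow> H x t \<le> C * (1 + H y t)"
  shows "cond_A1 S (\<lambda>x t. ennreal (H x t))"
proof -
  define \<omega> where "\<omega> = unit_ball_vol (DIM('a))"
  have \<omega>: "\<omega> > 0" by (simp add: \<omega>_def unit_ball_vol_pos)
  \<comment> \<open>Two points of a ball of radius \<open>r\<close> are at most \<open>2 r\<close> apart, hence the powers of two. If the ball has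
    measure at most one, then \<open>r \<le> max 1 (1 / \<omega>)\<close>.\<close>
  define R where "R = 2 * max 1 (1 / \<omega>)"
  define K where "K = 2 ^ DIM('a) / \<omega>"
  obtain C0 where C0: "\<And>x y r t. x \<in> S \<Longrightarrow> y \<in> S \<Longrightarrow> 0 < r \<Longrightarrow> r \<le> R \<Longrightarrow> dist x y \<le> r \<Longrightarrow> 0 \<le> t \<Longrightarrow>
        H y t \<le> K * (1 / r) ^ DIM('a) \<Longrightarrow> H x t \<le> C0 * (1 + H y t)"
    using comparison[of R K] by blast
  define C where "C = max 1 C0"
  have C: "C \<ge> 1" "C0 \<le> C" by (auto simp: C_def)
  define b where "b = 1 / (4 * C)"
  have b: "0 < b" "b < 1" using C by (auto simp: b_def)
  have key: "ennreal b * left_inverse (\<lambda>x t. ennreal (H x t)) x s \<le> left_inverse (\<lambda>x t. ennreal (H x t)) y s"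
    if z: "0 < r" "measure lebesgue (ball z r) \<le> 1" and x: "x \<in> ball z r \<inter> S" and y: "y \<in> ball z r \<inter> S"
      and s: "s \<in> {1..1 / measure lebesgue (ball z r)}" for x y z r s
  proof -
    have m: "measure lebesgue (ball z r) = \<omega> * r ^ DIM('a)"
      using content_ball[of r z] z by (simp add: \<omega>_def)
    have s1: "1 \<le> s" and s2: "s \<le> K * (1 / (2 * r)) ^ DIM('a)"
      using s by (auto simp: m K_def power_mult_distrib power_divide)
    have rR: "2 * r \<le> R"
    proof (cases "r \<le> 1")
      case False
      then have "r \<le> r ^ DIM('a)" using self_le_power[of r "DIM('a)"] by simp
      also have "\<dots> \<le> 1 / \<omega>" using z(2) \<omega> by (simp add: m field_simps)
      finally show ?thesis by (simp add: R_def)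
    qed (simp add: R_def)
    have d: "dist y x \<le> 2 * r"
      using x y dist_triangle[of y x z] by (auto simp: dist_commute)
    have main: "s \<le> H x (\<tau> / b)" if \<tau>: "0 \<le> \<tau>" "s \<le> H y \<tau>" for \<tau>
    proof (rule ccontr)
      assume "\<not> s \<le> H x (\<tau> / b)"
      then have lt: "H x (\<tau> / b) < s" by simp
      have \<tau>b: "0 \<le> \<tau> / b" using \<tau> b by simp
      have "H y (\<tau> / b) \<le> C0 * (1 + H x (\<tau> / b))"
        using lt s2 z rR d \<tau>b x y by (intro C0[of y x "2 * r"]) auto
      also have "\<dots> \<le> C * (2 * s)"
        using C lt s1 nonneg[of x "\<tau> / b"] \<tau>b x by (intro mult_mono) auto
      finally have up: "H y (\<tau> / b) \<le> C * (2 * s)" .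
      have "\<tau> \<noteq> 0" using zero[of y] y \<tau>(2) s1 by auto
      then have \<tau>0: "0 < \<tau>" using \<tau>(1) by simp
      have "\<tau> * 1 \<le> \<tau> * (1 / b)" using \<tau>0 b by (intro mult_left_mono) auto
      then have "(\<tau> / b) * H y \<tau> \<le> \<tau> * H y (\<tau> / b)" using \<tau>0 y by (intro ratio) auto
      then have "H y \<tau> \<le> b * H y (\<tau> / b)" using \<tau>0 b by (simp add: field_simps)
      also have "\<dots> \<le> b * (C * (2 * s))" using up b by (intro mult_left_mono) auto
      also have "\<dots> = s / 2" using C by (simp add: b_def)
      finally show False using \<tau>(2) s1 by simp
    qed
    show ?thesis
      unfolding left_inverse_def[of _ y]
    proof (rule Inf_greatest, clarify)
      fix \<tau> :: real assume \<tau>: "0 \<le> \<tau>" "ennreal s \<le> ennreal (H y \<tau>)"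
      have "s \<le> H y \<tau>" using \<tau> s1 nonneg[of y \<tau>] y by (simp add: ennreal_le_iff)
      from main[OF \<tau>(1) this] have "left_inverse (\<lambda>x t. ennreal (H x t)) x s \<le> ennreal (\<tau> / b)"
        unfolding left_inverse_def using \<tau>(1) b by (intro Inf_lower) (auto intro: ennreal_leI)
      then have "ennreal b * left_inverse (\<lambda>x t. ennreal (H x t)) x s \<le> ennreal b * ennreal (\<tau> / b)"
        by (rule mult_left_mono) simp
      also have "\<dots> = ennreal \<tau>" using b \<tau>(1) by (simp flip: ennreal_mult)
      finally show "ennreal b * left_inverse (\<lambda>x t. ennreal (H x t)) x s \<le> ennreal \<tau>" .
    qed
  qed
  show ?thesis
    unfolding cond_A1_def
  proof (intro exI[of _ b] conjI allI impI b bexI[of _ "{}"] ballI)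
    fix z r x y s
    assume "0 < r \<and> measure lebesgue (ball z r) \<le> 1" "x \<in> ball z r \<inter> S - {}" "y \<in> ball z r \<inter> S - {}"
      "s \<in> {1..1 / measure lebesgue (ball z r)}"
    then show "ennreal b * left_inverse (\<lambda>x t. ennreal (H x t)) x s \<le> left_inverse (\<lambda>x t. ennreal (H x t)) y s"
      by (intro key[of r z]) auto
  qed simp
qed

theorem theorem3p12:
  fixes \<Omega> :: "'a::euclidean_space set"
    and p q \<mu> :: "'a \<Rightarrow> real"
    and \<alpha>p \<alpha>q \<gamma> :: real
  assumes "DIM('a) \<ge> 2"
    and "open \<Omega>" and "connected \<Omega>" and "\<Omega> \<noteq> {}" and "bounded \<Omega>"
    and "hoelder_on \<alpha>p (closure \<Omega>) p"
    and "hoelder_on \<alpha>q (closure \<Omega>) q"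
    and "hoelder_on \<gamma> (closure \<Omega>) \<mu>"
    and "\<And>x. x \<in> closure \<Omega> \<Longrightarrow> 1 < p x \<and> p x \<le> q x"
    and "\<And>x. x \<in> closure \<Omega> \<Longrightarrow> 0 \<le> \<mu> x"
    and "(SUP x\<in>closure \<Omega>. q x / p x) < 1 + \<gamma> / real DIM('a)"
  shows "cond_A1 \<Omega> (\<lambda>x t. ennreal (H_log p q \<mu> x t)) \<and>
    (\<forall>u\<in>MO_Sobolev \<Omega> (H_log p q \<mu>). \<forall>\<epsilon>>0.
       \<exists>v\<in>{v. Cinf_on \<Omega> v} \<inter> MO_Sobolev \<Omega> (H_log p q \<mu>).
         MO_Sobolev_norm \<Omega> (H_log p q \<mu>) (\<lambda>x. u x - v x) < \<epsilon>)"
proof -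
  have sub: "x \<in> closure \<Omega>" if "x \<in> \<Omega>" for x using that closure_subset by blast
  have pq: "1 < p x" "p x \<le> q x" "1 \<le> p x" "1 \<le> q x" if "x \<in> closure \<Omega>" for x
    using assms(9)[OF that] by auto
  have comp: "compact (closure \<Omega>)" using assms(5) compact_closure by blast
  have cont: "continuous_on (closure \<Omega>) p" "continuous_on (closure \<Omega>) q" "continuous_on (closure \<Omega>) \<mu>"
    using assms(6-8) by (auto intro: hoelder_on_imp_continuous_on)
  have bdd: "bdd_above (f ` closure \<Omega>)" if "continuous_on (closure \<Omega>) f" for f :: "'a \<Rightarrow> real"
    using compact_continuous_image[OF that comp] by (intro bounded_imp_bdd_above compact_imp_bounded)
  obtain Q where Q: "\<And>x. x \<in> closure \<Omega> \<Longrightarrow> q x \<le> Q" using bdd[OF cont(2)] by (auto simp: bdd_above_def)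
  obtain M where M: "\<And>x. x \<in> closure \<Omega> \<Longrightarrow> \<mu> x \<le> M" using bdd[OF cont(3)] by (auto simp: bdd_above_def)
  define \<kappa> where "\<kappa> = (SUP x\<in>closure \<Omega>. q x / p x)"
  have "continuous_on (closure \<Omega>) (\<lambda>x. q x / p x)"
    using cont pq(1) by (intro continuous_on_divide) force+
  from bdd[OF this] have \<kappa>_ge: "q x / p x \<le> \<kappa>" if "x \<in> closure \<Omega>" for x
    unfolding \<kappa>_def using that by (intro cSUP_upper)
  have \<kappa>1: "q x \<le> \<kappa> * p x" if "x \<in> closure \<Omega>" for x
    using \<kappa>_ge[OF that] pq(1)[OF that] by (simp add: divide_le_eq)
  obtain x0 where x0: "x0 \<in> \<Omega>" using assms(4) by blast
  have \<kappa>2: "1 \<le> \<kappa>"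
  proof -
    have "1 \<le> q x0 / p x0" using pq[OF sub[OF x0]] by simp
    then show ?thesis using \<kappa>_ge[OF sub[OF x0]] by linarith
  qed
  have \<kappa>3: "\<kappa> < 1 + \<gamma> / real DIM('a)" using assms(11) by (simp add: \<kappa>_def)
  have comparison: "\<exists>C\<ge>0. \<forall>x\<in>\<Omega>. \<forall>y\<in>\<Omega>. \<forall>r t. 0 < r \<and> r \<le> R \<and> dist x y \<le> r \<and> 0 \<le> t \<and>
        H_log p q \<mu> y t \<le> K * (1 / r) ^ DIM('a) \<longrightarrow> H_log p q \<mu> x t \<le> C * (1 + H_log p q \<mu> y t)" for K R
  proof -
    have a: "1 \<le> p x \<and> p x \<le> q x" "0 \<le> \<mu> x \<and> \<mu> x \<le> M" if "x \<in> closure \<Omega>" for x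
      using pq[OF that] assms(10)[OF that] M[OF that] by auto
    obtain C where C: "C \<ge> 0" "\<forall>x\<in>closure \<Omega>. \<forall>y\<in>closure \<Omega>. \<forall>r t. 0 < r \<and> r \<le> R \<and> dist x y \<le> r \<and> 0 \<le> t \<and>
        H_log p q \<mu> y t \<le> K * (1 / r) ^ DIM('a) \<longrightarrow> H_log p q \<mu> x t \<le> C * (1 + H_log p q \<mu> y t)"
      using H_log_comparison[OF assms(6-8) a \<kappa>1 \<kappa>2 \<kappa>3 DIM_positive, of R K] by auto
    show ?thesis
      by (intro exI[of _ C] conjI ballI C(1)) (rule C(2)[THEN bspec, THEN bspec, OF sub sub], assumption+)
  qed
  have ratio: "t * H_log p q \<mu> x s \<le> s * H_log p q \<mu> x t" if "x \<in> \<Omega>" "0 < s" "s \<le> t" for x s t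
    using that pq[OF sub] assms(10)[OF sub] by (intro H_log_ratio) auto
  have nonneg: "0 \<le> H_log p q \<mu> x t" if "x \<in> \<Omega>" "0 \<le> t" for x t
    using that assms(10)[OF sub] by (intro H_log_nonneg) auto
  have zero: "H_log p q \<mu> x 0 = 0" for x by (simp add: H_log_def)
  interpret modular_function \<Omega> "H_log p q \<mu>"
  proof
    show "open \<Omega>" "bounded \<Omega>" by fact+
    show "\<exists>C\<ge>0. \<forall>x\<in>\<Omega>. \<forall>t\<ge>0. H_log p q \<mu> x (L * t) \<le> C * H_log p q \<mu> x t" if "1 \<le> L" for L
      using that order_trans[OF pq(2) Q] Q assms(10) sub
      by (intro exI[of _ "L powr Q * (1 + ln L)"] conjI ballI allI impI H_log_scale) auto
    show "t \<le> 1 + H_log p q \<mu> x t" if x: "x \<in> \<Omega>" and t: "0 \<le> t" for x t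
    proof -
      have "t \<le> 1 + t powr p x"
      proof (cases "t \<le> 1")
        case False
        then have "t powr 1 \<le> t powr p x" using pq[OF sub[OF x]] by (intro powr_mono) auto
        then show ?thesis using False by simp
      qed (simp add: add_increasing2)
      also have "\<dots> \<le> 1 + H_log p q \<mu> x t"
        using assms(10)[OF sub[OF x]] ln_exp1_ge_1[OF t] by (simp add: H_log_def)
      finally show ?thesis .
    qed
    show "(\<lambda>x. H_log p q \<mu> x \<bar>f x\<bar>) \<in> borel_measurable (lebesgue_on \<Omega>)"
      if f: "f \<in> borel_measurable (lebesgue_on \<Omega>)" for f
    proof -
      have "g \<in> borel_measurable (lebesgue_on \<Omega>)" if "continuous_on (closure \<Omega>) g" for g :: "'a \<Rightarrow> real"
        using that assms(2) by (intro continuous_imp_measurable_on_sets_lebesgue)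
          (auto intro: continuous_on_subset[OF _ closure_subset])
      from this[OF cont(1)] this[OF cont(2)] this[OF cont(3)] f show ?thesis
        unfolding H_log_def by measurable
    qed
    show "\<exists>C\<ge>0. \<forall>x\<in>\<Omega>. \<forall>y\<in>\<Omega>. \<forall>r t. 0 < r \<and> r \<le> 1 \<and> dist x y \<le> r \<and> 0 \<le> t \<and>
        H_log p q \<mu> y t \<le> K * (1 / r) ^ DIM('a) \<longrightarrow> H_log p q \<mu> x t \<le> C * (1 + H_log p q \<mu> y t)" for K
      by (rule comparison)
  qed (use ratio nonneg zero in auto)
  show ?thesis
    using cond_A1_of_comparison[OF ratio zero nonneg comparison] smooth_approximation by blast
qed

end
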